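(* Let $M$ be a finitely generated $\mathbb{Z}[D]$-module (possibly with $\mathbb{Z}$-torsion). Then \[\mathcal C_\Theta(M)=\bigl(\hat h^0(\Theta,M)\,\hat h^1(\Theta,M)\bigr)^{-1}=\frac{\hat h^{-1}(\Theta,M)}{\hat h^0(\Theta,M)}.\]
   Context: Let $q>1$ be an odd integer, $D=\langle\rho,\sigma:\rho^q=\sigma^2=1,\ \sigma\rho\sigma^{-1}=\rho^{-1}\rangle$ the dihedral group of order $2q$, $R=\langle\rho\rangle$, $\Sigma=\langle\sigma\rangle$, and $\Theta=1+2D-R-2\Sigma$, i.e. the $D$-Brauer relation $\sum_Hn_HH$ with $n_{\{1\}}=1$, $n_D=2$, $n_R=-1$, $n_\Sigma=-2$ and $n_H=0$ for all other subgroups. For a finitely generated $\mathbb{Z}[D]$-module $M$, write $M_{\mathrm{tors}}$ for its $\mathbb{Z}$-torsion subgroup and $M_{\mathrm{tf}}=M/M_{\mathrm{tors}}$; the regulator constant is $\mathcal C_\Theta(M)=\prod_{H\le D}\bigl(|M_{\mathrm{tors}}^H|^{-2}\det(\tfrac{1}{|H|}\langle\cdot,\cdot\rangle|_{(M^H)_{\mathrm{tf}}})\bigr)^{n_H}$, where $\langle\cdot,\cdot\rangle:M\times M\to\mathscr L$ is any $D$-invariant $\mathbb{Z}$-bilinear pairing into a field $\mathscr L\supseteq\mathbb{Q}$ non-degenerate on $M_{\mathrm{tf}}$ and the determinant is taken on a $\mathbb{Z}$-basis of $(M^H)_{\mathrm{tf}}$ (independent of the pairing). For $i\in\mathbb{Z}$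 and $H\le D$, $\hat H^i(H,M)$ is Tate cohomology, $\hat h^i(H,M)=|\hat H^i(H,M)|$, $\hat h^i(\Theta,M)=\prod_H\hat h^i(H,M)^{n_H}$. *)

theory Defs
  imports Main "Jordan_Normal_Form.Determinant"
begin

definition zsmul :: "int \<Rightarrow> 'm::ab_group_add \<Rightarrow> 'm" where
  "zsmul c x = (if 0 \<le> c then (\<Sum>_\<in>{..<nat c}. x) else - (\<Sum>_\<in>{..<nat (-c)}. x))"

definition is_zsubgroup :: "'m::ab_group_add set \<Rightarrow> bool" where
  "is_zsubgroup A \<longleftrightarrow> 0 \<in> A \<and> (\<forall>x\<in>A. \<forall>y\<in>A. x + y \<in> A) \<and> (\<forall>x\<in>A. - x \<in> A)"

definition zspan :: "'m::ab_group_add set \<Rightarrow> 'm set" where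
  "zspan S = \<Inter>{A. S \<subseteq> A \<and> is_zsubgroup A}"

definition tors :: "'m::ab_group_add set" where
  "tors = {x. \<exists>n::int. n > 0 \<and> zsmul n x = 0}"

definition qcard :: "'m::ab_group_add set \<Rightarrow> 'm set \<Rightarrow> nat" where
  "qcard A N = card ((\<lambda>x. {y\<in>A. y - x \<in> N}) ` A)"

section \<open>The dihedral group D of order 2q, modelled as pairs (k,e) = rho^k sigma^e\<close>

definition Dgrp :: "nat \<Rightarrow> (nat \<times> nat) set" where
  "Dgrp q = {0..<q} \<times> {0..<2}"

definition dmul :: "nat \<Rightarrow> nat \<times> nat \<Rightarrow> nat \<times> nat \<Rightarrow> nat \<times> nat" where
  "dmul q g h = (case g of (a, e) \<Rightarrow> case h of (b, f) \<Rightarrow>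
      ((if e = 0 then a + b else a + (q - b)) mod q, (e + f) mod 2))"

definition Rgrp :: "nat \<Rightarrow> (nat \<times> nat) set" where
  "Rgrp q = {0..<q} \<times> {0}"

definition Sgrp :: "(nat \<times> nat) set" where
  "Sgrp = {(0, 0), (0, 1)}"

definition Tgrp :: "(nat \<times> nat) set" where
  "Tgrp = {(0, 0)}"

text \<open>Z[D]-module structure on 'm given by the actions r of rho and s of sigma.\<close>
definition act :: "('m \<Rightarrow> 'm) \<Rightarrow> ('m \<Rightarrow> 'm) \<Rightarrow> nat \<times> nat \<Rightarrow> 'm \<Rightarrow> 'm" where
  "act r s g x = (case g of (k, e) \<Rightarrow> (r ^^ k) ((s ^^ e) x))"

definition is_ZD_module :: "nat \<Rightarrow> ('m::ab_group_add \<Rightarrow> 'm) \<Rightarrow> ('m \<Rightarrow> 'm) \<Rightarrow> bool" where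
  "is_ZD_module q r s \<longleftrightarrow>
     (\<forall>x y. r (x + y) = r x + r y) \<and> (\<forall>x y. s (x + y) = s x + s y) \<and>
     (\<forall>x. (r ^^ q) x = x) \<and> (\<forall>x. s (s x) = x) \<and>
     (\<forall>x. s (r (s x)) = (r ^^ (q - 1)) x)"

definition fg_ZD_module :: "nat \<Rightarrow> ('m::ab_group_add \<Rightarrow> 'm) \<Rightarrow> ('m \<Rightarrow> 'm) \<Rightarrow> bool" where
  "fg_ZD_module q r s \<longleftrightarrow>
     (\<exists>S. finite S \<and> zspan {act r s g y | g y. g \<in> Dgrp q \<and> y \<in> S} = UNIV)"

definition fixpts :: "('m \<Rightarrow> 'm) \<Rightarrow> ('m \<Rightarrow> 'm) \<Rightarrow> (nat \<times> nat) set \<Rightarrow> 'm set" where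
  "fixpts r s H = {x. \<forall>g\<in>H. act r s g x = x}"

definition normH :: "('m::ab_group_add \<Rightarrow> 'm) \<Rightarrow> ('m \<Rightarrow> 'm) \<Rightarrow> (nat \<times> nat) set \<Rightarrow> 'm \<Rightarrow> 'm" where
  "normH r s H x = (\<Sum>g\<in>H. act r s g x)"

definition tate_h0 :: "('m::ab_group_add \<Rightarrow> 'm) \<Rightarrow> ('m \<Rightarrow> 'm) \<Rightarrow> (nat \<times> nat) set \<Rightarrow> nat" where
  "tate_h0 r s H = qcard (fixpts r s H) (range (normH r s H))"

definition tate_hm1 :: "('m::ab_group_add \<Rightarrow> 'm) \<Rightarrow> ('m \<Rightarrow> 'm) \<Rightarrow> (nat \<times> nat) set \<Rightarrow> nat" where
  "tate_hm1 r s H = qcard {x. normH r s H x = 0} (zspan {act r s g x - x | g x. g \<in> H})"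

text \<open>hat H^1(H,M) = H^1(H,M) = crossed homomorphisms / principal crossed homomorphisms
  (cochains are taken extensional, i.e. zero outside H).\<close>
definition cocycles1 :: "nat \<Rightarrow> ('m::ab_group_add \<Rightarrow> 'm) \<Rightarrow> ('m \<Rightarrow> 'm) \<Rightarrow> (nat \<times> nat) set
    \<Rightarrow> ((nat \<times> nat) \<Rightarrow> 'm) set" where
  "cocycles1 q r s H = {f. (\<forall>g\<in>H. \<forall>h\<in>H. f (dmul q g h) = f g + act r s g (f h)) \<and>
                           (\<forall>g. g \<notin> H \<longrightarrow> f g = 0)}"

definition coboundaries1 :: "('m::ab_group_add \<Rightarrow> 'm) \<Rightarrow> ('m \<Rightarrow> 'm) \<Rightarrow> (nat \<times> nat) set
    \<Rightarrow> ((nat \<times> nat) \<Rightarrow> 'm) set" where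
  "coboundaries1 r s H = {(\<lambda>g. if g \<in> H then act r s g m - m else 0) | m. True}"

definition tate_h1 :: "nat \<Rightarrow> ('m::ab_group_add \<Rightarrow> 'm) \<Rightarrow> ('m \<Rightarrow> 'm) \<Rightarrow> (nat \<times> nat) set \<Rightarrow> nat" where
  "tate_h1 q r s H =
     card ((\<lambda>f. {f'\<in>cocycles1 q r s H. (\<lambda>g. f' g - f g) \<in> coboundaries1 r s H})
           ` cocycles1 q r s H)"

text \<open>hat h^i(Theta, M) for Theta = 1 + 2D - R - 2Sigma.\<close>
definition theta_prod :: "nat \<Rightarrow> ((nat \<times> nat) set \<Rightarrow> 'l::field) \<Rightarrow> 'l" where
  "theta_prod q F = F Tgrp * (F (Dgrp q)) powi 2 * (F (Rgrp q)) powi (-1) * (F Sgrp) powi (-2)"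

definition is_tf_basis :: "'m::ab_group_add set \<Rightarrow> 'm list \<Rightarrow> bool" where
  "is_tf_basis A bs \<longleftrightarrow> set bs \<subseteq> A \<and>
     (\<forall>x\<in>A. \<exists>!cs::int list. length cs = length bs \<and>
              x - (\<Sum>i<length bs. zsmul (cs ! i) (bs ! i)) \<in> tors)"

definition gram :: "('m \<Rightarrow> 'm \<Rightarrow> 'l::field) \<Rightarrow> 'l \<Rightarrow> 'm list \<Rightarrow> 'l mat" where
  "gram pair c bs = mat (length bs) (length bs) (\<lambda>(i, j). c * pair (bs ! i) (bs ! j))"

text \<open>det of (1/|H|) <,> on a Z-basis of (M^H)_tf (independent of the choice of basis).\<close>
definition regdet :: "('m::ab_group_add \<Rightarrow> 'm) \<Rightarrow> ('m \<Rightarrow> 'm) \<Rightarrow> ('m \<Rightarrow> 'm \<Rightarrow> 'l::field)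
    \<Rightarrow> (nat \<times> nat) set \<Rightarrow> 'l" where
  "regdet r s pair H =
     det (gram pair (inverse (of_nat (card H))) (SOME bs. is_tf_basis (fixpts r s H) bs))"

definition admissible_pairing :: "('m::ab_group_add \<Rightarrow> 'm) \<Rightarrow> ('m \<Rightarrow> 'm) \<Rightarrow> ('m \<Rightarrow> 'm \<Rightarrow> 'l::field_char_0) \<Rightarrow> bool" where
  "admissible_pairing r s pair \<longleftrightarrow>
     (\<forall>x y z. pair (x + y) z = pair x z + pair y z) \<and>
     (\<forall>x y z. pair x (y + z) = pair x y + pair x z) \<and>
     (\<forall>x y. pair (r x) (r y) = pair x y) \<and> (\<forall>x y. pair (s x) (s y) = pair x y) \<and>
     (\<forall>bs. is_tf_basis UNIV bs \<longrightarrow> det (gram pair 1 bs) \<noteq> 0)"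

definition reg_const :: "nat \<Rightarrow> ('m::ab_group_add \<Rightarrow> 'm) \<Rightarrow> ('m \<Rightarrow> 'm) \<Rightarrow> ('m \<Rightarrow> 'm \<Rightarrow> 'l::field) \<Rightarrow> 'l" where
  "reg_const q r s pair = theta_prod q (\<lambda>H.
      (of_nat (card (tors \<inter> fixpts r s H))) powi (-2) * regdet r s pair H)"

end

(* For a subgroup A of M put D(A) = det(<,> on A_tf) / |A_tors|^2. Replacing A by a subgroup of finite
   index n multiplies D by n^2, and D is multiplicative up to an index on orthogonal sums. Write
   N for the norm of R, P = M^R, K = ker N, and +/- for the eigenspaces of sigma.
   The sums P + K in M, P^+ + K^+ in M^+ and K^+ + K^- in K have finite index, and these indices are
   Tate cohomology orders of R up to powers of q and 2. This leaves the comparison of D(K^+) and D(K^-).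
   With omega a square root of rho, theta = omega - 1/omega anticommutes with sigma and is
   anti-self-adjoint, so it interchanges K^+ and K^-, and comparing the Gram matrices of theta
   and its adjoint turns the quotient D(K^-)/D(K^+) into a quotient of indices, whose value is again given by
   the cohomology of R because theta M = (rho - 1) M. For the sign, -theta^2 = 2 - rho - 1/rho has
   positive determinant on K^+.
   As q is odd, the 2-part of the cohomology of D is that of Sigma and cancels in Theta, while its
   q-part is H^i(R)^+; on H^1(R) = K/theta M the eigenspaces are those of H^{-1}(R) interchanged. *)

theory Submission
  imports Defs "Jordan_Normal_Form.Char_Poly" "HOL-Library.Product_Plus"
begin

section \<open>Subgroups and indices\<close>

text \<open>The torsion factor makes \<open>regD\<close> behave like a squared covolume: if B has
  finite index in A, the transition determinant is, up to sign, [A:B] |B_tors| / |A_tors|, and the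
  Gram determinant picks up its square. Indices see determinants only up to sign. Squares hide this
  everywhere except in the comparison of the two Gram matrices of theta, where determinants enter to
  the first power; there a positivity argument has to be supplied. An infinite index is recorded as
  0, so indices are multiplicative without finiteness hypotheses, and finiteness enters as
  \<open>qcard\<close> being nonzero. Two devices carry the arithmetic. As q = 2 \<open>h0\<close> +
  1, multiples by \<open>h0\<close> or \<open>h1\<close> replace division by 2 on quotients killed
  by q. And an x fixed by sigma satisfies N x = x + (1 + sigma) y for some y, so sigma has no
  cohomology on K; this separates the 2-part from the q-part. The minus side follows from the plus
  side on replacing sigma by - sigma.\<close>

lemma zsmul_0 [simp]: "zsmul 0 x = 0" and zsmul_1 [simp]: "zsmul 1 x = x"
  by (simp_all add: zsmul_def)

lemma zsmul_Suc: "zsmul (int (Suc n)) x = zsmul (int n) x + x"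
  by (simp add: zsmul_def add.commute del: of_nat_Suc)

lemma zsmul_uminus: "zsmul (- c) x = - zsmul c x"
  by (auto simp: zsmul_def)

lemma zsmul_add1: "zsmul (c + 1) x = zsmul c x + x"
proof (cases "0 \<le> c")
  case True
  then obtain n where "c = int n" using nonneg_int_cases by blast
  then show ?thesis using zsmul_Suc[of n x] by (simp add: add.commute)
next
  case False
  then obtain n where n: "- c = int (Suc n)"
    by (metis int_cases minus_minus neg_equal_iff_equal of_nat_0_le_iff)
  then have "c + 1 = - int n" "c = - int (Suc n)" by auto
  then show ?thesis using zsmul_Suc[of n x] by (simp only: zsmul_uminus) simp
qed

lemma zsmul_diff1: "zsmul (c - 1) x = zsmul c x - x"
  using zsmul_add1[of "c - 1" x] by (simp add: algebra_simps)

lemma zsmul_add_right: "zsmul c (x + y) = zsmul c x + zsmul c y"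
  by (induction c rule: int_induct[of _ 0]) (simp_all add: zsmul_add1 zsmul_diff1)

lemma zsmul_add_left: "zsmul (c + d) x = zsmul c x + zsmul d x"
proof (induction d rule: int_induct[of _ 0])
  case (step1 i)
  then show ?case using zsmul_add1[of "c + i" x] by (simp add: zsmul_add1 add.assoc)
next
  case (step2 i)
  then show ?case using zsmul_diff1[of "c + i" x] by (simp add: zsmul_diff1 algebra_simps)
qed simp

lemma zsmul_zsmul: "zsmul c (zsmul d x) = zsmul (c * d) x"
proof (induction c rule: int_induct[of _ 0])
  case (step1 i)
  then show ?case by (simp add: zsmul_add1 distrib_right zsmul_add_left)
next
  case (step2 i)
  have "zsmul (i * d) x = zsmul ((i - 1) * d) x + zsmul d x"
    by (simp add: zsmul_add_left[symmetric] algebra_simps)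
  with step2 show ?case by (simp add: zsmul_diff1)
qed simp

interpretation zmod: Modules.module zsmul
  by unfold_locales (simp_all add: zsmul_add_right zsmul_add_left zsmul_zsmul)

section \<open>Additive maps and subgroups\<close>

definition zhom :: "('a::ab_group_add \<Rightarrow> 'b::ab_group_add) \<Rightarrow> bool" where
  "zhom f \<longleftrightarrow> (\<forall>x y. f (x + y) = f x + f y)"

lemma zhom_add: "zhom f \<Longrightarrow> f (x + y) = f x + f y"
  by (simp add: zhom_def)

lemma zhom_0: "zhom f \<Longrightarrow> f 0 = 0"
  by (metis add_cancel_left_left zhom_def)

lemma zhom_uminus: "zhom f \<Longrightarrow> f (- x) = - f x"
  using zhom_add[of f x "- x"] by (simp add: zhom_0 eq_neg_iff_add_eq_0 add.commute)

lemma zhom_diff: "zhom f \<Longrightarrow> f (x - y) = f x - f y"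
  using zhom_add[of f "x - y" y] by simp

lemma zhom_sum: "zhom f \<Longrightarrow> f (\<Sum>i\<in>I. g i) = (\<Sum>i\<in>I. f (g i))"
  by (induction I rule: infinite_finite_induct) (auto simp: zhom_0 zhom_add)

lemma zhom_zsmul: "zhom f \<Longrightarrow> f (zsmul c x) = zsmul c (f x)"
  by (simp add: zsmul_def zhom_sum zhom_uminus)

lemmas zhom_simps =
  zhom_add zhom_0 zhom_uminus zhom_diff zhom_sum zhom_zsmul

lemma zhom_compose: "zhom f \<Longrightarrow> zhom g \<Longrightarrow> zhom (\<lambda>x. f (g x))"
  by (simp add: zhom_def)

lemma zhom_zsmul_fun: "zhom (zsmul c)" and zhom_id: "zhom (\<lambda>x. x)"
  by (simp_all add: zhom_def zsmul_add_right)

lemma zsubgroup_0: "is_zsubgroup A \<Longrightarrow> 0 \<in> A"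
  and zsubgroup_add: "is_zsubgroup A \<Longrightarrow> x \<in> A \<Longrightarrow> y \<in> A \<Longrightarrow> x + y \<in> A"
  and zsubgroup_uminus: "is_zsubgroup A \<Longrightarrow> x \<in> A \<Longrightarrow> - x \<in> A"
  by (simp_all add: is_zsubgroup_def)

lemma zsubgroup_diff: "is_zsubgroup A \<Longrightarrow> x \<in> A \<Longrightarrow> y \<in> A \<Longrightarrow> x - y \<in> A"
  by (metis diff_conv_add_uminus zsubgroup_add zsubgroup_uminus)

lemma zsubgroup_sum: "is_zsubgroup A \<Longrightarrow> (\<And>i. i \<in> I \<Longrightarrow> g i \<in> A) \<Longrightarrow> sum g I \<in> A"
  by (induction I rule: infinite_finite_induct) (auto simp: zsubgroup_0 zsubgroup_add)

lemma zsubgroup_zsmul: "is_zsubgroup A \<Longrightarrow> x \<in> A \<Longrightarrow> zsmul c x \<in> A"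
  by (auto simp: zsmul_def intro!: zsubgroup_sum zsubgroup_uminus simp del: sum_constant)

lemmas zsubgroup_intros =
  zsubgroup_0 zsubgroup_add zsubgroup_uminus zsubgroup_diff zsubgroup_sum zsubgroup_zsmul

lemma zsubgroup_add_cancel:
  "is_zsubgroup A \<Longrightarrow> y \<in> A \<Longrightarrow> x + y \<in> A \<longleftrightarrow> x \<in> A"
  "is_zsubgroup A \<Longrightarrow> y \<in> A \<Longrightarrow> y + x \<in> A \<longleftrightarrow> x \<in> A"
  "is_zsubgroup A \<Longrightarrow> y \<in> A \<Longrightarrow> x - y \<in> A \<longleftrightarrow> x \<in> A"
  by (metis add_diff_cancel zsubgroup_add zsubgroup_diff,
      metis add_diff_cancel_left' zsubgroup_add zsubgroup_diff,
      metis diff_add_cancel zsubgroup_add zsubgroup_diff)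

lemma zsubgroup_UNIV: "is_zsubgroup UNIV" and zsubgroup_trivial: "is_zsubgroup {0}"
  by (simp_all add: is_zsubgroup_def)

lemma zsubgroup_Int: "is_zsubgroup A \<Longrightarrow> is_zsubgroup B \<Longrightarrow> is_zsubgroup (A \<inter> B)"
  by (simp add: is_zsubgroup_def)

lemma zsubgroup_image: "zhom f \<Longrightarrow> is_zsubgroup A \<Longrightarrow> is_zsubgroup (f ` A)"
  unfolding is_zsubgroup_def
  by (auto simp: zhom_add[symmetric] zhom_uminus[symmetric] zhom_0
      intro!: image_eqI[of 0 f 0])

lemma zsubgroup_vimage: "zhom f \<Longrightarrow> is_zsubgroup B \<Longrightarrow> is_zsubgroup {x. f x \<in> B}"
  by (simp add: is_zsubgroup_def zhom_simps)

lemma zsubgroup_kernel: "zhom f \<Longrightarrow> is_zsubgroup {x. f x = 0}"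
  using zsubgroup_vimage[OF _ zsubgroup_trivial] by auto

lemma zsubgroup_tors: "is_zsubgroup tors"
proof -
  have "x + y \<in> tors" if xy: "x \<in> tors" "y \<in> tors" for x y :: 'a
  proof -
    obtain m n where "m > 0" "zsmul m x = 0" "n > 0" "zsmul n y = 0"
      using xy by (auto simp: tors_def)
    then have "m * n > 0" "zsmul (n * m) x = 0" "zsmul (m * n) y = 0"
      by (simp_all add: zsmul_zsmul[symmetric])
    then have "m * n > 0" "zsmul (m * n) (x + y) = 0"
      by (simp_all add: zsmul_add_right mult.commute)
    then show ?thesis unfolding tors_def by blast
  qed
  moreover have "(0::'a) \<in> tors" by (auto simp: tors_def intro!: exI[of _ 1])
  moreover have "- x \<in> tors" if "x \<in> tors" for x :: 'a
    using that by (auto simp: tors_def)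
  ultimately show ?thesis by (simp add: is_zsubgroup_def)
qed

lemma zhom_tors: "zhom f \<Longrightarrow> x \<in> tors \<Longrightarrow> f x \<in> tors"
  by (auto simp: tors_def) (metis zhom_0 zhom_zsmul)

lemma zsmul_tors_iff: "c \<noteq> 0 \<Longrightarrow> zsmul c x \<in> tors \<longleftrightarrow> x \<in> tors"
proof
  assume c: "c \<noteq> 0" and "zsmul c x \<in> tors"
  then obtain n where n: "n > 0" "zsmul n (zsmul c x) = 0" by (auto simp: tors_def)
  then have "zsmul (n * \<bar>c\<bar>) x = 0"
    by (cases "c \<ge> 0") (simp_all add: zsmul_zsmul zsmul_uminus)
  moreover have "n * \<bar>c\<bar> > 0" using n c by simp
  ultimately show "x \<in> tors" unfolding tors_def by blast
qed (simp add: zsubgroup_zsmul zsubgroup_tors)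

lemma torsI: "c \<noteq> 0 \<Longrightarrow> zsmul c x = 0 \<Longrightarrow> x \<in> tors"
  by (metis zsmul_tors_iff zsubgroup_0 zsubgroup_tors)

definition ssum :: "'a::ab_group_add set \<Rightarrow> 'a set \<Rightarrow> 'a set" where
  "ssum A B = {a + b | a b. a \<in> A \<and> b \<in> B}"

lemma ssumI: "a \<in> A \<Longrightarrow> b \<in> B \<Longrightarrow> a + b \<in> ssum A B"
  by (auto simp: ssum_def)

lemma ssumE: assumes "x \<in> ssum A B" obtains a b where "a \<in> A" "b \<in> B" "x = a + b"
  using assms by (auto simp: ssum_def)

lemma zsubgroup_ssum: "is_zsubgroup A \<Longrightarrow> is_zsubgroup B \<Longrightarrow> is_zsubgroup (ssum A B)"
proof -
  assume A: "is_zsubgroup A" and B: "is_zsubgroup B"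
  have "x + y \<in> ssum A B" if xy: "x \<in> ssum A B" "y \<in> ssum A B" for x y
  proof -
    obtain a b c d where *: "x = a + b" "y = c + d" "a \<in> A" "b \<in> B" "c \<in> A" "d \<in> B"
      using xy by (auto simp: ssum_def)
    then have "x + y = (a + c) + (b + d)" by (simp add: algebra_simps)
    then show ?thesis using * A B by (metis ssumI zsubgroup_add)
  qed
  moreover have "0 \<in> ssum A B" using ssumI[of 0 A 0 B] A B by (simp add: zsubgroup_0)
  moreover have "- x \<in> ssum A B" if x: "x \<in> ssum A B" for x
  proof -
    obtain a b where *: "x = a + b" "a \<in> A" "b \<in> B" using x by (meson ssumE)
    then have "- x = (- a) + (- b)" by simp
    then show ?thesis using * A B by (metis ssumI zsubgroup_uminus)
  qed
  ultimately show ?thesis by (simp add: is_zsubgroup_def)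
qed

lemma ssum_superset:
  "is_zsubgroup B \<Longrightarrow> A \<subseteq> ssum A B" "is_zsubgroup A \<Longrightarrow> B \<subseteq> ssum A B"
  using ssumI[of _ A 0 B] ssumI[of 0 A _ B] by (auto simp: zsubgroup_0)

lemma ssum_subset: "is_zsubgroup C \<Longrightarrow> A \<subseteq> C \<Longrightarrow> B \<subseteq> C \<Longrightarrow> ssum A B \<subseteq> C"
  by (auto simp: ssum_def subset_iff intro: zsubgroup_add)

section \<open>Indices of subgroups, with 0 standing for an infinite index\<close>

lemma card_image_eq_kernel:
  assumes "\<And>x y. x \<in> X \<Longrightarrow> y \<in> X \<Longrightarrow> F x = F y \<longleftrightarrow> G x = G y"
  shows "card (F ` X) = card (G ` X)"
proof -
  have "bij_betw (\<lambda>c. G (SOME x. x \<in> X \<and> F x = c)) (F ` X) (G ` X)"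
  proof (rule bij_betwI')
    have *: "(SOME y. y \<in> X \<and> F y = F x) \<in> X \<and> F (SOME y. y \<in> X \<and> F y = F x) = F x" if "x \<in> X" for x
      by (rule someI[of _ x]) (use that in auto)
    show "(G (SOME x. x \<in> X \<and> F x = a) = G (SOME x. x \<in> X \<and> F x = b)) = (a = b)"
      if ab: "a \<in> F ` X" "b \<in> F ` X" for a b
    proof -
      obtain x y where "x \<in> X" "y \<in> X" "a = F x" "b = F y" using ab by blast
      then show ?thesis using *[of x] *[of y] assms by metis
    qed
    show "G (SOME x. x \<in> X \<and> F x = a) \<in> G ` X" if "a \<in> F ` X" for a
      using that * by auto
    show "\<exists>a\<in>F ` X. b = G (SOME x. x \<in> X \<and> F x = a)" if b: "b \<in> G ` X" for b
    proof -
      obtain x where "x \<in> X" "b = G x" using b by blast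
      then show ?thesis using *[of x] assms[of x] by (metis imageI)
    qed
  qed
  then show ?thesis by (rule bij_betw_same_card)
qed

lemma coset_eq_iff:
  assumes "is_zsubgroup N" "N \<subseteq> A" "x \<in> A" "y \<in> A" "is_zsubgroup A"
  shows "{z\<in>A. z - x \<in> N} = {z\<in>A. z - y \<in> N} \<longleftrightarrow> x - y \<in> N"
proof
  assume "{z\<in>A. z - x \<in> N} = {z\<in>A. z - y \<in> N}"
  moreover have "x \<in> {z\<in>A. z - x \<in> N}" using assms by (simp add: zsubgroup_0)
  ultimately show "x - y \<in> N" by blast
next
  assume *: "x - y \<in> N"
  have "z - x \<in> N \<longleftrightarrow> z - y \<in> N" for z
    using zsubgroup_add_cancel(1)[OF assms(1) *, of "z - x"] by simp
  then show "{z\<in>A. z - x \<in> N} = {z\<in>A. z - y \<in> N}" by auto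
qed

text \<open>\<open>f\<close> induces an isomorphism X/X' to Y/Y': it need only be onto modulo
  \<open>Y'\<close>, with preimage of \<open>Y'\<close> equal to \<open>X'\<close>. Most indices
  below are computed in this form.\<close>

lemma qcard_iso:
  fixes f :: "'a::ab_group_add \<Rightarrow> 'b::ab_group_add"
  assumes X: "is_zsubgroup X" "is_zsubgroup X'" "X' \<subseteq> X"
    and Y: "is_zsubgroup Y" "is_zsubgroup Y'" "Y' \<subseteq> Y"
    and f: "zhom f" "\<And>x. x \<in> X \<Longrightarrow> f x \<in> Y"
    and ker: "\<And>x. x \<in> X \<Longrightarrow> f x \<in> Y' \<longleftrightarrow> x \<in> X'"
    and surj: "\<And>y. y \<in> Y \<Longrightarrow> \<exists>x\<in>X. y - f x \<in> Y'"
  shows "qcard X X' = qcard Y Y'"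
proof -
  define cl where "cl y = {z\<in>Y. z - y \<in> Y'}" for y
  have "cl ` Y = (\<lambda>x. cl (f x)) ` X"
  proof (intro equalityI subsetI)
    fix c assume "c \<in> cl ` Y"
    then obtain y where y: "y \<in> Y" "c = cl y" by auto
    obtain x where x: "x \<in> X" "y - f x \<in> Y'" using surj[OF y(1)] by auto
    then have "cl y = cl (f x)"
      unfolding cl_def using coset_eq_iff[OF Y(2,3) y(1) f(2) Y(1)] by blast
    then show "c \<in> (\<lambda>x. cl (f x)) ` X" using x y by auto
  qed (use f in auto)
  then have "qcard Y Y' = card ((\<lambda>x. cl (f x)) ` X)" by (simp add: qcard_def cl_def)
  also have "\<dots> = card ((\<lambda>x. {z\<in>X. z - x \<in> X'}) ` X)"
  proof (rule card_image_eq_kernel)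
    fix x y assume xy: "x \<in> X" "y \<in> X"
    have "cl (f x) = cl (f y) \<longleftrightarrow> f x - f y \<in> Y'"
      unfolding cl_def using xy f Y by (intro coset_eq_iff) auto
    also have "\<dots> \<longleftrightarrow> x - y \<in> X'"
      using ker[of "x - y"] xy X by (simp add: zhom_diff f(1) zsubgroup_diff)
    also have "\<dots> \<longleftrightarrow> {z\<in>X. z - x \<in> X'} = {z\<in>X. z - y \<in> X'}"
      using xy X by (intro coset_eq_iff[symmetric]) auto
    finally show "cl (f x) = cl (f y) \<longleftrightarrow> {z\<in>X. z - x \<in> X'} = {z\<in>X. z - y \<in> X'}" .
  qed
  finally show ?thesis by (simp add: qcard_def)
qed

lemma qcard_second_iso:
  assumes "is_zsubgroup A" "is_zsubgroup B"
  shows "qcard (ssum A B) B = qcard A (A \<inter> B)"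
proof (rule qcard_iso[of A "A \<inter> B" "ssum A B" B "\<lambda>x. x", symmetric])
  show "\<exists>x\<in>A. y - x \<in> B" if "y \<in> ssum A B" for y
    using that by (auto elim!: ssumE) (metis add_diff_cancel_left')
qed (use assms ssum_superset[of B A] ssum_superset[of A B] in
      \<open>auto simp: zsubgroup_Int zsubgroup_ssum zhom_id\<close>)

text \<open>A choice of representatives gives a bijection from X/W to X/Y times Y/W, sending x to
  the class of x and the class of x - \<open>rep\<close> x. It exists for infinite quotients too,
  and \<open>card\<close> of an infinite set is 0, so infinite indices are covered.\<close>

lemma qcard_mult:
  assumes X: "is_zsubgroup X" and Y: "is_zsubgroup Y" and W: "is_zsubgroup W"
    and "W \<subseteq> Y" "Y \<subseteq> X"
  shows "qcard X W = qcard X Y * qcard Y W"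
proof -
  define cX where "cX x = {z\<in>X. z - x \<in> Y}" for x
  define cY where "cY x = {z\<in>Y. z - x \<in> W}" for x
  define rep where "rep x = (SOME y. y \<in> X \<and> cX y = cX x)" for x
  have WX: "W \<subseteq> X" using assms by auto
  have rep: "rep x \<in> X" "cX (rep x) = cX x" if "x \<in> X" for x
    using someI[of "\<lambda>y. y \<in> X \<and> cX y = cX x" x] that by (auto simp: rep_def)
  have repd: "x - rep x \<in> Y" if "x \<in> X" for x
    using coset_eq_iff[OF Y assms(5) that rep(1)[OF that] X] rep[OF that] by (simp add: cX_def)
  have repc: "rep x = rep y" if "cX x = cX y" for x y
    using that by (simp add: rep_def)
  let ?G = "\<lambda>x. (cX x, cY (x - rep x))"
  have "qcard X W = card ((\<lambda>x. {z\<in>X. z - x \<in> W}) ` X)" by (simp add: qcard_def)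
  also have "\<dots> = card (?G ` X)"
  proof (rule card_image_eq_kernel)
    fix x y assume xy: "x \<in> X" "y \<in> X"
    have 1: "{z\<in>X. z - x \<in> W} = {z\<in>X. z - y \<in> W} \<longleftrightarrow> x - y \<in> W"
      using xy W X WX by (intro coset_eq_iff) auto
    have 2: "cX x = cX y \<longleftrightarrow> x - y \<in> Y"
      unfolding cX_def using xy assms by (intro coset_eq_iff) auto
    have 3: "cY (x - rep x) = cY (y - rep y) \<longleftrightarrow> (x - rep x) - (y - rep y) \<in> W"
      unfolding cY_def using xy assms repd by (intro coset_eq_iff) auto
    show "{z\<in>X. z - x \<in> W} = {z\<in>X. z - y \<in> W} \<longleftrightarrow> ?G x = ?G y"
    proof (cases "x - y \<in> Y")
      case True
      then have "rep x = rep y" using 2 repc by blast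
      then have "(x - rep x) - (y - rep y) = x - y" by simp
      with 1 2 3 True show ?thesis by simp
    next
      case False
      then show ?thesis using 1 2 assms(4) by auto
    qed
  qed
  also have "?G ` X = (cX ` X) \<times> (cY ` Y)"
  proof (intro equalityI subsetI)
    fix p assume "p \<in> (cX ` X) \<times> (cY ` Y)"
    then obtain x y where xy: "x \<in> X" "y \<in> Y" "p = (cX x, cY y)" by auto
    \<comment> \<open>Adding y to the representative instead of x makes the second component exactly
      the class of y.\<close>
    let ?z = "rep x + y"
    have z: "?z \<in> X" using xy rep assms by (auto intro: zsubgroup_add)
    have "cX ?z = cX (rep x)"
      unfolding cX_def using coset_eq_iff[OF Y assms(5) z rep(1)[OF xy(1)] X] xy by simp
    then have c: "cX ?z = cX x" using rep xy by simp
    then have "?z - rep ?z = y" using repc[OF c] by simp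
    then have "?G ?z = p" using c xy by simp
    then show "p \<in> ?G ` X" using z image_eqI[of p ?G ?z X] by simp
  qed (use repd in auto)
  also have "card \<dots> = qcard X Y * qcard Y W"
    by (simp add: card_cartesian_product qcard_def cX_def[abs_def] cY_def[abs_def])
  finally show ?thesis .
qed

lemma qcard_trivial: "qcard A {0} = card A"
proof -
  have "inj_on (\<lambda>x. {y\<in>A. y - x \<in> {0}}) A" by (auto simp: inj_on_def)
  then show ?thesis by (simp add: qcard_def card_image)
qed

lemma qcard_self: "is_zsubgroup A \<Longrightarrow> qcard A A = 1"
proof -
  assume A: "is_zsubgroup A"
  then have "(\<lambda>x. {y\<in>A. y - x \<in> A}) ` A = {A}"
    using zsubgroup_0[OF A] zsubgroup_diff[OF A] by (auto intro!: image_eqI[of _ _ 0])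
  then show ?thesis by (simp add: qcard_def)
qed

lemma card_lagrange:
  "is_zsubgroup A \<Longrightarrow> is_zsubgroup B \<Longrightarrow> B \<subseteq> A \<Longrightarrow> card A = qcard A B * card B"
  using qcard_mult[of A B "{0}"] by (simp add: qcard_trivial zsubgroup_trivial zsubgroup_0)

lemma card_hom:
  assumes "is_zsubgroup A" "zhom f"
  shows "card A = card (f ` A) * card {x\<in>A. f x = 0}"
proof -
  let ?K = "{x\<in>A. f x = 0}"
  have K: "is_zsubgroup ?K"
    using zsubgroup_Int[OF assms(1) zsubgroup_kernel[OF assms(2)]] by (simp add: Int_def)
  have "qcard A ?K = qcard (f ` A) {0}"
    by (rule qcard_iso[where f=f])
      (use assms K zsubgroup_0[OF assms(1)] in
        \<open>auto simp: zsubgroup_image zsubgroup_trivial zhom_0 intro!: image_eqI[of 0 f 0]\<close>)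
  then show ?thesis using card_lagrange[OF assms(1) K] by (auto simp: qcard_trivial)
qed

section \<open>Bases modulo torsion\<close>

definition lc :: "(nat \<Rightarrow> int) \<Rightarrow> 'a::ab_group_add list \<Rightarrow> 'a" where
  "lc c bs = (\<Sum>i<length bs. zsmul (c i) (bs ! i))"

lemma lc_diff: "lc (\<lambda>i. c i - d i) bs = lc c bs - lc d bs"
  by (simp add: lc_def zmod.scale_left_diff_distrib sum_subtractf)

lemma lc_add: "lc (\<lambda>i. c i + d i) bs = lc c bs + lc d bs"
  by (simp add: lc_def zsmul_add_left sum.distrib)

lemma lc_scale: "lc (\<lambda>i. k * c i) bs = zsmul k (lc c bs)"
  by (simp add: lc_def zmod.scale_sum_right zsmul_zsmul)

lemma lc_cong: "(\<And>i. i < length bs \<Longrightarrow> c i = d i) \<Longrightarrow> lc c bs = lc d bs"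
  by (simp add: lc_def)

lemma lc_Cons: "lc c (a # as) = zsmul (c 0) a + lc (\<lambda>i. c (Suc i)) as"
  by (simp add: lc_def sum.lessThan_Suc_shift del: sum.lessThan_Suc)

lemma lc_delta: "i < length bs \<Longrightarrow> lc (\<lambda>j. if j = i then 1 else 0) bs = bs ! i"
  by (simp add: lc_def if_distrib[of "\<lambda>c. zsmul c _"] cong: if_cong)

lemma lc_append: "lc c (as @ bs) = lc c as + lc (\<lambda>i. c (length as + i)) bs"
proof (induction as arbitrary: c)
  case (Cons a as)
  show ?case by (simp only: append_Cons lc_Cons Cons.IH) (simp add: add.assoc)
qed (simp add: lc_def)

lemma lc_map: "zhom f \<Longrightarrow> lc c (map f bs) = f (lc c bs)"
  by (simp add: lc_def zhom_sum zhom_zsmul)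

lemma lc_mem: "is_zsubgroup A \<Longrightarrow> set bs \<subseteq> A \<Longrightarrow> lc c bs \<in> A"
  unfolding lc_def by (intro zsubgroup_sum zsubgroup_zsmul) auto

text \<open>The difference of two expansions of x is a combination lying in \<open>tors\<close>, so
  uniqueness of coefficient lists becomes independence modulo torsion. Coefficient functions replace
  the lists from here on.\<close>

lemma is_tf_basis_iff:
  assumes A: "is_zsubgroup A"
  shows "is_tf_basis A bs \<longleftrightarrow> set bs \<subseteq> A \<and> (\<forall>x\<in>A. \<exists>c. x - lc c bs \<in> tors) \<and>
    (\<forall>c. lc c bs \<in> tors \<longrightarrow> (\<forall>i<length bs. c i = 0))"
proof
  assume L: "is_tf_basis A bs"
  have ex1: "\<exists>!cs. length cs = length bs \<and> x - lc ((!) cs) bs \<in> tors" if "x \<in> A" for x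
    using L that by (simp add: is_tf_basis_def lc_def)
  have "c i = 0" if "lc c bs \<in> tors" "i < length bs" for c i
  proof -
    let ?n = "length bs"
    have "lc ((!) (map c [0..<?n])) bs = lc c bs" "lc ((!) (replicate ?n 0)) bs = 0"
      by (simp_all add: lc_def)
    then have "0 - lc ((!) (map c [0..<?n])) bs \<in> tors" "0 - lc ((!) (replicate ?n 0)) bs \<in> tors"
      using that by (simp_all add: zsubgroup_intros zsubgroup_tors)
    with ex1[OF zsubgroup_0[OF A]] have "map c [0..<?n] = replicate ?n 0"
      by (elim ex1E) (metis length_map length_replicate length_upt minus_nat.diff_0)
    then have "map c [0..<?n] ! i = replicate ?n 0 ! i" by (rule arg_cong)
    with that show ?thesis by simp
  qed
  moreover have "\<exists>c. x - lc c bs \<in> tors" if "x \<in> A" for x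
    using ex1_implies_ex[OF ex1[OF that]] by blast
  moreover have "set bs \<subseteq> A" using L by (simp add: is_tf_basis_def)
  ultimately show "set bs \<subseteq> A \<and> (\<forall>x\<in>A. \<exists>c. x - lc c bs \<in> tors) \<and>
    (\<forall>c. lc c bs \<in> tors \<longrightarrow> (\<forall>i<length bs. c i = 0))" by simp
next
  assume R: "set bs \<subseteq> A \<and> (\<forall>x\<in>A. \<exists>c. x - lc c bs \<in> tors) \<and>
    (\<forall>c. lc c bs \<in> tors \<longrightarrow> (\<forall>i<length bs. c i = 0))"
  have "\<exists>!cs. length cs = length bs \<and> x - lc ((!) cs) bs \<in> tors" if x: "x \<in> A" for x
  proof -
    obtain c where c: "x - lc c bs \<in> tors" using R x by blast
    show ?thesis
    proof (rule ex1I[of _ "map c [0..<length bs]"])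
      have "lc ((!) (map c [0..<length bs])) bs = lc c bs" by (simp add: lc_def)
      then show "length (map c [0..<length bs]) = length bs \<and>
        x - lc ((!) (map c [0..<length bs])) bs \<in> tors" using c by simp
      fix cs assume cs: "length cs = length bs \<and> x - lc ((!) cs) bs \<in> tors"
      have "lc (\<lambda>i. cs ! i - c i) bs = (x - lc c bs) - (x - lc ((!) cs) bs)"
        by (simp add: lc_diff)
      then have "lc (\<lambda>i. cs ! i - c i) bs \<in> tors"
        using c cs by (metis zsubgroup_diff zsubgroup_tors)
      then have "\<forall>i<length bs. cs ! i - c i = 0" using R by blast
      then show "cs = map c [0..<length bs]" using cs by (intro nth_equalityI) auto
    qed
  qed
  with R show "is_tf_basis A bs" by (simp add: is_tf_basis_def lc_def)
qed

text \<open>Only the values below \<open>length bs\<close> are determined by x; beyond them the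
  choice is arbitrary, which is why facts about \<open>coords\<close> carry a bound on the
  index.\<close>

definition coords :: "'a::ab_group_add list \<Rightarrow> 'a \<Rightarrow> nat \<Rightarrow> int" where
  "coords bs x = (SOME c. x - lc c bs \<in> tors)"

context
  fixes A :: "'a::ab_group_add set" and bs :: "'a list"
  assumes A: "is_zsubgroup A" and basis: "is_tf_basis A bs"
begin

lemma basis_subset: "set bs \<subseteq> A"
  and basis_independent: "lc c bs \<in> tors \<Longrightarrow> i < length bs \<Longrightarrow> c i = 0"
  using basis unfolding is_tf_basis_iff[OF A] by auto

lemma basis_nth: "i < length bs \<Longrightarrow> bs ! i \<in> A"
  using basis_subset by auto

lemma coords: "x \<in> A \<Longrightarrow> x - lc (coords bs x) bs \<in> tors"
  using basis unfolding is_tf_basis_iff[OF A] coords_def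
  by (blast intro: someI_ex[of "\<lambda>c. x - lc c bs \<in> tors"])

lemma coords_unique:
  assumes "x \<in> A" "x - lc c bs \<in> tors" "i < length bs"
  shows "coords bs x i = c i"
proof -
  have "lc (\<lambda>i. coords bs x i - c i) bs = (x - lc c bs) - (x - lc (coords bs x) bs)"
    by (simp add: lc_diff)
  then have "lc (\<lambda>i. coords bs x i - c i) bs \<in> tors"
    using coords[OF assms(1)] assms(2) by (metis zsubgroup_diff zsubgroup_tors)
  then show ?thesis using basis_independent[of "\<lambda>i. coords bs x i - c i" i] assms(3) by simp
qed

lemma coords_add:
  assumes "x \<in> A" "y \<in> A" "i < length bs"
  shows "coords bs (x + y) i = coords bs x i + coords bs y i"
proof (rule coords_unique[where c="\<lambda>i. coords bs x i + coords bs y i"])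
  have "x + y - lc (\<lambda>i. coords bs x i + coords bs y i) bs =
      (x - lc (coords bs x) bs) + (y - lc (coords bs y) bs)"
    by (simp add: lc_add)
  then show "x + y - lc (\<lambda>i. coords bs x i + coords bs y i) bs \<in> tors"
    using coords assms by (metis zsubgroup_add zsubgroup_tors)
qed (use assms A in \<open>auto intro: zsubgroup_add\<close>)

lemma coords_zsmul:
  assumes "x \<in> A" "i < length bs"
  shows "coords bs (zsmul k x) i = k * coords bs x i"
proof (rule coords_unique[where c="\<lambda>i. k * coords bs x i"])
  have "zsmul k x - lc (\<lambda>i. k * coords bs x i) bs = zsmul k (x - lc (coords bs x) bs)"
    by (simp add: lc_scale zmod.scale_right_diff_distrib)
  then show "zsmul k x - lc (\<lambda>i. k * coords bs x i) bs \<in> tors"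
    using coords assms by (metis zsubgroup_zsmul zsubgroup_tors)
qed (use assms A in \<open>auto intro: zsubgroup_zsmul\<close>)

lemma coords_diff:
  assumes "x \<in> A" "y \<in> A" "i < length bs"
  shows "coords bs (x - y) i = coords bs x i - coords bs y i"
  using coords_add[of "x - y" y i] assms A by (simp add: zsubgroup_diff)

lemma coords_tors: "x \<in> A \<Longrightarrow> x \<in> tors \<Longrightarrow> i < length bs \<Longrightarrow> coords bs x i = 0"
  by (rule coords_unique[where c="\<lambda>_. 0"]) (simp_all add: lc_def)

lemma coords_basis:
  "i < length bs \<Longrightarrow> j < length bs \<Longrightarrow> coords bs (bs ! i) j = (if j = i then 1 else 0)"
  by (rule coords_unique[where c="\<lambda>j. if j = i then 1 else 0"])
    (simp_all add: basis_nth lc_delta zsubgroup_0[OF zsubgroup_tors])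

text \<open>Additivity and vanishing on torsion are asked on A alone, so that coordinates, pairings
  and eigenvector functionals are all covered. It is the source of the matrix identities for
  \<open>tfmat\<close> and \<open>gramP\<close>.\<close>

lemma functional_coords:
  fixes \<phi> :: "'a \<Rightarrow> 'r::ring_1"
  assumes add: "\<And>x y. x \<in> A \<Longrightarrow> y \<in> A \<Longrightarrow> \<phi> (x + y) = \<phi> x + \<phi> y"
    and tors: "\<And>x. x \<in> A \<Longrightarrow> x \<in> tors \<Longrightarrow> \<phi> x = 0"
    and x: "x \<in> A"
  shows "\<phi> x = (\<Sum>i<length bs. of_int (coords bs x i) * \<phi> (bs ! i))"
proof -
  have z: "\<phi> 0 = 0" using add[of 0 0] zsubgroup_0[OF A] by simp
  have diff: "\<phi> (x - y) = \<phi> x - \<phi> y" if "x \<in> A" "y \<in> A" for x y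
    using add[of "x - y" y] that A by (simp add: zsubgroup_diff)
  have sc: "\<phi> (zsmul k y) = of_int k * \<phi> y" if "y \<in> A" for k y
  proof (induction k rule: int_induct[of _ 0])
    case (step1 i)
    then show ?case using that A
      by (simp add: zsmul_add1 add zsubgroup_zsmul distrib_right)
  next
    case (step2 i)
    then show ?case using that A
      by (simp add: zsmul_diff1 diff zsubgroup_zsmul left_diff_distrib)
  qed (simp add: z)
  have sum: "\<phi> (sum g I) = (\<Sum>i\<in>I. \<phi> (g i))" if "finite I" "\<And>i. i \<in> I \<Longrightarrow> g i \<in> A" for I :: "nat set" and g
    using that by (induction I) (auto simp: z add zsubgroup_sum A)
  have "\<phi> x = \<phi> (lc (coords bs x) bs)"
    using diff[OF x lc_mem[OF A basis_subset, of "coords bs x"]]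
      tors[OF zsubgroup_diff[OF A x lc_mem[OF A basis_subset]] coords[OF x]] by simp
  also have "\<dots> = (\<Sum>i<length bs. \<phi> (zsmul (coords bs x i) (bs ! i)))"
    unfolding lc_def using A basis_nth by (intro sum) (auto simp: zsubgroup_zsmul)
  also have "\<dots> = (\<Sum>i<length bs. of_int (coords bs x i) * \<phi> (bs ! i))"
    by (intro sum.cong) (auto simp: sc basis_nth)
  finally show ?thesis .
qed

end

text \<open>Finitely generated abelian groups, encoded by finite torsion and a basis modulo torsion.
  Subgroups inherit this through \<open>triangular_basis\<close>;
  \<open>zlattice_finite_superset\<close> gives the link with finite generation.\<close>

definition zlattice :: "'a::ab_group_add set \<Rightarrow> bool" where
  "zlattice A \<longleftrightarrow> is_zsubgroup A \<and> finite (tors \<inter> A) \<and> (\<exists>bs. is_tf_basis A bs)"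

text \<open>Rows are the images of the basis vectors, so doing f and then g gives the product of
  their matrices in that order, and a right eigenvector is a functional on the group.\<close>

definition tfmat :: "('a \<Rightarrow> 'b::ab_group_add) \<Rightarrow> 'a list \<Rightarrow> 'b list \<Rightarrow> int mat" where
  "tfmat f as bs = mat (length as) (length bs) (\<lambda>(i, j). coords bs (f (as ! i)) j)"

lemma tfmat_carrier [simp]: "tfmat f as bs \<in> carrier_mat (length as) (length bs)"
  by (simp add: tfmat_def)

lemma tfmat_id:
  assumes "is_zsubgroup A" "is_tf_basis A as"
  shows "tfmat (\<lambda>x. x) as as = 1\<^sub>m (length as)"
  by (rule eq_matI) (auto simp: tfmat_def coords_basis[OF assms])

lemma tfmat_comp:
  assumes B: "is_zsubgroup B" "is_tf_basis B bs" and C: "is_zsubgroup C" "is_tf_basis C cs"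
    and f: "\<And>i. i < length as \<Longrightarrow> f (as ! i) \<in> B"
    and g: "zhom g" "\<And>x. x \<in> B \<Longrightarrow> g x \<in> C"
  shows "tfmat (\<lambda>x. g (f x)) as cs = tfmat f as bs * tfmat g bs cs"
proof (rule eq_matI)
  fix i k assume ik: "i < dim_row (tfmat f as bs * tfmat g bs cs)"
    "k < dim_col (tfmat f as bs * tfmat g bs cs)"
  have "coords cs (g (f (as ! i))) k =
      (\<Sum>j<length bs. of_int (coords bs (f (as ! i)) j) * coords cs (g (bs ! j)) k)"
    by (rule functional_coords[OF B, where \<phi>="\<lambda>x. coords cs (g x) k"])
      (use ik f g in \<open>auto simp: tfmat_def zhom_add zhom_tors coords_add[OF C] intro: coords_tors[OF C]\<close>)
  then show "tfmat (\<lambda>x. g (f x)) as cs $$ (i, k) = (tfmat f as bs * tfmat g bs cs) $$ (i, k)"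
    using ik by (simp add: tfmat_def scalar_prod_def atLeast0LessThan)
qed (simp_all add: tfmat_def)

text \<open>If m < n, padding both factors with zeros to size n keeps the product, but the padded V
  has a zero row and so determinant 0 instead of a unit.\<close>

lemma left_inverse_mat_dim_le:
  fixes U V :: "int mat"
  assumes U: "U \<in> carrier_mat n m" and V: "V \<in> carrier_mat m n" and UV: "U * V = 1\<^sub>m n"
  shows "n \<le> m"
proof (rule ccontr)
  assume "\<not> n \<le> m"
  then have mn: "m < n" by simp
  define U' where "U' = mat n n (\<lambda>(i, j). if j < m then U $$ (i, j) else 0)"
  define V' where "V' = mat n n (\<lambda>(i, j). if i < m then V $$ (i, j) else 0)"
  have c: "U' \<in> carrier_mat n n" "V' \<in> carrier_mat n n" by (simp_all add: U'_def V'_def)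
  have "U' * V' = U * V"
  proof (rule eq_matI)
    fix i j assume ij: "i < dim_row (U * V)" "j < dim_col (U * V)"
    have "(U' * V') $$ (i, j) = (\<Sum>k<n. if k < m then U $$ (i, k) * V $$ (k, j) else 0)"
      using ij U V by (auto simp: U'_def V'_def scalar_prod_def atLeast0LessThan intro!: sum.cong)
    also have "\<dots> = (\<Sum>k<m. U $$ (i, k) * V $$ (k, j))"
      using mn by (subst sum.inter_restrict[symmetric, where B="{..<m}", simplified])
        (auto intro!: sum.cong)
    also have "\<dots> = (U * V) $$ (i, j)"
      using ij U V by (simp add: scalar_prod_def atLeast0LessThan)
    finally show "(U' * V') $$ (i, j) = (U * V) $$ (i, j)" .
  qed (use U V c in auto)
  then have "det U' * det V' = 1" using det_mult[OF c] UV by simp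
  moreover have "det V' = 0"
  proof -
    have "(\<Prod>i = 0..<n. V' $$ (i, p i)) = 0" if "p permutes {0..<n}" for p
      using that mn permutes_in_image[OF that, of m] by (auto simp: V'_def intro!: bexI[of _ m])
    then show ?thesis unfolding det_def'[OF c(2)] by (intro sum.neutral) auto
  qed
  ultimately show False by simp
qed

lemma
  assumes A: "is_zsubgroup A" and as: "is_tf_basis A as" and bs: "is_tf_basis A bs"
  shows tf_basis_length_eq: "length as = length bs"
    and abs_det_tfmat_id: "\<bar>det (tfmat (\<lambda>x. x) as bs)\<bar> = 1"
proof -
  have *: "tfmat (\<lambda>x. x) as bs * tfmat (\<lambda>x. x) bs as = 1\<^sub>m (length as)"
    if "is_tf_basis A as" "is_tf_basis A bs" for as bs
    using tfmat_comp[OF A that(2) A that(1), of as "\<lambda>x. x" "\<lambda>x. x"] tfmat_id[OF A that(1)]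
      basis_nth[OF A that(1)] by (simp add: zhom_id)
  show eq: "length as = length bs"
    using left_inverse_mat_dim_le[OF _ _ *[OF as bs]] left_inverse_mat_dim_le[OF _ _ *[OF bs as]]
    by (simp add: antisym)
  have "det (tfmat (\<lambda>x. x) as bs) * det (tfmat (\<lambda>x. x) bs as) = 1"
    using det_mult[of "tfmat (\<lambda>x. x) as bs" "length as" "tfmat (\<lambda>x. x) bs as"] *[OF as bs] eq
    by (metis det_one tfmat_carrier)
  then show "\<bar>det (tfmat (\<lambda>x. x) as bs)\<bar> = 1" by (metis abs_zmult_eq_1 abs_1)
qed

section \<open>Subgroups of a lattice: Hermite normal form, and indices as determinants\<close>

lemma least_generator:
  fixes \<phi> :: "'a::ab_group_add \<Rightarrow> int"
  assumes B: "is_zsubgroup B"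
    and add: "\<And>x y. x \<in> B \<Longrightarrow> y \<in> B \<Longrightarrow> \<phi> (x + y) = \<phi> x + \<phi> y"
    and sc: "\<And>k x. x \<in> B \<Longrightarrow> \<phi> (zsmul k x) = k * \<phi> x"
  obtains b where "b \<in> B" "\<phi> b \<ge> 0" "\<And>x. x \<in> B \<Longrightarrow> \<phi> b dvd \<phi> x"
proof (cases "\<exists>x\<in>B. \<phi> x \<noteq> 0")
  case False
  then show ?thesis using that[of 0] zsubgroup_0[OF B] by auto
next
  case True
  then obtain x0 where "x0 \<in> B" "\<phi> x0 \<noteq> 0" by auto
  then have "\<exists>x\<in>B. \<phi> x > 0"
    using sc[of x0 "-1"] zsubgroup_zsmul[OF B, of x0 "-1"] by (metis linorder_neqE_linordered_idom mult_minus1 neg_0_less_iff_less)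
  then obtain x1 where x1: "x1 \<in> B" "\<phi> x1 > 0" by auto
  define P where "P n \<longleftrightarrow> (\<exists>x\<in>B. \<phi> x = int n \<and> n > 0)" for n
  have "P (nat (\<phi> x1))" using x1 by (auto simp: P_def)
  then have "P (LEAST n. P n)" by (rule LeastI)
  then obtain b where b: "b \<in> B" "\<phi> b = int (LEAST n. P n)" "\<phi> b > 0" by (auto simp: P_def)
  have "\<phi> b dvd \<phi> x" if x: "x \<in> B" for x
  proof (rule ccontr)
    assume nd: "\<not> \<phi> b dvd \<phi> x"
    let ?y = "x + zsmul (- (\<phi> x div \<phi> b)) b"
    have y: "?y \<in> B" using x b B by (simp add: zsubgroup_intros)
    have "\<phi> ?y = \<phi> x mod \<phi> b"
      using x b B by (simp add: add sc zsubgroup_intros minus_div_mult_eq_mod[symmetric] del: zmod.scale_minus_left)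
    moreover have "\<phi> x mod \<phi> b > 0" "\<phi> x mod \<phi> b < \<phi> b"
      using nd pos_mod_sign[OF b(3), of "\<phi> x"] pos_mod_bound[OF b(3), of "\<phi> x"]
      by (simp_all add: dvd_eq_mod_eq_0 order_less_le)
    ultimately have "P (nat (\<phi> ?y))" "nat (\<phi> ?y) < (LEAST n. P n)"
      using y b by (auto simp: P_def intro!: bexI[of _ ?y])
    then show False using not_less_Least by blast
  qed
  then show ?thesis using that[of b] b by auto
qed

text \<open>Reduction of \<phi> modulo d identifies the quotient with Z/d. For d = 0 the subgroup is
  the kernel, and \<open>nat d\<close> = 0 agrees with the convention for infinite index.\<close>

lemma qcard_int_functional:
  fixes \<phi> :: "'a::ab_group_add \<Rightarrow> int"
  assumes A: "is_zsubgroup A"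
    and add: "\<And>x y. x \<in> A \<Longrightarrow> y \<in> A \<Longrightarrow> \<phi> (x + y) = \<phi> x + \<phi> y"
    and surj: "\<phi> ` A = UNIV" and d: "d \<ge> 0"
  shows "is_zsubgroup {x\<in>A. d dvd \<phi> x}" "qcard A {x\<in>A. d dvd \<phi> x} = nat d"
proof -
  let ?Y = "{x\<in>A. d dvd \<phi> x}"
  have z: "\<phi> 0 = 0" using add[of 0 0] zsubgroup_0[OF A] by simp
  have diff: "\<phi> (x - y) = \<phi> x - \<phi> y" if "x \<in> A" "y \<in> A" for x y
    using add[of "x - y" y] that A by (simp add: zsubgroup_diff)
  show Y: "is_zsubgroup ?Y"
    using A z add diff[OF zsubgroup_0[OF A]] unfolding is_zsubgroup_def by auto
  have "qcard A ?Y = card ((\<lambda>x. \<phi> x mod d) ` A)"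
    unfolding qcard_def
  proof (rule card_image_eq_kernel)
    fix x y assume xy: "x \<in> A" "y \<in> A"
    have "{z \<in> A. z - x \<in> ?Y} = {z \<in> A. z - y \<in> ?Y} \<longleftrightarrow> x - y \<in> ?Y"
      using Y A xy by (intro coset_eq_iff) auto
    also have "\<dots> \<longleftrightarrow> \<phi> x mod d = \<phi> y mod d"
      using xy A by (simp add: diff zsubgroup_diff mod_eq_dvd_iff)
    finally show "{z \<in> A. z - x \<in> ?Y} = {z \<in> A. z - y \<in> ?Y} \<longleftrightarrow> \<phi> x mod d = \<phi> y mod d" .
  qed
  also have "(\<lambda>x. \<phi> x mod d) ` A = (\<lambda>k. k mod d) ` UNIV"
    unfolding surj[symmetric] image_image ..
  also have "card \<dots> = nat d"
  proof (cases "d = 0")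
    case False
    then have "(\<lambda>k. k mod d) ` UNIV = {0..<d}"
      using d by (auto simp: image_iff intro!: exI[of _ "_::int"] mod_pos_pos_trivial[symmetric])
    then show ?thesis by simp
  qed (simp add: infinite_UNIV_int)
  finally show "qcard A ?Y = nat d" .
qed

context
  fixes A :: "'a::ab_group_add set" and a as
  assumes A: "is_zsubgroup A" and basis: "is_tf_basis A (a # as)"
begin

abbreviation hyperplane :: "'a set" where
  "hyperplane \<equiv> {x\<in>A. coords (a # as) x 0 = 0}"

lemma coords0_add: "x \<in> A \<Longrightarrow> y \<in> A \<Longrightarrow>
    coords (a # as) (x + y) 0 = coords (a # as) x 0 + coords (a # as) y 0"
  by (rule coords_add[OF A basis]) auto

lemma coords0_surj: "(\<lambda>x. coords (a # as) x 0) ` A = UNIV"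
proof -
  have a: "a \<in> A" using basis_subset[OF A basis] by simp
  have "k = coords (a # as) (zsmul k a) 0" for k
    using coords_zsmul[OF A basis a, of 0 k] coords_basis[OF A basis, of 0 0] by simp
  then show ?thesis using a A by (auto intro!: image_eqI[of _ _ "zsmul _ a"] zsubgroup_zsmul)
qed

lemma zsubgroup_hyperplane: "is_zsubgroup hyperplane"
  using qcard_int_functional(1)[OF A coords0_add coords0_surj, of 0] by simp

lemma tors_hyperplane: "tors \<inter> hyperplane = tors \<inter> A"
  using coords_tors[OF A basis, of _ 0] by auto

lemma coords_hyperplane:
  "x \<in> hyperplane \<Longrightarrow> x - lc (\<lambda>i. coords (a # as) x (Suc i)) as \<in> tors"
  using coords[OF A basis, of x] by (simp add: lc_Cons)

lemma hyperplane_basis: "is_tf_basis hyperplane as"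
  unfolding is_tf_basis_iff[OF zsubgroup_hyperplane]
proof (intro conjI allI impI ballI)
  show "set as \<subseteq> hyperplane"
    using coords_basis[OF A basis, of "Suc _" 0] basis_subset[OF A basis]
    by (auto simp: in_set_conv_nth)
  show "\<exists>c. x - lc c as \<in> tors" if "x \<in> hyperplane" for x
    using coords_hyperplane[OF that] by blast
  show "c i = 0" if "lc c as \<in> tors" "i < length as" for c i
    using basis_independent[OF A basis, of "case_nat 0 c" "Suc i"] that by (simp add: lc_Cons)
qed

lemma coords_hyperplane_Suc:
  "x \<in> hyperplane \<Longrightarrow> i < length as \<Longrightarrow> coords as x i = coords (a # as) x (Suc i)"
  by (rule coords_unique[OF zsubgroup_hyperplane hyperplane_basis _ coords_hyperplane])

end

text \<open>Hermite normal form: split off the first coordinate, whose values on \<open>B\<close> form an ideal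
  of the integers.\<close>
lemma triangular_basis:
  fixes A B :: "'a::ab_group_add set"
  assumes "is_zsubgroup A" "finite (tors \<inter> A)" "is_tf_basis A as" "is_zsubgroup B" "B \<subseteq> A"
  shows "\<exists>bs. is_tf_basis B bs \<and> length bs \<le> length as \<and> (qcard A B \<noteq> 0 \<longrightarrow> length bs = length as) \<and>
    (length bs = length as \<longrightarrow> det (tfmat (\<lambda>x. x) bs as) \<noteq> 0 \<and>
      \<bar>det (tfmat (\<lambda>x. x) bs as)\<bar> * int (card (tors \<inter> A)) = int (qcard A B * card (tors \<inter> B)))"
  using assms
proof (induction as arbitrary: A B)
  case Nil
  note N = Nil
  \<comment> \<open>With an empty basis everything is torsion, the determinant is 1, and the formula
    is Lagrange's theorem.\<close>
  have At: "A \<subseteq> tors"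
    using N(3) unfolding is_tf_basis_iff[OF N(1)] by (auto simp: lc_def)
  then have t: "tors \<inter> A = A" "tors \<inter> B = B" using N(5) by auto
  have "is_tf_basis B []"
    unfolding is_tf_basis_iff[OF N(4)] using At N(5) by (auto simp: lc_def)
  moreover have "det (tfmat (\<lambda>x. x) ([] :: 'a list) ([] :: 'a list)) = 1"
    by (rule det_dim_zero) (metis list.size(3) tfmat_carrier)
  ultimately show ?case
    using card_lagrange[OF N(1,4,5)] by (intro exI[of _ "[]"]) (simp only: t, simp)
next
  case (Cons a as)
  note A = Cons.prems(1) and finA = Cons.prems(2) and as = Cons.prems(3)
    and B = Cons.prems(4) and BA = Cons.prems(5)
  define \<phi> where "\<phi> x = coords (a # as) x 0" for x
  define A' where "A' = {x\<in>A. \<phi> x = 0}"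
  define B' where "B' = {x\<in>B. \<phi> x = 0}"
  have A': "is_zsubgroup A'" "is_tf_basis A' as" "tors \<inter> A' = tors \<inter> A"
    using zsubgroup_hyperplane[OF A as] hyperplane_basis[OF A as] tors_hyperplane[OF A as]
    by (simp_all add: A'_def \<phi>_def)
  have B'_eq: "B' = A' \<inter> B" using BA by (auto simp: A'_def B'_def)
  have B': "is_zsubgroup B'" "B' \<subseteq> A'" "tors \<inter> B' = tors \<inter> B"
    using zsubgroup_Int[OF A'(1) B] A'(3) BA by (auto simp: B'_eq)
  have \<phi>_add: "\<phi> (x + y) = \<phi> x + \<phi> y" if "x \<in> A" "y \<in> A" for x y
    using that by (simp add: \<phi>_def coords0_add[OF A as])
  have \<phi>_sc: "\<phi> (zsmul k x) = k * \<phi> x" if "x \<in> A" for x k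
    using that by (simp add: \<phi>_def coords_zsmul[OF A as])
  have \<phi>_diff: "\<phi> (x - y) = \<phi> x - \<phi> y" if "x \<in> A" "y \<in> A" for x y
    using that by (simp add: \<phi>_def coords_diff[OF A as])
  have \<phi>_tors: "\<phi> x = 0" if "x \<in> A" "x \<in> tors" for x
    using that by (simp add: \<phi>_def coords_tors[OF A as])
  obtain b where b: "b \<in> B" "\<phi> b \<ge> 0" "\<And>x. x \<in> B \<Longrightarrow> \<phi> b dvd \<phi> x"
    using least_generator[OF B, of \<phi>] \<phi>_add \<phi>_sc BA by blast
  define d where "d = \<phi> b"
  define Y where "Y = {x\<in>A. d dvd \<phi> x}"
  have Y: "is_zsubgroup Y" "qcard A Y = nat d"
    using qcard_int_functional[OF A coords0_add[OF A as] coords0_surj[OF A as] b(2)]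
    by (simp_all add: Y_def d_def \<phi>_def)
  have BY: "B \<subseteq> Y" "Y \<subseteq> A" using b BA by (auto simp: Y_def d_def)
  have reduce: "\<exists>k. y - zsmul k b \<in> A'" if "y \<in> Y" for y
  proof -
    obtain k where "\<phi> y = d * k" using \<open>y \<in> Y\<close> by (auto simp: Y_def)
    then have "y - zsmul k b \<in> A'"
      using that b(1) BA BY(2) A by (auto simp: A'_def \<phi>_diff \<phi>_sc d_def intro!: zsubgroup_diff zsubgroup_zsmul)
        (metis A BA b(1) \<phi>_diff \<phi>_sc d_def diff_self mult.commute subsetD zsubgroup_zsmul)
    then show ?thesis ..
  qed
  \<comment> \<open>\<open>reduce\<close> says Y = A' + Zb with b in B, and B' = A' \<inter> B, so
    inclusion identifies A'/B' with Y/B. The remaining index [A:Y] = d is the new diagonal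
    entry.\<close>
  have "qcard A' B' = qcard Y B"
  proof (rule qcard_iso[where f="\<lambda>x. x"])
    show "\<exists>x\<in>A'. y - x \<in> B" if "y \<in> Y" for y
    proof -
      obtain k where "y - zsmul k b \<in> A'" using reduce[OF \<open>y \<in> Y\<close>] by blast
      moreover have "y - (y - zsmul k b) \<in> B" using b(1) B by (simp add: zsubgroup_zsmul)
      ultimately show ?thesis by blast
    qed
  qed (use A' B B' BY Y B'_eq in \<open>auto simp: zhom_id Y_def A'_def\<close>)
  then have q: "qcard A B = nat d * qcard A' B'"
    using qcard_mult[OF A Y(1) B BY] Y(2) by simp
  obtain bs where bs: "is_tf_basis B' bs" "length bs \<le> length as"
    "qcard A' B' \<noteq> 0 \<longrightarrow> length bs = length as"
    "length bs = length as \<longrightarrow> det (tfmat (\<lambda>x. x) bs as) \<noteq> 0 \<and>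
      \<bar>det (tfmat (\<lambda>x. x) bs as)\<bar> * int (card (tors \<inter> A')) = int (qcard A' B' * card (tors \<inter> B'))"
    using Cons.IH[OF A'(1) _ A'(2) B'(1,2)] finA A'(3) by auto
  show ?case
  proof (cases "d = 0")
    case True
    \<comment> \<open>B lies in the hyperplane: its index is infinite and its basis is shorter than
      \<open>a # as\<close>, so the clauses on determinants hold vacuously.\<close>
    then have "B' = B" using b(3) by (auto simp: B'_def d_def)
    then show ?thesis using bs q True by (intro exI[of _ bs]) auto
  next
    case False
    then have d: "d > 0" using b(2) by (simp add: d_def)
    have bbs: "is_tf_basis B (b # bs)"
      unfolding is_tf_basis_iff[OF B]
    proof (intro conjI allI impI ballI)
      show "set (b # bs) \<subseteq> B" using b(1) basis_subset[OF B'(1) bs(1)] by (auto simp: B'_def)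
      show "\<exists>c. x - lc c (b # bs) \<in> tors" if "x \<in> B" for x
      proof -
        obtain k where "x - zsmul k b \<in> A'" using reduce BY \<open>x \<in> B\<close> by blast
        then have "x - zsmul k b \<in> B'"
          using \<open>x \<in> B\<close> b(1) B by (auto simp: B'_eq intro!: zsubgroup_diff zsubgroup_zsmul)
        then have "x - zsmul k b - lc (coords bs (x - zsmul k b)) bs \<in> tors"
          by (rule coords[OF B'(1) bs(1)])
        then have "x - lc (case_nat k (coords bs (x - zsmul k b))) (b # bs) \<in> tors"
          by (simp add: lc_Cons diff_diff_eq)
        then show ?thesis by blast
      qed
      show "c i = 0" if c: "lc c (b # bs) \<in> tors" and i: "i < length (b # bs)" for c i
      proof -
        have l: "lc (\<lambda>i. c (Suc i)) bs \<in> B'" by (rule lc_mem[OF B'(1) basis_subset[OF B'(1) bs(1)]])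
        have m: "zsmul (c 0) b \<in> A" "lc (\<lambda>i. c (Suc i)) bs \<in> A"
          using l b(1) B BA A by (auto simp: B'_def intro!: zsubgroup_zsmul dest: zsubgroup_zsmul[of B b])
        have "\<phi> (lc c (b # bs)) = c 0 * d"
          using l m b(1) BA by (auto simp: lc_Cons \<phi>_add \<phi>_sc d_def B'_def)
        moreover have "\<phi> (lc c (b # bs)) = 0"
          using c m A by (auto simp: lc_Cons intro!: \<phi>_tors zsubgroup_add)
        ultimately have c0: "c 0 = 0" using d by simp
        show ?thesis
        proof (cases i)
          case (Suc j)
          then show ?thesis
            using basis_independent[OF B'(1) bs(1), of "\<lambda>i. c (Suc i)" j] c c0 i by (simp add: lc_Cons)
        qed (simp add: c0)
      qed
    qed
    have "det (tfmat (\<lambda>x. x) (b # bs) (a # as)) = d * det (tfmat (\<lambda>x. x) bs as)"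
      if len: "length bs = length as"
    proof -
      let ?n = "length as"
      define R where "R = mat 1 ?n (\<lambda>(_, j). coords (a # as) b (Suc j))"
      have "tfmat (\<lambda>x. x) (b # bs) (a # as) =
          four_block_mat (mat 1 1 (\<lambda>_. d)) R (0\<^sub>m ?n 1) (tfmat (\<lambda>x. x) bs as)" (is "?L = ?R")
      proof (rule eq_matI)
        fix i j assume "i < dim_row ?R" "j < dim_col ?R"
        then have ij: "i < Suc ?n" "j < Suc ?n" using len by (simp_all add: tfmat_def)
        show "?L $$ (i, j) = ?R $$ (i, j)"
        proof (cases i)
          case 0
          then show ?thesis using ij len by (cases j) (simp_all add: tfmat_def R_def d_def \<phi>_def)
        next
          case (Suc i')
          then have *: "bs ! i' \<in> A'"
            using ij len basis_nth[OF B'(1) bs(1), of i'] B'(2) by auto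
          then have "coords (a # as) (bs ! i') 0 = 0" by (simp add: A'_def \<phi>_def)
          then show ?thesis
            using Suc ij len * coords_hyperplane_Suc[OF A as, of "bs ! i'"]
            by (cases j) (simp_all add: tfmat_def A'_def \<phi>_def)
        qed
      qed (use len in \<open>simp_all add: tfmat_def R_def\<close>)
      then have "det (tfmat (\<lambda>x. x) (b # bs) (a # as)) =
          det (mat 1 1 (\<lambda>_. d)) * det (tfmat (\<lambda>x. x) bs as)"
        using det_four_block_mat_lower_left_zero[of "mat 1 1 (\<lambda>_. d)" 1 R ?n "0\<^sub>m ?n 1" "tfmat (\<lambda>x. x) bs as"] len
          tfmat_carrier[of "\<lambda>x. x" bs as]
        by (simp add: R_def)
      then show ?thesis by (simp add: det_single)
    qed
    then show ?thesis
      using bs bbs q d A'(3) B'(3)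
      by (intro exI[of _ "b # bs"]) (auto simp: abs_mult algebra_simps)
  qed
qed

text \<open>The given \<open>bs\<close> differs from the triangular basis by a unimodular matrix,
  which can only change the sign. The formula says that [A_tf : B_tf] is [A:B] divided by
  [A_tors : B_tors].\<close>

lemma
  assumes A: "is_zsubgroup A" "finite (tors \<inter> A)" and as: "is_tf_basis A as"
    and B: "is_zsubgroup B" "B \<subseteq> A" and bs: "is_tf_basis B bs"
  shows tf_rank_eq_of_index: "qcard A B \<noteq> 0 \<Longrightarrow> length bs = length as"
    and index_eq_abs_det: "length bs = length as \<Longrightarrow> det (tfmat (\<lambda>x. x) bs as) \<noteq> 0 \<and>
      \<bar>det (tfmat (\<lambda>x. x) bs as)\<bar> * int (card (tors \<inter> A)) = int (qcard A B * card (tors \<inter> B))"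
proof -
  obtain cs where cs: "is_tf_basis B cs" "qcard A B \<noteq> 0 \<longrightarrow> length cs = length as"
    "length cs = length as \<longrightarrow> det (tfmat (\<lambda>x. x) cs as) \<noteq> 0 \<and>
      \<bar>det (tfmat (\<lambda>x. x) cs as)\<bar> * int (card (tors \<inter> A)) = int (qcard A B * card (tors \<inter> B))"
    using triangular_basis[OF A as B] by blast
  have len: "length cs = length bs" using tf_basis_length_eq[OF B(1) cs(1) bs] .
  then show "qcard A B \<noteq> 0 \<Longrightarrow> length bs = length as" using cs by simp
  assume l: "length bs = length as"
  have "tfmat (\<lambda>x. x) bs as = tfmat (\<lambda>x. x) bs cs * tfmat (\<lambda>x. x) cs as"
    using tfmat_comp[OF B(1) cs(1) A(1) as, of bs "\<lambda>x. x" "\<lambda>x. x"] basis_nth[OF B(1) bs] B(2)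
    by (auto simp: zhom_id)
  then have "det (tfmat (\<lambda>x. x) bs as) = det (tfmat (\<lambda>x. x) bs cs) * det (tfmat (\<lambda>x. x) cs as)"
    using det_mult[of "tfmat (\<lambda>x. x) bs cs" "length as" "tfmat (\<lambda>x. x) cs as"] len l
    by (metis tfmat_carrier)
  then have "\<bar>det (tfmat (\<lambda>x. x) bs as)\<bar> = \<bar>det (tfmat (\<lambda>x. x) cs as)\<bar>"
    using abs_det_tfmat_id[OF B(1) bs cs(1)] by (simp add: abs_mult)
  then show "det (tfmat (\<lambda>x. x) bs as) \<noteq> 0 \<and>
      \<bar>det (tfmat (\<lambda>x. x) bs as)\<bar> * int (card (tors \<inter> A)) = int (qcard A B * card (tors \<inter> B))"
    using cs len l by auto
qed

lemma zlattice_subgroup: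
  assumes "zlattice A" "is_zsubgroup B" "B \<subseteq> A"
  shows "zlattice B"
proof -
  obtain as where "is_zsubgroup A" "finite (tors \<inter> A)" "is_tf_basis A as"
    using assms(1) by (auto simp: zlattice_def)
  then have "\<exists>bs. is_tf_basis B bs" using triangular_basis assms(2,3) by blast
  moreover have "finite (tors \<inter> B)" using \<open>finite (tors \<inter> A)\<close> assms(3) by (auto intro: rev_finite_subset)
  ultimately show ?thesis using assms(2) by (simp add: zlattice_def)
qed

text \<open>\<open>f\<close> loses only torsion, so relations modulo torsion agree before and after
  \<open>f\<close>. This serves both to push a basis forward and to pull one back along
  multiplication by n.\<close>

lemma image_basis_iff:
  assumes A: "is_zsubgroup A" and f: "zhom f" and inj: "\<And>x. x \<in> A \<Longrightarrow> f x \<in> tors \<Longrightarrow> x \<in> tors"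
    and as: "set as \<subseteq> A"
  shows "is_tf_basis (f ` A) (map f as) \<longleftrightarrow> is_tf_basis A as"
proof -
  have *: "f x - lc c (map f as) \<in> tors \<longleftrightarrow> x - lc c as \<in> tors" if "x \<in> A" for x c
    using inj[of "x - lc c as"] that A as zhom_tors[OF f, of "x - lc c as"]
    by (auto simp: lc_map[OF f] zhom_diff[OF f, symmetric] lc_mem zsubgroup_diff)
  have **: "lc c (map f as) \<in> tors \<longleftrightarrow> lc c as \<in> tors" for c
    using inj[of "lc c as"] A as zhom_tors[OF f, of "lc c as"]
    by (auto simp: lc_map[OF f] lc_mem)
  show ?thesis
    unfolding is_tf_basis_iff[OF A] is_tf_basis_iff[OF zsubgroup_image[OF f A]]
    using as by (simp add: * ** image_mono)
qed

text \<open>The kernel of \<open>f\<close> is torsion, so |A_tors| = |f(A)_tors| |ker f|; this turns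
  the index formula for the subgroup f(A) of B into one for \<open>f\<close> itself.\<close>

lemma
  assumes A: "zlattice A" "is_tf_basis A as" and B: "zlattice B" "is_tf_basis B bs"
    and f: "zhom (f :: 'a::ab_group_add \<Rightarrow> 'b::ab_group_add)" "\<And>x. x \<in> A \<Longrightarrow> f x \<in> B" "\<And>x. x \<in> A \<Longrightarrow> f x \<in> tors \<Longrightarrow> x \<in> tors"
  shows tf_rank_eq_hom: "qcard B (f ` A) \<noteq> 0 \<Longrightarrow> length as = length bs"
    and index_hom: "length as = length bs \<Longrightarrow> det (tfmat f as bs) \<noteq> 0 \<and>
      \<bar>det (tfmat f as bs)\<bar> * int (card (tors \<inter> B) * card {x\<in>A. f x = 0}) =
        int (qcard B (f ` A) * card (tors \<inter> A))"
proof -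
  have A': "is_zsubgroup A" "finite (tors \<inter> A)" and B': "is_zsubgroup B" "finite (tors \<inter> B)"
    using A B by (simp_all add: zlattice_def)
  note as = basis_subset[OF A'(1) A(2)]
  have b: "is_tf_basis (f ` A) (map f as)"
    using image_basis_iff[OF A'(1) f(1,3) as] A(2) by simp
  have s: "is_zsubgroup (f ` A)" "f ` A \<subseteq> B" using zsubgroup_image[OF f(1) A'(1)] f(2) by auto
  have m: "tfmat (\<lambda>x. x) (map f as) bs = tfmat f as bs"
    by (rule eq_matI) (simp_all add: tfmat_def)
  have t: "tors \<inter> f ` A = f ` (tors \<inter> A)" using f(3) zhom_tors[OF f(1)] by auto
  have k: "{x \<in> tors \<inter> A. f x = 0} = {x \<in> A. f x = 0}"
    using f(3) zsubgroup_0[OF zsubgroup_tors, where 'a='b] by auto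
  have c: "card (tors \<inter> A) = card (tors \<inter> f ` A) * card {x\<in>A. f x = 0}"
    using card_hom[OF zsubgroup_Int[OF zsubgroup_tors A'(1)] f(1)] by (simp only: t k)
  show "qcard B (f ` A) \<noteq> 0 \<Longrightarrow> length as = length bs"
    using tf_rank_eq_of_index[OF B' B(2) s b] by simp
  assume "length as = length bs"
  then have *: "det (tfmat f as bs) \<noteq> 0" "\<bar>det (tfmat f as bs)\<bar> * int (card (tors \<inter> B)) =
      int (qcard B (f ` A) * card (tors \<inter> f ` A))"
    using index_eq_abs_det[OF B' B(2) s b] m by simp_all
  then show "det (tfmat f as bs) \<noteq> 0 \<and>
      \<bar>det (tfmat f as bs)\<bar> * int (card (tors \<inter> B) * card {x\<in>A. f x = 0}) =
        int (qcard B (f ` A) * card (tors \<inter> A))"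
    using arg_cong[OF *(2), of "\<lambda>n. n * int (card {x\<in>A. f x = 0})"] *(1)
    unfolding c of_nat_mult mult.assoc by blast
qed

definition tfbasis :: "'a::ab_group_add set \<Rightarrow> 'a list" where
  "tfbasis A = (SOME bs. is_tf_basis A bs)"

definition rk :: "'a::ab_group_add set \<Rightarrow> nat" where
  "rk A = length (tfbasis A)"

lemma tfbasis: "zlattice A \<Longrightarrow> is_tf_basis A (tfbasis A)"
  unfolding zlattice_def tfbasis_def by (auto intro: someI_ex)

lemma rk_eqI: "is_zsubgroup A \<Longrightarrow> is_tf_basis A as \<Longrightarrow> rk A = length as"
  unfolding rk_def by (rule tf_basis_length_eq) (auto simp: tfbasis_def intro: someI)

lemma zlattice_imp_zsubgroup: "zlattice A \<Longrightarrow> is_zsubgroup A"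
  by (simp add: zlattice_def)

lemma card_tors_pos: "zlattice A \<Longrightarrow> card (tors \<inter> A) > 0"
  using zsubgroup_0[OF zsubgroup_tors] zsubgroup_0[of A] by (auto simp: zlattice_def card_gt_0_iff)

lemma rk_eq_of_index:
  assumes "zlattice A" "is_zsubgroup B" "B \<subseteq> A" "qcard A B \<noteq> 0"
  shows "rk B = rk A"
  unfolding rk_def
  using assms tfbasis[OF assms(1)] tfbasis[OF zlattice_subgroup[OF assms(1-3)]]
  by (intro tf_rank_eq_of_index[of A _ B]) (auto simp: zlattice_def)

text \<open>Multiplication by n has a scalar matrix of determinant \<open>n ^ rk A\<close>; the
  torsion orders on the two sides cancel and the n-torsion of A remains.\<close>

lemma index_zsmul:
  assumes A: "zlattice A" and n: "n > 0"
  shows "qcard A (zsmul n ` A) = nat n ^ rk A * card {x\<in>A. zsmul n x = 0}"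
proof -
  note Z = zlattice_imp_zsubgroup[OF A] and b = tfbasis[OF A]
  have "tfmat (zsmul n) (tfbasis A) (tfbasis A) = n \<cdot>\<^sub>m 1\<^sub>m (rk A)"
    by (rule eq_matI)
      (auto simp: tfmat_def rk_def coords_zsmul[OF Z b basis_nth[OF Z b]] coords_basis[OF Z b])
  then have "det (tfmat (zsmul n) (tfbasis A) (tfbasis A)) = n ^ rk A" by simp
  then have "n ^ rk A * int (card (tors \<inter> A) * card {x\<in>A. zsmul n x = 0}) =
      int (qcard A (zsmul n ` A) * card (tors \<inter> A))"
    using index_hom[OF A b A b zhom_zsmul_fun, of n] n
    by (simp add: zsubgroup_zsmul[OF Z] zsmul_tors_iff)
  moreover have "n = int (nat n)" using n by simp
  ultimately have "int (nat n ^ rk A * card {x\<in>A. zsmul n x = 0} * card (tors \<inter> A)) =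
      int (qcard A (zsmul n ` A) * card (tors \<inter> A))"
    by (metis (no_types, lifting) mult.assoc mult.commute of_nat_mult of_nat_power)
  then show ?thesis using card_tors_pos[OF A] by (simp only: of_nat_eq_iff mult_cancel2) simp
qed

lemma finite_zsmul_kernel:
  assumes "zlattice A" "n \<noteq> 0" shows "finite {x\<in>A. zsmul n x = 0}"
proof -
  have "{x\<in>A. zsmul n x = 0} \<subseteq> tors \<inter> A" using torsI[OF assms(2)] by auto
  then show ?thesis using assms(1) by (auto simp: zlattice_def intro: rev_finite_subset)
qed

text \<open>B contains nA, whose index is finite by \<open>index_zsmul\<close>. This is the
  finiteness criterion used below.\<close>

lemma qcard_nonzero:
  assumes A: "zlattice A" and B: "is_zsubgroup B" "B \<subseteq> A"
    and n: "n > 0" "\<And>x. x \<in> A \<Longrightarrow> zsmul n x \<in> B"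
  shows "qcard A B \<noteq> 0"
proof -
  note Z = zlattice_imp_zsubgroup[OF A]
  have "0 \<in> {x\<in>A. zsmul n x = 0}" using Z by (simp add: zsubgroup_0)
  then have "card {x\<in>A. zsmul n x = 0} \<noteq> 0"
    using finite_zsmul_kernel[OF A, of n] n by (metis (lifting) card_0_eq empty_iff less_irrefl)
  then have "qcard A (zsmul n ` A) \<noteq> 0" using index_zsmul[OF A n(1)] n by simp
  moreover have "qcard A (zsmul n ` A) = qcard A B * qcard B (zsmul n ` A)"
    using n(2) by (intro qcard_mult Z B zsubgroup_image zhom_zsmul_fun) auto
  ultimately show ?thesis by auto
qed

section \<open>Finitely generated groups are lattices\<close>

lemma zlattice_trivial: "zlattice {0}"
  using zsubgroup_trivial zsubgroup_0[OF zsubgroup_tors]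
  unfolding zlattice_def is_tf_basis_iff[OF zsubgroup_trivial]
  by (auto intro!: exI[of _ "[]"] simp: lc_def)

text \<open>Either some positive multiple n x lies in A; then multiplication by n carries the
  enlarged group into A, and a basis is pulled back from there. Or no such multiple does, and x is a
  new free generator.\<close>

lemma zlattice_adjoin:
  assumes "zlattice A"
  shows "zlattice (ssum A (range (\<lambda>k. zsmul k x)))" (is "zlattice ?A'")
proof -
  have A: "is_zsubgroup A" "finite (tors \<inter> A)" using assms by (simp_all add: zlattice_def)
  obtain bs where bs: "is_tf_basis A bs" using assms by (auto simp: zlattice_def)
  have "zhom (\<lambda>k. zsmul k x)" by (simp add: zhom_def zsmul_add_left)
  then have A': "is_zsubgroup ?A'" by (intro zsubgroup_ssum A zsubgroup_image zsubgroup_UNIV)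
  have elem: "y \<in> ?A' \<longleftrightarrow> (\<exists>k. y - zsmul k x \<in> A)" for y
  proof
    assume "y \<in> ?A'"
    then obtain a k where "a \<in> A" "y = a + zsmul k x" by (auto elim: ssumE)
    then have "y - zsmul k x \<in> A" by simp
    then show "\<exists>k. y - zsmul k x \<in> A" ..
  next
    assume "\<exists>k. y - zsmul k x \<in> A"
    then obtain k where "y - zsmul k x \<in> A" ..
    then have "(y - zsmul k x) + zsmul k x \<in> ?A'" by (intro ssumI) auto
    then show "y \<in> ?A'" by simp
  qed
  have AA': "A \<subseteq> ?A'" unfolding subset_iff elem by (metis zsmul_0 diff_zero)
  show ?thesis
  proof (cases "\<exists>n>0. zsmul n x \<in> A")
    case True
    then obtain n where n: "n > 0" "zsmul n x \<in> A" by auto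
    have sub: "zsmul n ` ?A' \<subseteq> A"
    proof (rule image_subsetI)
      fix y assume "y \<in> ?A'"
      then obtain k where k: "y - zsmul k x \<in> A" using elem by blast
      have "zsmul n y = zsmul n (y - zsmul k x) + zsmul k (zsmul n x)"
        by (simp add: zmod.scale_right_diff_distrib zsmul_zsmul mult.commute)
      then show "zsmul n y \<in> A" using k n A by (metis zsubgroup_add zsubgroup_zsmul)
    qed
    have "zlattice (zsmul n ` ?A')"
      using zlattice_subgroup[OF assms zsubgroup_image[OF zhom_zsmul_fun A'] sub] .
    then obtain bs where bs: "is_tf_basis (zsmul n ` ?A') bs" by (auto simp: zlattice_def)
    have "set bs \<subseteq> zsmul n ` ?A'"
      by (rule basis_subset[OF zsubgroup_image[OF zhom_zsmul_fun A'] bs])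
    then have "bs \<in> lists (zsmul n ` ?A')" by auto
    then obtain cs where cs: "bs = map (zsmul n) cs" "set cs \<subseteq> ?A'"
      unfolding lists_image by (auto simp: in_lists_conv_set)
    have "is_tf_basis ?A' cs"
      using image_basis_iff[OF A' zhom_zsmul_fun _ cs(2), of n] bs n(1) cs(1)
      by (simp add: zsmul_tors_iff)
    moreover have "finite (tors \<inter> ?A')"
    proof -
      \<comment> \<open>Reducing k modulo n leaves finitely many cosets of A, and torsion elements
        of one coset differ by torsion of A.\<close>
      have "tors \<inter> ?A' \<subseteq> (\<Union>i\<in>{0..<n}. {t\<in>tors. t - zsmul i x \<in> A})"
      proof
        fix t assume t: "t \<in> tors \<inter> ?A'"
        then obtain k where k: "t - zsmul k x \<in> A" using elem by blast
        have "zsmul k x = zsmul (k div n) (zsmul n x) + zsmul (k mod n) x"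
          by (simp only: zsmul_zsmul zsmul_add_left[symmetric] div_mult_mod_eq)
        then have "t - zsmul (k mod n) x = (t - zsmul k x) + zsmul (k div n) (zsmul n x)" by simp
        then have "t - zsmul (k mod n) x \<in> A" using k n A by (metis zsubgroup_add zsubgroup_zsmul)
        then show "t \<in> (\<Union>i\<in>{0..<n}. {t\<in>tors. t - zsmul i x \<in> A})"
          using t n by (auto intro!: bexI[of _ "k mod n"])
      qed
      moreover have "finite {t\<in>tors. t - zsmul i x \<in> A}" for i
      proof (cases "\<exists>t0. t0 \<in> tors \<and> t0 - zsmul i x \<in> A")
        case True
        then obtain t0 where t0: "t0 \<in> tors" "t0 - zsmul i x \<in> A" by blast
        have "{t\<in>tors. t - zsmul i x \<in> A} \<subseteq> (\<lambda>t. t + t0) ` (tors \<inter> A)"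
        proof
          fix t assume t: "t \<in> {t\<in>tors. t - zsmul i x \<in> A}"
          have "t - t0 = (t - zsmul i x) - (t0 - zsmul i x)" by simp
          then have "t - t0 \<in> tors \<inter> A" using t t0 A(1) zsubgroup_tors
            by (metis (no_types, lifting) IntI mem_Collect_eq zsubgroup_diff)
          then show "t \<in> (\<lambda>t. t + t0) ` (tors \<inter> A)" by (rule rev_image_eqI) simp
        qed
        then show ?thesis using A(2) finite_surj by blast
      next
        case False
        then have "{t\<in>tors. t - zsmul i x \<in> A} = {}" by blast
        then show ?thesis by (metis finite.emptyI)
      qed
      ultimately show ?thesis by (meson finite_UN_I finite_atLeastLessThan_int finite_subset)
    qed
    ultimately show ?thesis using A' by (auto simp: zlattice_def)
  next
    case False
    have no: "k = 0" if "zsmul k x \<in> A" for k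
      using that False A(1) zsubgroup_uminus[of A "zsmul k x"]
      by (metis linorder_neqE_linordered_idom neg_0_less_iff_less zsmul_uminus)
    have tk: "k = 0" if a: "a \<in> A" and t: "zsmul k x + a \<in> tors" for a k
    proof -
      obtain m where m: "m > 0" "zsmul m (zsmul k x + a) = 0" using t by (auto simp: tors_def)
      then have "zsmul (m * k) x = - zsmul m a"
        by (simp add: zsmul_add_right zsmul_zsmul eq_neg_iff_add_eq_0)
      then have "zsmul (m * k) x \<in> A" using a A(1) by (simp add: zsubgroup_intros)
      then show "k = 0" using no[of "m * k"] m(1) by simp
    qed
    have "tors \<inter> ?A' \<subseteq> tors \<inter> A"
    proof
      fix t assume t: "t \<in> tors \<inter> ?A'"
      then obtain k where k: "t - zsmul k x \<in> A" using elem by blast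
      then have "k = 0" using tk[of "t - zsmul k x" k] t by simp
      then show "t \<in> tors \<inter> A" using t k by simp
    qed
    then have "finite (tors \<inter> ?A')" using A(2) finite_subset by blast
    moreover have "is_tf_basis ?A' (x # bs)"
      unfolding is_tf_basis_iff[OF A']
    proof (intro conjI allI impI ballI)
      have "x \<in> ?A'" unfolding elem using zsubgroup_0[OF A(1)] by (auto intro!: exI[of _ 1])
      then show "set (x # bs) \<subseteq> ?A'" using basis_subset[OF A(1) bs] AA' by auto
      show "\<exists>c. y - lc c (x # bs) \<in> tors" if y: "y \<in> ?A'" for y
      proof -
        obtain k where k: "y - zsmul k x \<in> A" using y elem by blast
        have "y - lc (case_nat k (coords bs (y - zsmul k x))) (x # bs) \<in> tors"
          using coords[OF A(1) bs k] by (simp add: lc_Cons diff_diff_eq)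
        then show ?thesis by blast
      qed
      show "c i = 0" if c: "lc c (x # bs) \<in> tors" and i: "i < length (x # bs)" for c i
      proof -
        have "c 0 = 0"
          using tk[OF lc_mem[OF A(1) basis_subset[OF A(1) bs]]] c by (simp add: lc_Cons)
        then show ?thesis
          using basis_independent[OF A(1) bs, of "\<lambda>i. c (Suc i)"] c i
          by (cases i) (auto simp: lc_Cons)
      qed
    qed
    ultimately show ?thesis using A' by (auto simp: zlattice_def)
  qed
qed

lemma zlattice_finite_superset: "finite S \<Longrightarrow> \<exists>A. zlattice A \<and> S \<subseteq> A"
proof (induction S rule: finite_induct)
  case (insert x S)
  then obtain A where A: "zlattice A" "S \<subseteq> A" by auto
  have Z: "is_zsubgroup A" using A(1) by (rule zlattice_imp_zsubgroup)
  have "zhom (\<lambda>k. zsmul k x)" by (simp add: zhom_def zsmul_add_left)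
  then have "is_zsubgroup (range (\<lambda>k. zsmul k x))" by (intro zsubgroup_image zsubgroup_UNIV)
  then have "A \<subseteq> ssum A (range (\<lambda>k. zsmul k x))" by (rule ssum_superset)
  moreover have "x \<in> ssum A (range (\<lambda>k. zsmul k x))"
    using ssumI[OF zsubgroup_0[OF Z], of x "range (\<lambda>k. zsmul k x)"] by (simp add: range_eqI[of _ _ 1])
  ultimately show ?case using zlattice_adjoin[OF A(1), of x] A(2) by (intro exI conjI) auto
qed (use zlattice_trivial in auto)

section \<open>Regulators\<close>

definition gramP :: "('a \<Rightarrow> 'a \<Rightarrow> 'l) \<Rightarrow> 'a list \<Rightarrow> 'a list \<Rightarrow> 'l mat" where
  "gramP P as bs = mat (length as) (length bs) (\<lambda>(i, j). P (as ! i) (bs ! j))"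

lemma gramP_carrier [simp]: "gramP P as bs \<in> carrier_mat (length as) (length bs)"
  by (simp add: gramP_def)

lemma gramP_transpose: "transpose_mat (gramP P as bs) = gramP (\<lambda>x y. P y x) bs as"
  by (rule eq_matI) (auto simp: gramP_def)

definition biadditive :: "('a::ab_group_add \<Rightarrow> 'a \<Rightarrow> 'l::ab_group_add) \<Rightarrow> bool" where
  "biadditive P \<longleftrightarrow> (\<forall>y. zhom (\<lambda>x. P x y)) \<and> (\<forall>x. zhom (P x))"

text \<open>n f(x) = f(n x) = 0 for some n > 0, and the field has characteristic 0. Hence pairings
  factor through the quotient by torsion.\<close>

lemma zhom_field_tors:
  fixes f :: "'a::ab_group_add \<Rightarrow> 'l::field_char_0"
  assumes f: "zhom f" and x: "x \<in> tors"
  shows "f x = 0"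
proof -
  have "zsmul n y = of_int n * y" for n and y :: 'l
    by (induction n rule: int_induct[of _ 0]) (simp_all add: zsmul_add1 zsmul_diff1 algebra_simps)
  moreover obtain n where "n > 0" "zsmul n x = 0" using x by (auto simp: tors_def)
  ultimately show ?thesis using zhom_zsmul[OF f, of n x] zhom_0[OF f] by simp
qed

lemma gramP_tfmat_left:
  fixes P :: "'a::ab_group_add \<Rightarrow> 'a \<Rightarrow> 'l::field_char_0"
  assumes P: "biadditive P" and B: "is_zsubgroup B" "is_tf_basis B bs"
    and f: "\<And>x. x \<in> set as \<Longrightarrow> f x \<in> B"
  shows "gramP P (map f as) cs = map_mat of_int (tfmat f as bs) * gramP P bs cs"
proof (rule eq_matI)
  have h: "zhom (\<lambda>x. P x y)" for y using P by (simp add: biadditive_def)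
  fix i k assume ik: "i < dim_row (map_mat of_int (tfmat f as bs) * gramP P bs cs)"
    "k < dim_col (map_mat of_int (tfmat f as bs) * gramP P bs cs)"
  have "P (f (as ! i)) (cs ! k) =
      (\<Sum>j<length bs. of_int (coords bs (f (as ! i)) j) * P (bs ! j) (cs ! k))"
    by (rule functional_coords[OF B]) (use ik f in \<open>auto simp: zhom_add[OF h] zhom_field_tors[OF h] tfmat_def\<close>)
  then show "gramP P (map f as) cs $$ (i, k) = (map_mat of_int (tfmat f as bs) * gramP P bs cs) $$ (i, k)"
    using ik by (simp add: gramP_def tfmat_def scalar_prod_def atLeast0LessThan)
qed (simp_all add: gramP_def tfmat_def)

lemma gramP_tfmat_right:
  fixes P :: "'a::ab_group_add \<Rightarrow> 'a \<Rightarrow> 'l::field_char_0"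
  assumes P: "biadditive P" and B: "is_zsubgroup B" "is_tf_basis B bs"
    and f: "\<And>x. x \<in> set as \<Longrightarrow> f x \<in> B"
  shows "gramP P cs (map f as) = gramP P cs bs * transpose_mat (map_mat of_int (tfmat f as bs))"
proof -
  have "biadditive (\<lambda>x y. P y x)" using P by (simp add: biadditive_def)
  from gramP_tfmat_left[OF this B, of as f cs]
  have "transpose_mat (gramP (\<lambda>x y. P y x) (map f as) cs) =
    transpose_mat (map_mat of_int (tfmat f as bs) * gramP (\<lambda>x y. P y x) bs cs)" using f by simp
  also have "\<dots> = transpose_mat (gramP (\<lambda>x y. P y x) bs cs) * transpose_mat (map_mat of_int (tfmat f as bs))"
    by (rule transpose_mult[of _ "length as" "length bs" _ "length cs"]) auto
  finally show ?thesis by (simp add: gramP_transpose)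
qed

text \<open>The Gram matrix changes as F G F^T, so the sign of the transition determinant is
  lost.\<close>

lemma det_gramP_change:
  fixes P :: "'a::ab_group_add \<Rightarrow> 'a \<Rightarrow> 'l::field_char_0"
  assumes P: "biadditive P" and A: "is_zsubgroup A" "is_tf_basis A as"
    and bs: "set bs \<subseteq> A" "length bs = length as"
  shows "det (gramP P bs bs) = of_int (det (tfmat (\<lambda>x. x) bs as)) ^ 2 * det (gramP P as as)"
proof -
  let ?F = "map_mat of_int (tfmat (\<lambda>x. x) bs as) :: 'l mat" and ?n = "length as"
  have F: "?F \<in> carrier_mat ?n ?n" using bs(2) tfmat_carrier[of "\<lambda>x. x" bs as] by simp
  have G: "gramP P as as \<in> carrier_mat ?n ?n" by simp
  have "gramP P bs bs = ?F * gramP P as bs"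
    using gramP_tfmat_left[OF P A, of bs "\<lambda>x. x" bs] bs by auto
  also have "gramP P as bs = gramP P as as * transpose_mat ?F"
    using gramP_tfmat_right[OF P A, of bs "\<lambda>x. x" as] bs by auto
  finally have "gramP P bs bs = ?F * (gramP P as as * transpose_mat ?F)" .
  then have "det (gramP P bs bs) = det ?F * (det (gramP P as as) * det (transpose_mat ?F))"
    using det_mult[OF F mult_carrier_mat[OF G]] det_mult[OF G] F by (metis transpose_carrier_mat)
  then show ?thesis
    by (simp add: det_transpose[OF F] power2_eq_square of_int_hom.hom_det)
qed

lemma det_gramP_basis_eq:
  fixes P :: "'a::ab_group_add \<Rightarrow> 'a \<Rightarrow> 'l::field_char_0"
  assumes P: "biadditive P" and A: "is_zsubgroup A" and as: "is_tf_basis A as" and bs: "is_tf_basis A bs"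
  shows "det (gramP P as as) = det (gramP P bs bs)"
proof -
  have "(det (tfmat (\<lambda>x. x) as bs))\<^sup>2 = 1"
    using abs_det_tfmat_id[OF A as bs] by (metis abs_square_eq_1)
  then have "(of_int (det (tfmat (\<lambda>x. x) as bs)) :: 'l)\<^sup>2 = 1"
    by (metis of_int_1 of_int_power)
  then show ?thesis
    using det_gramP_change[OF P A bs basis_subset[OF A as] tf_basis_length_eq[OF A as bs]] by simp
qed

text \<open>The scaling of the pairing by 1/|H| is left out here; it contributes a power of |H|,
  restored in \<open>regulator_factor\<close>.\<close>

definition regD :: "('a::ab_group_add \<Rightarrow> 'a \<Rightarrow> 'l::field_char_0) \<Rightarrow> 'a set \<Rightarrow> 'l" where
  "regD P A = det (gramP P (tfbasis A) (tfbasis A)) / of_nat (card (tors \<inter> A)) ^ 2"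

lemma regD_eq:
  assumes "biadditive P" "zlattice A" "is_tf_basis A as"
  shows "regD P A = det (gramP P as as) / of_nat (card (tors \<inter> A)) ^ 2"
  unfolding regD_def
  using det_gramP_basis_eq[OF assms(1) _ tfbasis[OF assms(2)] assms(3)] assms(2)
  by (simp add: zlattice_def)

lemma regD_index:
  fixes P :: "'a::ab_group_add \<Rightarrow> 'a \<Rightarrow> 'l::field_char_0"
  assumes P: "biadditive P" and A: "zlattice A" and B: "is_zsubgroup B" "B \<subseteq> A"
    and q: "qcard A B \<noteq> 0"
  shows "regD P B = regD P A * of_nat (qcard A B) ^ 2"
proof -
  note BL = zlattice_subgroup[OF A B]
  have A': "is_zsubgroup A" "finite (tors \<inter> A)" using A by (simp_all add: zlattice_def)
  note as = tfbasis[OF A] and bs = tfbasis[OF BL]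
  have len: "length (tfbasis B) = length (tfbasis A)"
    using rk_eq_of_index[OF A B q] by (simp add: rk_def)
  define d where "d = det (tfmat (\<lambda>x. x) (tfbasis B) (tfbasis A))"
  have "\<bar>d\<bar> * int (card (tors \<inter> A)) = int (qcard A B * card (tors \<inter> B))"
    using index_eq_abs_det[OF A' as B bs len] by (simp add: d_def)
  then have "\<bar>d\<bar>\<^sup>2 * (int (card (tors \<inter> A)))\<^sup>2 = (int (qcard A B * card (tors \<inter> B)))\<^sup>2"
    by (metis power_mult_distrib)
  then have "of_int (d\<^sup>2 * (int (card (tors \<inter> A)))\<^sup>2) = (of_int ((int (qcard A B * card (tors \<inter> B)))\<^sup>2) :: 'l)"
    by simp
  then have *: "(of_int d :: 'l)\<^sup>2 * of_nat (card (tors \<inter> A)) ^ 2 =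
      of_nat (qcard A B) ^ 2 * of_nat (card (tors \<inter> B)) ^ 2"
    by (simp add: power_mult_distrib)
  have "det (gramP P (tfbasis B) (tfbasis B)) = of_int d ^ 2 * det (gramP P (tfbasis A) (tfbasis A))"
    unfolding d_def using basis_subset[OF B(1) bs] B(2) len
    by (intro det_gramP_change[OF P A'(1) as]) auto
  then show ?thesis
    using * card_tors_pos[OF A] card_tors_pos[OF BL] unfolding regD_def
    by (simp add: field_simps)
qed

lemma tors_ssum:
  assumes "is_zsubgroup A" "is_zsubgroup B" "A \<inter> B \<subseteq> tors"
  shows "tors \<inter> ssum A B = ssum (tors \<inter> A) (tors \<inter> B)"
proof (intro equalityI subsetI)
  fix x assume x: "x \<in> tors \<inter> ssum A B"
  then obtain a b where ab: "x = a + b" "a \<in> A" "b \<in> B" by (auto elim: ssumE)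
  obtain n where n: "n > 0" "zsmul n x = 0" using x by (auto simp: tors_def)
  then have "zsmul n a = - zsmul n b" by (simp add: ab zsmul_add_right eq_neg_iff_add_eq_0)
  then have "zsmul n a \<in> A \<inter> B" using ab assms by (metis IntI zsubgroup_uminus zsubgroup_zsmul)
  then have a: "a \<in> tors" using assms(3) n(1) zsmul_tors_iff[of n a] by auto
  then have "b \<in> tors" using x ab zsubgroup_add_cancel(2)[OF zsubgroup_tors a] by auto
  then show "x \<in> ssum (tors \<inter> A) (tors \<inter> B)" using ab a by (auto intro: ssumI)
next
  fix x assume "x \<in> ssum (tors \<inter> A) (tors \<inter> B)"
  then show "x \<in> tors \<inter> ssum A B"
    by (auto elim!: ssumE intro: ssumI zsubgroup_add[OF zsubgroup_tors])
qed

lemma card_ssum: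
  assumes "is_zsubgroup A" "is_zsubgroup B"
  shows "card (ssum A B) * card (A \<inter> B) = card A * card B"
  using card_lagrange[OF zsubgroup_ssum[OF assms] assms(2) ssum_superset(2)[OF assms(1)]]
    card_lagrange[OF assms(1) zsubgroup_Int[OF assms]] qcard_second_iso[OF assms]
  by simp

lemma ssum_basis:
  assumes A: "is_zsubgroup A" "is_tf_basis A as" and B: "is_zsubgroup B" "is_tf_basis B bs"
    and AB: "A \<inter> B \<subseteq> tors"
  shows "is_tf_basis (ssum A B) (as @ bs)"
  unfolding is_tf_basis_iff[OF zsubgroup_ssum[OF A(1) B(1)]]
proof (intro conjI allI impI ballI)
  show "set (as @ bs) \<subseteq> ssum A B"
    using basis_subset[OF A] basis_subset[OF B] ssum_superset[OF B(1), of A] ssum_superset(2)[OF A(1), of B]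
    by auto
  show "\<exists>c. x - lc c (as @ bs) \<in> tors" if "x \<in> ssum A B" for x
  proof -
    obtain a b where ab: "x = a + b" "a \<in> A" "b \<in> B" using \<open>x \<in> ssum A B\<close> by (auto elim: ssumE)
    define c where "c i = (if i < length as then coords as a i else coords bs b (i - length as))" for i
    have "lc c (as @ bs) = lc (coords as a) as + lc (coords bs b) bs"
      by (simp add: lc_append c_def cong: lc_cong)
    then have "x - lc c (as @ bs) = (a - lc (coords as a) as) + (b - lc (coords bs b) bs)"
      by (simp add: ab)
    then show ?thesis
      using coords[OF A ab(2)] coords[OF B ab(3)] zsubgroup_add[OF zsubgroup_tors] by metis
  qed
  show "c i = 0" if c: "lc c (as @ bs) \<in> tors" and i: "i < length (as @ bs)" for c i
  proof -
    let ?a = "lc c as" and ?b = "lc (\<lambda>i. c (length as + i)) bs"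
    have m: "?a \<in> A" "?b \<in> B" by (rule lc_mem[OF A(1) basis_subset[OF A]], rule lc_mem[OF B(1) basis_subset[OF B]])
    have "?a + ?b \<in> tors" using c by (simp add: lc_append)
    then obtain n where n: "n > 0" "zsmul n (?a + ?b) = 0" by (auto simp: tors_def)
    then have "zsmul n ?a = - zsmul n ?b" by (simp add: zsmul_add_right eq_neg_iff_add_eq_0)
    then have "zsmul n ?a \<in> A \<inter> B" using m A B by (metis IntI zsubgroup_uminus zsubgroup_zsmul)
    then have a: "?a \<in> tors" using AB n(1) zsmul_tors_iff[of n ?a] by auto
    then have b: "?b \<in> tors" using \<open>?a + ?b \<in> tors\<close> zsubgroup_add_cancel(2)[OF zsubgroup_tors a] by auto
    show "c i = 0"
    proof (cases "i < length as")
      case True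
      then show ?thesis using basis_independent[OF A a] by simp
    next
      case False
      then show ?thesis using basis_independent[OF B b, of "i - length as"] i by simp
    qed
  qed
qed

text \<open>The sum is direct only modulo torsion. The Gram matrix is block diagonal, while the
  torsion of the sum has order |A_tors| |B_tors| / |A \<inter> B|, whence the correction
  factor.\<close>

lemma
  fixes P :: "'a::ab_group_add \<Rightarrow> 'a \<Rightarrow> 'l::field_char_0"
  assumes X: "zlattice X" and A: "is_zsubgroup A" "A \<subseteq> X" and B: "is_zsubgroup B" "B \<subseteq> X"
    and AB: "A \<inter> B \<subseteq> tors"
  shows rk_ssum: "rk (ssum A B) = rk A + rk B"
    and regD_ssum: "biadditive P \<Longrightarrow> (\<And>x y. x \<in> A \<Longrightarrow> y \<in> B \<Longrightarrow> P x y = 0 \<and> P y x = 0) \<Longrightarrow>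
      regD P (ssum A B) = regD P A * regD P B * of_nat (card (A \<inter> B)) ^ 2"
proof -
  have L: "zlattice A" "zlattice B" "zlattice (ssum A B)"
    using zlattice_subgroup[OF X A] zlattice_subgroup[OF X B]
      zlattice_subgroup[OF X zsubgroup_ssum[OF A(1) B(1)] ssum_subset[OF zlattice_imp_zsubgroup[OF X] A(2) B(2)]]
    by simp_all
  let ?as = "tfbasis A" and ?bs = "tfbasis B"
  note as = tfbasis[OF L(1)] and bs = tfbasis[OF L(2)]
  note b = ssum_basis[OF A(1) as B(1) bs AB]
  show "rk (ssum A B) = rk A + rk B"
    using rk_eqI[OF zsubgroup_ssum[OF A(1) B(1)] b] by (simp add: rk_def)
  assume P: "biadditive P" and orth: "\<And>x y. x \<in> A \<Longrightarrow> y \<in> B \<Longrightarrow> P x y = 0 \<and> P y x = 0"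
  have "gramP P (?as @ ?bs) (?as @ ?bs) =
      four_block_mat (gramP P ?as ?as) (0\<^sub>m (length ?as) (length ?bs)) (0\<^sub>m (length ?bs) (length ?as)) (gramP P ?bs ?bs)"
    by (rule eq_matI)
      (auto simp: gramP_def nth_append orth basis_nth[OF A(1) as] basis_nth[OF B(1) bs])
  then have d: "det (gramP P (?as @ ?bs) (?as @ ?bs)) = det (gramP P ?as ?as) * det (gramP P ?bs ?bs)"
    using det_four_block_mat_lower_left_zero[of "gramP P ?as ?as" "length ?as" _ "length ?bs" _ "gramP P ?bs ?bs"]
    by simp
  have "tors \<inter> A \<inter> (tors \<inter> B) = A \<inter> B" using AB by auto
  then have "card (tors \<inter> ssum A B) * card (A \<inter> B) = card (tors \<inter> A) * card (tors \<inter> B)"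
    using card_ssum[OF zsubgroup_Int[OF zsubgroup_tors A(1)] zsubgroup_Int[OF zsubgroup_tors B(1)]]
    by (simp add: tors_ssum[OF A(1) B(1) AB])
  then have "(of_nat (card (tors \<inter> ssum A B)) * of_nat (card (A \<inter> B)) :: 'l) =
      of_nat (card (tors \<inter> A)) * of_nat (card (tors \<inter> B))"
    by (metis of_nat_mult)
  then have "(of_nat (card (tors \<inter> ssum A B)) :: 'l)\<^sup>2 * of_nat (card (A \<inter> B)) ^ 2 =
      of_nat (card (tors \<inter> A)) ^ 2 * of_nat (card (tors \<inter> B)) ^ 2"
    by (metis power_mult_distrib)
  then show "regD P (ssum A B) = regD P A * regD P B * of_nat (card (A \<inter> B)) ^ 2"
    using card_tors_pos[OF L(1)] card_tors_pos[OF L(2)] card_tors_pos[OF L(3)]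
    unfolding regD_eq[OF P L(3) b] regD_def[of P A] regD_def[of P B] d by (simp add: divide_simps mult_ac)
qed

text \<open>Comparing the two Gram matrices of \<open>f\<close> and its adjoint \<open>g\<close> replaces regulators by indices.\<close>
lemma regD_adjoint:
  fixes P :: "'a::ab_group_add \<Rightarrow> 'a \<Rightarrow> 'l::field_char_0"
  assumes P: "biadditive P" and A: "zlattice A" and B: "zlattice B"
    and f: "zhom f" "\<And>x. x \<in> A \<Longrightarrow> f x \<in> B" "\<And>x. x \<in> A \<Longrightarrow> f x \<in> tors \<Longrightarrow> x \<in> tors"
    and g: "zhom g" "\<And>x. x \<in> B \<Longrightarrow> g x \<in> A" "\<And>x. x \<in> B \<Longrightarrow> g x \<in> tors \<Longrightarrow> x \<in> tors"
    and adj: "\<And>x y. x \<in> A \<Longrightarrow> y \<in> B \<Longrightarrow> P (f x) y = P x (g y)"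
    and fin: "qcard B (f ` A) \<noteq> 0"
    and pos: "det (tfmat (\<lambda>x. g (f x)) (tfbasis A) (tfbasis A)) > 0"
  shows "regD P B * of_nat (qcard B (f ` A)) * of_nat (card {x\<in>B. g x = 0}) =
    regD P A * of_nat (qcard A (g ` B)) * of_nat (card {x\<in>A. f x = 0})"
proof -
  have Z: "is_zsubgroup A" "is_zsubgroup B" using A B zlattice_imp_zsubgroup by auto
  let ?as = "tfbasis A" and ?bs = "tfbasis B"
  note as = tfbasis[OF A] and bs = tfbasis[OF B]
  have len: "length ?as = length ?bs" by (rule tf_rank_eq_hom[OF A as B bs f fin])
  let ?F = "tfmat f ?as ?bs" and ?G = "tfmat g ?bs ?as" and ?n = "length ?as"
  have c: "?F \<in> carrier_mat ?n ?n" "?G \<in> carrier_mat ?n ?n" "gramP P ?as ?as \<in> carrier_mat ?n ?n"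
    "gramP P ?bs ?bs \<in> carrier_mat ?n ?n"
    using tfmat_carrier[of f ?as ?bs] tfmat_carrier[of g ?bs ?as] gramP_carrier[of P ?bs ?bs]
      gramP_carrier[of P ?as ?as]
    by (simp_all only: len)
  have "det (tfmat (\<lambda>x. g (f x)) ?as ?as) = det ?F * det ?G"
    using tfmat_comp[OF Z(2) bs Z(1) as, of ?as f g] f g basis_nth[OF Z(1) as] det_mult[OF c(1,2)] by simp
  with pos have sgn: "det ?F * det ?G > 0" by simp
  have "gramP P (map f ?as) ?bs = gramP P ?as (map g ?bs)"
    by (rule eq_matI) (auto simp: gramP_def adj basis_nth[OF Z(1) as] basis_nth[OF Z(2) bs])
  then have "map_mat of_int ?F * gramP P ?bs ?bs = gramP P ?as ?as * transpose_mat (map_mat of_int ?G)"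
    using gramP_tfmat_left[OF P Z(2) bs f(2), OF subsetD[OF basis_subset[OF Z(1) as]], of ?as "\<lambda>x. x" ?bs]
      gramP_tfmat_right[OF P Z(1) as g(2), OF subsetD[OF basis_subset[OF Z(2) bs]], of ?bs "\<lambda>x. x" ?as]
    by simp
  then have "det (map_mat of_int ?F) * det (gramP P ?bs ?bs) =
      det (gramP P ?as ?as) * det (transpose_mat (map_mat of_int ?G))"
    using det_mult[of "map_mat of_int ?F" ?n "gramP P ?bs ?bs"]
      det_mult[of "gramP P ?as ?as" ?n "transpose_mat (map_mat of_int ?G)"] c by simp
  then have e: "of_int (det ?F) * det (gramP P ?bs ?bs) = det (gramP P ?as ?as) * of_int (det ?G)"
    using c(2) by (simp add: det_transpose[of _ ?n] of_int_hom.hom_det)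
  \<comment> \<open>The two determinants have the same sign, so both may be replaced by their
    absolute values, and these are what \<open>index_hom\<close> computes.\<close>
  have e': "of_int \<bar>det ?F\<bar> * det (gramP P ?bs ?bs) = det (gramP P ?as ?as) * of_int \<bar>det ?G\<bar>"
    using e sgn by (cases "det ?F > 0") (auto simp: zero_less_mult_iff)
  define kf kg tA tB where "kf = card {x\<in>A. f x = 0}" and "kg = card {x\<in>B. g x = 0}"
    and "tA = card (tors \<inter> A)" and "tB = card (tors \<inter> B)"
  note defs = kf_def kg_def tA_def tB_def
  have "\<bar>det ?F\<bar> * int (tB * kf) = int (qcard B (f ` A) * tA)"
    using index_hom[OF A as B bs f len] by (simp add: defs)
  then have "of_int (\<bar>det ?F\<bar> * int (tB * kf)) = (of_int (int (qcard B (f ` A) * tA)) :: 'l)" by simp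
  then have 1: "of_int \<bar>det ?F\<bar> * of_nat tB * of_nat kf = (of_nat (qcard B (f ` A)) * of_nat tA :: 'l)"
    by (simp add: mult.assoc)
  have "\<bar>det ?G\<bar> * int (tA * kg) = int (qcard A (g ` B) * tB)"
    using index_hom[OF B bs A as g len[symmetric]] by (simp add: defs)
  then have "of_int (\<bar>det ?G\<bar> * int (tA * kg)) = (of_int (int (qcard A (g ` B) * tB)) :: 'l)" by simp
  then have 2: "of_int \<bar>det ?G\<bar> * of_nat tA * of_nat kg = (of_nat (qcard A (g ` B)) * of_nat tB :: 'l)"
    by (simp add: mult.assoc)
  have t: "(of_nat tA :: 'l) \<noteq> 0" "(of_nat tB :: 'l) \<noteq> 0"
    using card_tors_pos[OF A] card_tors_pos[OF B] by (simp_all add: defs)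
  have qB: "of_nat (qcard B (f ` A)) = (of_int \<bar>det ?F\<bar> * of_nat tB * of_nat kf / of_nat tA :: 'l)"
    using 1 t by (simp add: field_simps)
  have qA: "of_nat (qcard A (g ` B)) = (of_int \<bar>det ?G\<bar> * of_nat tA * of_nat kg / of_nat tB :: 'l)"
    using 2 t by (simp add: field_simps)
  have "regD P B * of_nat (qcard B (f ` A)) * of_nat kg =
      of_int \<bar>det ?F\<bar> * det (gramP P ?bs ?bs) * of_nat kf * of_nat kg / (of_nat tA * of_nat tB)"
    unfolding qB regD_def defs[symmetric] using t by (simp add: field_simps power2_eq_square)
  also have "\<dots> = regD P A * of_nat (qcard A (g ` B)) * of_nat kf"
    unfolding qA e' regD_def defs[symmetric] using t by (simp add: field_simps power2_eq_square)
  finally show ?thesis by (simp add: defs)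
qed

text \<open>A negative determinant would give \<open>2 - T\<close> a real eigenvalue \<open>y > 2\<close>, and along an eigenvector
  the Chebyshev sequence \<open>c\<close> would grow strictly instead of returning to its start.\<close>
lemma det_tfmat_pos:
  fixes A :: "'a::ab_group_add set" and c :: "nat \<Rightarrow> 'a \<Rightarrow> 'a"
  assumes A: "zlattice A" and T: "zhom T" "\<And>x. x \<in> A \<Longrightarrow> T x \<in> A"
    and c0: "\<And>x. x \<in> A \<Longrightarrow> c 0 x = zsmul 2 x" and c1: "\<And>x. x \<in> A \<Longrightarrow> c 1 x = zsmul 2 x - T x"
    and cS: "\<And>n x. x \<in> A \<Longrightarrow> c (Suc (Suc n)) x = c 1 (c (Suc n) x) - c n x"
    and cA: "\<And>n x. x \<in> A \<Longrightarrow> c n x \<in> A"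
    and period: "q > 0" "\<And>x. x \<in> A \<Longrightarrow> c q x = zsmul 2 x"
    and nz: "det (tfmat T (tfbasis A) (tfbasis A)) \<noteq> 0"
  shows "det (tfmat T (tfbasis A) (tfbasis A)) > 0"
proof (rule ccontr)
  let ?as = "tfbasis A"
  let ?E = "map_mat real_of_int (tfmat T ?as ?as)" and ?n = "length ?as"
  note Z = zlattice_imp_zsubgroup[OF A] and as = tfbasis[OF A]
  have E: "?E \<in> carrier_mat ?n ?n" by simp
  have mE: "- ?E \<in> carrier_mat ?n ?n" by simp
  assume "\<not> ?thesis"
  with nz have "det (tfmat T ?as ?as) < 0" by simp
  \<comment> \<open>The characteristic polynomial of \<open>- ?E\<close> is monic and takes the
    value det ?E < 0 at 0, so it has a root x > 0. Thus T has the eigenvalue - x, and c 1 = 2 - T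
    has 2 + x.\<close>
  moreover have "- char_matrix (- ?E) 0 = ?E"
    using E by (intro eq_matI) (auto simp: char_matrix_def tfmat_def)
  ultimately have "poly (char_poly (- ?E)) 0 < 0"
    unfolding char_poly_matrix[OF mE] by (simp add: of_int_hom.hom_det)
  moreover have "lead_coeff (char_poly (- ?E)) = 1"
    using degree_monic_char_poly[OF mE] by simp
  then obtain z where "\<forall>x\<ge>z. poly (char_poly (- ?E)) x \<ge> 1"
    using poly_pinfty_gt_lc[of "char_poly (- ?E)"] by auto
  then have "poly (char_poly (- ?E)) (max z 1) > 0" by (smt (verit) max.cobounded1)
  ultimately obtain x where x: "x > 0" "poly (char_poly (- ?E)) x = 0"
    using poly_IVT_pos[of 0 "max z 1" "char_poly (- ?E)"] that by (auto simp: less_max_iff_disj)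
  then obtain v where v: "v \<in> carrier_vec ?n" "v \<noteq> 0\<^sub>v ?n" "- ?E *\<^sub>v v = x \<cdot>\<^sub>v v"
    using eigenvalue_root_char_poly[OF mE, of x] by (auto simp: eigenvalue_def eigenvector_def tfmat_def)
  \<comment> \<open>The right eigenvector v read as a functional on A: it satisfies \<psi> (T y) = -
    x \<psi> y, because the rows of \<open>tfmat\<close> are images of basis vectors.\<close>
  define \<psi> where "\<psi> y = (\<Sum>i<?n. real_of_int (coords ?as y i) * v $ i)" for y
  have \<psi>_add: "\<psi> (y + z) = \<psi> y + \<psi> z" if "y \<in> A" "z \<in> A" for y z
    using that by (simp add: \<psi>_def coords_add[OF Z as] sum.distrib distrib_right)
  have \<psi>_diff: "\<psi> (y - z) = \<psi> y - \<psi> z" if "y \<in> A" "z \<in> A" for y z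
    using that by (simp add: \<psi>_def coords_diff[OF Z as] sum_subtractf left_diff_distrib)
  have \<psi>_2: "\<psi> (zsmul 2 y) = 2 * \<psi> y" if "y \<in> A" for y
    using that by (simp add: \<psi>_def coords_zsmul[OF Z as] sum_distrib_left mult.assoc)
  have \<psi>_tors: "\<psi> y = 0" if "y \<in> A" "y \<in> tors" for y
    using that by (simp add: \<psi>_def coords_tors[OF Z as])
  have \<psi>_basis: "\<psi> (?as ! i) = v $ i" if "i < ?n" for i
    using that by (simp add: \<psi>_def coords_basis[OF Z as] if_distrib[of "\<lambda>c. real_of_int c * _"] cong: if_cong)
  have \<psi>_T: "\<psi> (T (?as ! i)) = - x * v $ i" if "i < ?n" for i
  proof -
    have "(- ?E *\<^sub>v v) $ i = - \<psi> (T (?as ! i))"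
      using that v(1) by (simp add: \<psi>_def tfmat_def scalar_prod_def atLeast0LessThan sum_negf)
    then show ?thesis using that v(1) by (simp add: v(3))
  qed
  have "\<psi> (T y) + x * \<psi> y = 0" if "y \<in> A" for y
  proof -
    have "\<psi> (T y) + x * \<psi> y = (\<Sum>i<?n. of_int (coords ?as y i) * (\<psi> (T (?as ! i)) + x * \<psi> (?as ! i)))"
      by (rule functional_coords[OF Z as, where \<phi>="\<lambda>y. \<psi> (T y) + x * \<psi> y"])
        (use T that in \<open>auto simp: zhom_add[OF T(1)] \<psi>_add \<psi>_tors zhom_tors[OF T(1)] algebra_simps\<close>)
    then show ?thesis by (simp add: \<psi>_T \<psi>_basis)
  qed
  then have eig: "\<psi> (c 1 y) = (2 + x) * \<psi> y" if "y \<in> A" for y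
    using that T(2)[OF that] Z by (simp add: c1 \<psi>_diff \<psi>_2 zsubgroup_zsmul algebra_simps add_eq_0_iff del: One_nat_def)
  obtain i where i: "i < ?n" "v $ i \<noteq> 0"
    using v(1,2) by (metis carrier_vecD eq_vecI index_zero_vec)
  let ?y = "?as ! i"
  have y: "?y \<in> A" using basis_nth[OF Z as i(1)] .
  define u where "u n = \<psi> (c n ?y) / v $ i" for n
  have u0: "u 0 = 2" and uq: "u q = 2"
    using i y by (simp_all add: u_def c0 period \<psi>_2 \<psi>_basis)
  have u1: "u 1 = 2 + x" using i y eig[OF y] by (simp add: u_def \<psi>_basis)
  have uS: "u (Suc (Suc n)) = (2 + x) * u (Suc n) - u n" for n
    using eig[OF cA[OF y], of "Suc n"] \<psi>_diff[OF cA[OF cA[OF y]] cA[OF y], of 1 "Suc n" n]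
    by (simp add: u_def cS[OF y] diff_divide_distrib del: One_nat_def)
  \<comment> \<open>The increments grow: u (n+2) - u (n+1) = x u (n+1) + (u (n+1) - u n).\<close>
  have "u n \<ge> 2 \<and> u (Suc n) > u n" for n
  proof (induction n)
    case (Suc n)
    then have "x * u (Suc n) > 0" using x(1) by simp
    with Suc show ?case by (simp add: uS algebra_simps)
  qed (use u0 u1 x in simp)
  then have "u 0 < u q"
    using lift_Suc_mono_less[of u 0 q] period(1) by simp
  then show False using u0 uq by simp
qed

section \<open>Modules over the dihedral group\<close>

lemma ssum_Int_subset: "is_zsubgroup X \<Longrightarrow> ssum (X \<inter> A) (X \<inter> B) \<subseteq> X"
  by (rule ssum_subset) auto

locale dihedral_module =
  fixes q :: nat and r s :: "'m::ab_group_add \<Rightarrow> 'm"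
  assumes odd_q: "odd q" and q_gt_1: "q > 1" and ZD: "is_ZD_module q r s"
    and lattice_UNIV: "zlattice (UNIV :: 'm set)"
begin

lemma r_hom: "zhom r" and s_hom: "zhom s" and s_s [simp]: "s (s x) = x"
  and r_order: "(r ^^ q) x = x" and s_r_s: "s (r (s x)) = (r ^^ (q - 1)) x"
  using ZD by (auto simp: is_ZD_module_def zhom_def)

lemmas s_simps = zhom_add[OF s_hom] zhom_0[OF s_hom] zhom_uminus[OF s_hom] zhom_diff[OF s_hom]
  zhom_sum[OF s_hom] zhom_zsmul[OF s_hom]

text \<open>The relations of D survive the replacement of sigma by - sigma, which leaves N,
  \<open>P\<close>, \<open>K\<close> and \<open>th\<close> alone and exchanges \<open>L\<close> with
  \<open>Lm\<close>. Every statement about one eigenspace thereby yields the one about the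
  other.\<close>

lemma neg: "dihedral_module q r (\<lambda>x. - s x)"
proof
  show "is_ZD_module q r (\<lambda>x. - s x)"
    using ZD unfolding is_ZD_module_def
    by (auto simp: s_simps zhom_uminus[OF r_hom])
qed (use odd_q q_gt_1 lattice_UNIV in auto)

abbreviation rp :: "nat \<Rightarrow> 'm \<Rightarrow> 'm" where "rp k \<equiv> r ^^ k"

lemma rp_hom: "zhom (rp k)"
proof (induction k)
  case (Suc k)
  then show ?case using zhom_compose[OF r_hom Suc] by simp
qed (simp add: zhom_def)

lemmas rp_simps = zhom_add[OF rp_hom] zhom_0[OF rp_hom] zhom_uminus[OF rp_hom] zhom_diff[OF rp_hom]
  zhom_sum[OF rp_hom] zhom_zsmul[OF rp_hom]

lemma rp_rp: "rp a (rp b x) = rp (a + b) x"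
  by (simp add: funpow_add)

lemma rp_1: "rp 1 x = r x" by simp

lemma rp_add_q: "rp (k + q) x = rp k x"
  by (simp add: funpow_add r_order)

lemma rp_add_mult_q: "rp (k + m * q) x = rp k x"
proof (induction m)
  case (Suc m)
  then show ?case using rp_add_q[of "k + m * q" x] by (simp add: algebra_simps)
qed simp

lemma rp_mod: "rp (k mod q) x = rp k x"
  using rp_add_mult_q[of "k mod q" "k div q" x] by (simp add: mod_div_mult_eq)

text \<open>\<open>rp (k * (q - 1))\<close> is rho to the power - k, written without a subtraction
  that would require k \<le> q.\<close>

lemma s_rp: "s (rp k x) = rp (k * (q - 1)) (s x)"
proof (induction k arbitrary: x)
  case (Suc k)
  have "s (rp (Suc k) x) = s (r (s (s (rp k x))))" by simp
  also have "\<dots> = rp (q - 1) (s (rp k x))" by (simp only: s_r_s)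
  also have "\<dots> = rp (Suc k * (q - 1)) (s x)" by (simp add: Suc rp_rp)
  finally show ?case .
qed simp

lemma s_rp_le: "k \<le> q \<Longrightarrow> s (rp k x) = rp (q - k) (s x)"
proof (cases k)
  case 0
  then show ?thesis by (simp add: r_order)
next
  case (Suc j)
  assume "k \<le> q"
  then have "k * (q - 1) = (q - k) + j * q"
    using Suc by (simp add: algebra_simps diff_mult_distrib2)
  then show ?thesis by (simp add: s_rp rp_add_mult_q)
qed

definition N :: "'m \<Rightarrow> 'm" where "N x = (\<Sum>i<q. rp i x)"

lemma N_hom: "zhom N"
  by (simp add: zhom_def N_def rp_simps sum.distrib)

lemmas N_simps = zhom_add[OF N_hom] zhom_0[OF N_hom] zhom_uminus[OF N_hom] zhom_diff[OF N_hom]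
  zhom_sum[OF N_hom] zhom_zsmul[OF N_hom]

lemma N_r: "N (r x) = N x"
proof -
  have "N (r x) = (\<Sum>i<q. rp (Suc i) x)" by (simp add: N_def funpow_swap1)
  also have "\<dots> = (\<Sum>i<Suc q. rp i x) - x" by (subst sum.lessThan_Suc_shift) simp
  finally show ?thesis by (simp add: N_def r_order)
qed

lemma N_rp: "N (rp k x) = N x"
  by (induction k) (simp_all add: N_r)

lemma r_N: "r (N x) = N x"
proof -
  have "r (N x) = N (r x)" by (simp add: N_def zhom_sum[OF r_hom] funpow_swap1)
  then show ?thesis by (simp add: N_r)
qed

lemma rp_fixed: "r x = x \<Longrightarrow> rp k x = x"
  by (induction k) auto

lemma N_fixed: "r x = x \<Longrightarrow> N x = zsmul (int q) x"
  by (simp add: N_def rp_fixed zsmul_def)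

lemma s_N: "s (N x) = N (s x)"
proof -
  have "s (N x) = (\<Sum>i<q. rp (q - i) (s x))" by (simp add: N_def s_simps s_rp_le)
  \<comment> \<open>Reversal gives the exponents 1 to q instead of 0 to q - 1; the surplus rotation
    is moved onto the argument, where N does not see it.\<close>
  also have "\<dots> = (\<Sum>i<q. rp (q - Suc i) (r (s x)))"
  proof (rule sum.cong)
    fix i assume "i \<in> {..<q}"
    then have "q - i = (q - Suc i) + 1" by auto
    then show "rp (q - i) (s x) = rp (q - Suc i) (r (s x))" by (simp only: rp_rp[symmetric] rp_1)
  qed simp
  also have "\<dots> = N (r (s x))" unfolding N_def by (rule sum.nat_diff_reindex)
  finally show ?thesis by (simp add: N_r)
qed

text \<open>2 \<open>h1\<close> = q + 1, so \<open>rp h1\<close> is a square root of rho, and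
  \<open>h0\<close> = q - \<open>h1\<close> is the exponent of its inverse. As integers,
  \<open>h1\<close> and - \<open>h0\<close> represent 1/2 modulo q.\<close>

definition h1 :: nat where "h1 = (q + 1) div 2"
definition h0 :: nat where "h0 = (q - 1) div 2"

lemma half: "h1 + h0 = q" "h1 = Suc h0" "q = 2 * h0 + 1"
  using odd_q q_gt_1 by (auto elim!: oddE simp: h1_def h0_def)

lemma half_int: "int q = int h0 + int h0 + 1" "int h1 = int h0 + 1"
  using half(3) half(2) by simp_all

text \<open>\<open>\<theta> = \<omega> - 1/\<omega>\<close> for the square root \<open>\<omega>\<close> of the rotation. Unlike \<open>\<rho> - 1\<close> it anticommutes
  with the reflection, and is anti-self-adjoint.\<close>
definition th :: "'m \<Rightarrow> 'm" where "th x = rp h1 x - rp h0 x"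

lemma th_hom: "zhom th"
  by (simp add: zhom_def th_def rp_simps)

lemmas th_simps = zhom_add[OF th_hom] zhom_0[OF th_hom] zhom_uminus[OF th_hom] zhom_diff[OF th_hom]
  zhom_sum[OF th_hom] zhom_zsmul[OF th_hom]

lemma s_th: "s (th x) = - th (s x)"
proof -
  have "h1 \<le> q" "h0 \<le> q" "q - h1 = h0" "q - h0 = h1" using half by auto
  then show ?thesis by (simp only: th_def s_simps s_rp_le) simp
qed

lemma th_rp: "th (rp k x) = rp k (th x)"
  by (simp add: th_def rp_simps rp_rp add.commute)

lemma N_th: "N (th x) = 0"
  by (simp add: th_def N_simps N_rp)

lemma th_eq: "th x = rp h0 (r x - x)"
  using half(2) by (simp add: th_def rp_simps funpow_swap1)

lemma rp_inverse: "rp h1 (rp h0 x) = x" "rp h0 (rp h1 x) = x"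
  using half(1) by (simp_all add: rp_rp r_order add.commute)

lemma r_diff_eq: "r x - x = th (rp h1 x)" "r x - x = rp h1 (th x)"
  by (simp_all only: th_rp, simp_all only: th_eq rp_inverse)

lemma th_eq_0_iff: "th x = 0 \<longleftrightarrow> r x = x"
proof
  assume "th x = 0"
  then have "r x - x = 0" by (simp only: r_diff_eq(2) rp_simps)
  then show "r x = x" by simp
qed (simp add: th_eq rp_simps)

lemma th_N: "th (N x) = 0"
  by (simp add: th_eq_0_iff r_N)

lemma range_th: "range (\<lambda>x. r x - x) = range th"
proof (intro equalityI subsetI)
  fix y assume "y \<in> range th"
  then obtain x where "y = th x" by auto
  then have "y = r (rp h0 x) - rp h0 x"
    by (simp add: th_eq rp_simps funpow_swap1)
  then show "y \<in> range (\<lambda>x. r x - x)" by blast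
qed (auto simp: r_diff_eq)

text \<open>q - N is the sum of the 1 - rho^i, each a multiple of rho - 1. So q kills K / th(M),
  that is, Tate H^-1 of R.\<close>

lemma q_minus_N: "\<exists>z. zsmul (int q) x - N x = th z"
proof -
  have R: "is_zsubgroup (range th)" by (intro zsubgroup_image th_hom zsubgroup_UNIV)
  have *: "x - rp i x \<in> range th" for i
  proof (induction i)
    case (Suc i)
    have "x - rp (Suc i) x = (x - rp i x) - th (rp h1 (rp i x))"
      unfolding r_diff_eq(1)[symmetric] by simp
    then show ?case using Suc R by (metis rangeI zsubgroup_diff)
  qed (simp add: zsubgroup_0[OF R])
  have "zsmul (int q) x - N x = (\<Sum>i<q. x - rp i x)"
    by (simp add: N_def sum_subtractf zsmul_def)
  then have "zsmul (int q) x - N x \<in> range th"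
    using zsubgroup_sum[OF R, of "{..<q}" "\<lambda>i. x - rp i x"] * by simp
  then show ?thesis by auto
qed

section \<open>Eigenspaces of sigma on the invariants and on the norm kernel of R, and the indices
  of their sums\<close>

definition L :: "'m set" where "L = {x. s x = x}"
definition Lm :: "'m set" where "Lm = {x. s x = - x}"
definition P :: "'m set" where "P = {x. r x = x}"
definition K :: "'m set" where "K = {x. N x = 0}"

lemma neg_L: "dihedral_module.L (\<lambda>x. - s x) = Lm" and neg_Lm: "dihedral_module.Lm (\<lambda>x. - s x) = L"
  unfolding dihedral_module.L_def[OF neg] dihedral_module.Lm_def[OF neg] L_def Lm_def
  by (metis (mono_tags, opaque_lifting) minus_minus, metis (mono_tags, opaque_lifting) minus_minus)

lemma zsubgroup_L: "is_zsubgroup L"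
  by (simp add: L_def is_zsubgroup_def s_simps)

lemma zsubgroup_Lm: "is_zsubgroup Lm"
  using dihedral_module.zsubgroup_L[OF neg] by (simp add: neg_L)

lemma zsubgroup_P: "is_zsubgroup P"
  by (simp add: P_def is_zsubgroup_def zhom_add[OF r_hom] zhom_0[OF r_hom] zhom_uminus[OF r_hom])

lemma zsubgroup_K: "is_zsubgroup K"
  unfolding K_def by (rule zsubgroup_kernel[OF N_hom])

lemmas zsubgroups = zsubgroup_L zsubgroup_Lm zsubgroup_P zsubgroup_K zsubgroup_UNIV
  zsubgroup_Int zsubgroup_image[OF N_hom] zsubgroup_image[OF th_hom] zsubgroup_ssum

lemma lattice: "is_zsubgroup A \<Longrightarrow> zlattice (A :: 'm set)"
  by (rule zlattice_subgroup[OF lattice_UNIV]) auto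

lemma s_mem: "x \<in> P \<Longrightarrow> s x \<in> P" "x \<in> K \<Longrightarrow> s x \<in> K"
proof -
  assume "x \<in> P"
  then have "th x = 0" by (simp add: P_def th_eq_0_iff)
  then have "th (s x) = 0" using s_th[of x] by (simp add: s_simps)
  then show "s x \<in> P" by (simp add: P_def th_eq_0_iff)
next
  assume "x \<in> K"
  then show "s x \<in> K" by (simp add: K_def s_N[symmetric] s_simps)
qed

lemma th_mem: "x \<in> L \<Longrightarrow> th x \<in> Lm" "x \<in> Lm \<Longrightarrow> th x \<in> L" "th x \<in> K"
  by (simp_all add: L_def Lm_def K_def s_th N_th th_simps)

lemma N_mem: "N x \<in> P" "x \<in> L \<Longrightarrow> N x \<in> L" "x \<in> Lm \<Longrightarrow> N x \<in> Lm"
  by (simp_all add: P_def L_def Lm_def r_N s_N N_simps)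

lemma plus_s_mem: "x + s x \<in> L" "x - s x \<in> Lm"
  by (simp_all add: L_def Lm_def s_simps add.commute)

text \<open>On an x fixed by sigma, rho^(q-i) x = sigma rho^i x. The exponents 1 to q - 1 pair off,
  and only i = 0 remains since q is odd.\<close>

lemma N_of_fixed:
  assumes "x \<in> L"
  shows "N x = x + ((\<Sum>i=1..h0. rp i x) + s (\<Sum>i=1..h0. rp i x))"
proof -
  have "{..<q} = {0} \<union> ({1..h0} \<union> {h1..<q})" using half by auto
  then have "N x = (\<Sum>i\<in>{0} \<union> ({1..h0} \<union> {h1..<q}). rp i x)" by (simp add: N_def)
  also have "\<dots> = (\<Sum>i\<in>{0}. rp i x) + (\<Sum>i\<in>{1..h0} \<union> {h1..<q}. rp i x)"
    by (rule sum.union_disjoint) (auto simp: half(2))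
  also have "(\<Sum>i\<in>{1..h0} \<union> {h1..<q}. rp i x) = (\<Sum>i=1..h0. rp i x) + (\<Sum>i=h1..<q. rp i x)"
    by (rule sum.union_disjoint) (auto simp: half(2))
  also have "(\<Sum>i\<in>{0}. rp i x) = x" by simp
  also have "(\<Sum>i=h1..<q. rp i x) = (\<Sum>i=1..h0. rp (q - i) x)"
    by (rule sum.reindex_bij_witness[of _ "\<lambda>i. q - i" "\<lambda>i. q - i"]) (use half in auto)
  also have "\<dots> = s (\<Sum>i=1..h0. rp i x)"
    unfolding s_simps using half assms by (intro sum.cong) (auto simp: s_rp_le L_def)
  finally show ?thesis .
qed

text \<open>Vanishing of Tate H^0 of Sigma on K, read off from \<open>N_of_fixed\<close> with N x =
  0. Its companion for - sigma, \<open>K_minus_eq\<close>, is the vanishing of H^-1.\<close>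

lemma K_plus_eq:
  assumes "x \<in> K" "x \<in> L"
  obtains y where "y \<in> K" "x = y + s y"
proof -
  let ?y = "\<Sum>i=1..h0. rp i x"
  have "?y \<in> K" using assms(1) by (simp add: K_def N_simps N_rp)
  then have "- ?y \<in> K" by (rule zsubgroup_uminus[OF zsubgroup_K])
  moreover have "x = - ?y + s (- ?y)"
    using N_of_fixed[OF assms(2)] assms(1)
    by (simp add: K_def s_simps(3) add_eq_0_iff2 del: One_nat_def)
  ultimately show ?thesis using that by blast
qed

lemma K_minus_eq:
  assumes "x \<in> K" "x \<in> Lm"
  obtains y where "y \<in> K" "x = y - s y"
proof -
  have "x \<in> dihedral_module.L (\<lambda>x. - s x)" using assms(2) by (simp add: neg_L)
  then show ?thesis
    using dihedral_module.K_plus_eq[OF neg assms(1)] that by (metis diff_conv_add_uminus)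
qed

text \<open>The obstruction w = z + sigma z to z lying in \<open>Lm\<close> is killed by
  \<open>th\<close>, which anticommutes with sigma. So w is fixed by rho, and z can be corrected by
  a rho-fixed p with p + sigma p = w, leaving \<open>th z\<close> unchanged.\<close>

lemma th_in_L:
  assumes "th z \<in> L"
  obtains z' where "z' \<in> Lm" "th z' = th z"
proof -
  let ?w = "z + s z"
  have "th ?w = 0" using assms by (simp add: th_simps L_def s_th) (metis minus_minus add.right_inverse s_s s_th)
  then have "r ?w = ?w" by (simp add: th_eq_0_iff)
  then have Nw: "N z + s (N z) = zsmul (int q) ?w" by (simp add: N_fixed[symmetric] N_simps s_N)
  \<comment> \<open>N z + sigma N z = q w, so this choice gives (q - 2 \<open>h0\<close>) w =
    w.\<close>
  let ?p = "N z - zsmul (int h0) ?w"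
  have "zsmul (int q) ?w = zsmul (int h0) ?w + zsmul (int h0) ?w + ?w"
    unfolding half_int zsmul_add_left by simp
  moreover have "s (zsmul (int h0) ?w) = zsmul (int h0) ?w" by (simp add: s_simps add.commute)
  ultimately have "?p + s ?p = ?w" using Nw by (simp add: s_simps algebra_simps)
  then have "z - ?p \<in> Lm" by (simp add: Lm_def s_simps algebra_simps)
  moreover have "th (z - ?p) = th z"
    using \<open>th ?w = 0\<close> by (simp only: th_simps th_N zmod.scale_zero_right diff_zero diff_self)
  ultimately show ?thesis using that by blast
qed

lemma th_in_Lm:
  assumes "th z \<in> Lm"
  obtains z' where "z' \<in> L" "th z' = th z"
  using dihedral_module.th_in_L[OF neg, of z] assms unfolding neg_L neg_Lm by blast

lemma N_in_L:
  assumes "N z \<in> L"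
  obtains z' where "z' \<in> L" "N z' = N z"
proof -
  \<comment> \<open>Applying N multiplies N z by q - 2 \<open>h0\<close> = 1.\<close>
  let ?z = "N z - zsmul (int h0) (z + s z)"
  have "s (N z) = N z" using assms by (simp add: L_def)
  then have "?z \<in> L" by (simp add: L_def s_simps add.commute)
  moreover have "N (z + s z) = zsmul 2 (N z)"
    using \<open>s (N z) = N z\<close> zsmul_add_left[of 1 1 "N z"] by (simp add: N_simps s_N)
  then have "N ?z = zsmul (int q) (N z) - zsmul (int h0) (zsmul 2 (N z))"
    by (simp add: N_simps(4) N_simps(6) N_fixed r_N)
  then have "N ?z = zsmul (int q - int h0 * 2) (N z)"
    by (simp add: zsmul_zsmul zmod.scale_left_diff_distrib)
  then have "N ?z = N z" by (simp add: half_int)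
  ultimately show ?thesis using that by blast
qed

lemma range_N_Int: "range N \<inter> L = N ` L" "range N \<inter> Lm = N ` Lm"
proof -
  show "range N \<inter> L = N ` L" using N_mem N_in_L by (auto simp: image_iff) metis
  then show "range N \<inter> Lm = N ` Lm"
    using dihedral_module.N_mem[OF neg] dihedral_module.N_in_L[OF neg] unfolding neg_L neg_Lm
    by (auto simp: image_iff) metis
qed

lemma range_th_Int: "range th \<inter> L = th ` Lm" "range th \<inter> Lm = th ` L"
  using th_mem th_in_L th_in_Lm by (auto simp: image_iff) metis+

text \<open>X/Y is killed by the odd number q, so sigma splits it into eigenspaces, with
  \<open>h1\<close> acting as 1/2. The map 1 + sigma takes X onto the plus part with kernel W, and
  W/Y is the minus part.\<close>

lemma qcard_split:
  assumes X: "is_zsubgroup X" "\<And>x. x \<in> X \<Longrightarrow> s x \<in> X" and Y: "is_zsubgroup Y" "\<And>x. x \<in> Y \<Longrightarrow> s x \<in> Y"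
    and YX: "Y \<subseteq> X" and q: "\<And>x. x \<in> X \<Longrightarrow> zsmul (int q) x \<in> Y"
  shows "qcard X Y = qcard (X \<inter> L) (Y \<inter> L) * qcard (X \<inter> Lm) (Y \<inter> Lm)"
proof -
  have h: "zhom (\<lambda>x. x + s x)" by (simp add: zhom_def s_simps)
  define W where "W = X \<inter> {x. x + s x \<in> Y}"
  have W: "is_zsubgroup W" unfolding W_def by (intro zsubgroup_Int X zsubgroup_vimage h Y)
  have YW: "Y \<subseteq> W" using YX Y by (auto simp: W_def zsubgroup_add)
  have two_h1: "zsmul (int h1) x + zsmul (int h1) x = zsmul (int q) x + x" for x :: 'm
    unfolding half_int zsmul_add_left by simp
  have "qcard X W = qcard (X \<inter> L) (Y \<inter> L)"
  proof (rule qcard_iso[OF X(1) W _ _ _ _ h])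
    show "\<exists>x\<in>X. y - (x + s x) \<in> Y \<inter> L" if y: "y \<in> X \<inter> L" for y
    proof
      show x: "zsmul (int h1) y \<in> X" using y X by (simp add: zsubgroup_zsmul)
      have "y - (zsmul (int h1) y + s (zsmul (int h1) y)) = - zsmul (int q) y"
        using y two_h1[of y] by (simp add: L_def s_simps)
      moreover have "- zsmul (int q) y \<in> Y \<inter> L"
        using y q Y zsubgroup_L by (simp add: zsubgroup_intros)
      ultimately show "y - (zsmul (int h1) y + s (zsmul (int h1) y)) \<in> Y \<inter> L" by simp
    qed
  qed (use X Y YX plus_s_mem in \<open>auto simp: W_def zsubgroup_add intro!: zsubgroups\<close>)
  moreover have "qcard (X \<inter> Lm) (Y \<inter> Lm) = qcard W Y"
  proof (rule qcard_iso[OF _ _ _ W Y(1) YW zhom_id])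
    show "\<exists>x\<in>X \<inter> Lm. w - x \<in> Y" if w: "w \<in> W" for w
    proof
      have wX: "w \<in> X" "w + s w \<in> Y" using w by (auto simp: W_def)
      show "zsmul (int h1) (w - s w) \<in> X \<inter> Lm"
        using wX X plus_s_mem zsubgroup_Lm by (simp add: zsubgroup_intros)
      have "w - zsmul (int h1) (w - s w) = zsmul (int h1) (w + s w) - zsmul (int q) w"
        using two_h1[of w] by (simp add: zmod.scale_right_diff_distrib zsmul_add_right algebra_simps)
      then show "w - zsmul (int h1) (w - s w) \<in> Y"
        using wX q Y by (simp add: zsubgroup_diff zsubgroup_zsmul)
    qed
  qed (use X Y YX in \<open>auto simp: W_def Lm_def[symmetric] zsubgroup_0 intro!: zsubgroups, auto simp: Lm_def zsubgroup_0\<close>)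
  ultimately show ?thesis using qcard_mult[OF X(1) W Y(1) YW] by (simp add: W_def)
qed

text \<open>N is multiplication by q on P. Hence N carries X / (X \<inter> P + X \<inter> K)
  isomorphically to N X / q (X \<inter> P), the index of q (X \<inter> P) in X \<inter> P is given
  by \<open>index_zsmul\<close>, and the q-torsion of X \<inter> P is X \<inter> P \<inter>
  K.\<close>

lemma norm_index:
  assumes X: "is_zsubgroup X" "N ` X \<subseteq> X"
  shows "qcard (X \<inter> P) (N ` X) * qcard X (ssum (X \<inter> P) (X \<inter> K)) =
    q ^ rk (X \<inter> P) * card (X \<inter> P \<inter> K)"
proof -
  have NP: "N x = zsmul (int q) x" if "x \<in> P" for x using that by (simp add: P_def N_fixed)
  let ?qP = "zsmul (int q) ` (X \<inter> P)"
  have XP: "is_zsubgroup (X \<inter> P)" and NX: "is_zsubgroup (N ` X)" and qP: "is_zsubgroup ?qP"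
    and S: "is_zsubgroup (ssum (X \<inter> P) (X \<inter> K))"
    using X by (auto intro!: zsubgroups zsubgroup_image[OF zhom_zsmul_fun])
  have sub: "?qP \<subseteq> N ` X" "N ` X \<subseteq> X \<inter> P" using NP X N_mem(1) by (auto simp: image_iff) metis
  have "qcard X (ssum (X \<inter> P) (X \<inter> K)) = qcard (N ` X) ?qP"
  proof (rule qcard_iso[OF X(1) S _ NX qP sub(1) N_hom])
    show "N x \<in> ?qP \<longleftrightarrow> x \<in> ssum (X \<inter> P) (X \<inter> K)" if x: "x \<in> X" for x
    proof
      assume "N x \<in> ?qP"
      then obtain p where p: "p \<in> X" "p \<in> P" "N x = N p" using NP by auto
      then have "p + (x - p) \<in> ssum (X \<inter> P) (X \<inter> K)"
        using x X by (intro ssumI) (auto simp: K_def N_simps zsubgroup_diff)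
      then show "x \<in> ssum (X \<inter> P) (X \<inter> K)" by simp
    next
      assume "x \<in> ssum (X \<inter> P) (X \<inter> K)"
      then show "N x \<in> ?qP" using NP by (auto elim!: ssumE simp: N_simps K_def)
    qed
    show "\<exists>x\<in>X. y - N x \<in> ?qP" if "y \<in> N ` X" for y
      using that zsubgroup_0[OF qP] by (metis diff_self imageE)
  qed (use ssum_Int_subset[OF X(1)] in auto)
  then have "qcard (X \<inter> P) (N ` X) * qcard X (ssum (X \<inter> P) (X \<inter> K)) = qcard (X \<inter> P) ?qP"
    using qcard_mult[OF XP NX qP sub] by simp
  also have "\<dots> = q ^ rk (X \<inter> P) * card {x\<in>X \<inter> P. zsmul (int q) x = 0}"
    using index_zsmul[OF lattice[OF XP], of "int q"] q_gt_1 by simp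
  also have "{x\<in>X \<inter> P. zsmul (int q) x = 0} = X \<inter> P \<inter> K"
    using NP by (auto simp: K_def)
  finally show ?thesis .
qed

lemma P_K_tors: "P \<inter> K \<subseteq> tors"
  using q_gt_1 by (auto simp: P_def K_def N_fixed intro!: torsI[of "int q"])

lemma L_Lm_tors: "L \<inter> Lm \<subseteq> tors"
proof
  fix x assume "x \<in> L \<inter> Lm"
  then have "s x = x \<and> s x = - x" unfolding L_def Lm_def by blast
  then have "x + x = 0" by (metis add.right_inverse)
  then have "zsmul 2 x = 0" using zsmul_add_left[of 1 1 x] by simp
  then show "x \<in> tors" by (intro torsI[of 2]) auto
qed

lemma finite_tors: "finite (A \<inter> (tors :: 'm set))"
  using lattice_UNIV by (auto simp: zlattice_def)

lemma card_tors_sub_pos: "is_zsubgroup A \<Longrightarrow> A \<subseteq> (tors :: 'm set) \<Longrightarrow> card A > 0"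
  using finite_tors[of A] zsubgroup_0[of A] by (auto simp: card_gt_0_iff Int_absorb2)

lemma index_P_K_nonzero:
  assumes X: "is_zsubgroup X" "N ` X \<subseteq> X"
  shows "qcard X (ssum (X \<inter> P) (X \<inter> K)) \<noteq> 0"
proof -
  have "card (X \<inter> P \<inter> K) > 0"
    using X P_K_tors by (intro card_tors_sub_pos) (auto intro!: zsubgroups)
  then show ?thesis using norm_index[OF X] q_gt_1 by (metis mult_is_0 power_not_zero less_numeral_extra(3) not_one_less_zero)
qed

text \<open>1 + sigma maps K onto K \<inter> L by \<open>K_plus_eq\<close>, and the preimage of 2 (K
  \<inter> L) is the sum of the eigenspaces; the index of that double comes from
  \<open>index_zsmul\<close>.\<close>

lemma K_plus_minus_index: "qcard K (ssum (K \<inter> L) (K \<inter> Lm)) = 2 ^ rk (K \<inter> L) * card (K \<inter> L \<inter> Lm)"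
proof -
  have h: "zhom (\<lambda>x. x + s x)" by (simp add: zhom_def s_simps)
  have two: "zsmul 2 y = y + y" for y :: 'm using zsmul_add_left[of 1 1 y] by simp
  let ?Y = "zsmul 2 ` (K \<inter> L)"
  have KL: "is_zsubgroup (K \<inter> L)" by (intro zsubgroups)
  then have Y: "is_zsubgroup ?Y" by (rule zsubgroup_image[OF zhom_zsmul_fun])
  have "qcard K (ssum (K \<inter> L) (K \<inter> Lm)) = qcard (K \<inter> L) ?Y"
  proof (rule qcard_iso[OF zsubgroup_K _ _ KL Y _ h])
    show "x + s x \<in> ?Y \<longleftrightarrow> x \<in> ssum (K \<inter> L) (K \<inter> Lm)" if x: "x \<in> K" for x
    proof
      assume "x + s x \<in> ?Y"
      then obtain y where y: "y \<in> K" "y \<in> L" "x + s x = y + y" by (auto simp: two)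
      then have "s x - y = y - x" by (simp add: algebra_simps)
      then have "y + (x - y) \<in> ssum (K \<inter> L) (K \<inter> Lm)"
        using x y zsubgroup_K by (intro ssumI) (auto simp: Lm_def L_def s_simps zsubgroup_diff)
      then show "x \<in> ssum (K \<inter> L) (K \<inter> Lm)" by simp
    next
      assume "x \<in> ssum (K \<inter> L) (K \<inter> Lm)"
      then obtain a b where "a \<in> K \<inter> L" "x = a + b" "b \<in> Lm" by (auto elim!: ssumE)
      then show "x + s x \<in> ?Y" by (auto simp: two s_simps L_def Lm_def intro!: image_eqI[of _ _ a])
    qed
    show "\<exists>x\<in>K. y - (x + s x) \<in> ?Y" if "y \<in> K \<inter> L" for y
    proof -
      obtain z where "z \<in> K" "y = z + s z" using K_plus_eq[of y] \<open>y \<in> K \<inter> L\<close> by auto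
      then show ?thesis using zsubgroup_0[OF Y] by (metis diff_self)
    qed
    show "is_zsubgroup (ssum (K \<inter> L) (K \<inter> Lm))" by (intro zsubgroups)
    show "ssum (K \<inter> L) (K \<inter> Lm) \<subseteq> K" by (rule ssum_Int_subset[OF zsubgroup_K])
    show "?Y \<subseteq> K \<inter> L" using KL by (auto intro: zsubgroup_zsmul[OF zsubgroup_K] zsubgroup_zsmul[OF zsubgroup_L])
    show "x + s x \<in> K \<inter> L" if "x \<in> K" for x
      using that s_mem plus_s_mem zsubgroup_K by (auto intro: zsubgroup_add)
  qed
  also have "\<dots> = 2 ^ rk (K \<inter> L) * card {x\<in>K \<inter> L. zsmul 2 x = 0}"
    using index_zsmul[OF lattice[OF KL], of 2] by simp
  also have "{x\<in>K \<inter> L. zsmul 2 x = 0} = K \<inter> L \<inter> Lm"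
    by (auto simp: two L_def Lm_def eq_neg_iff_add_eq_0)
  finally show ?thesis .
qed

text \<open>If \<open>th x\<close> is torsion then so is each x - rho^i x, and these add up to q x
  when N x = 0.\<close>

lemma th_tors: "x \<in> K \<Longrightarrow> th x \<in> tors \<Longrightarrow> x \<in> tors"
proof -
  assume x: "x \<in> K" "th x \<in> tors"
  have d: "r x - x \<in> tors" unfolding r_diff_eq(2) by (rule zhom_tors[OF rp_hom x(2)])
  have "x - rp i x \<in> tors" for i
  proof (induction i)
    case (Suc i)
    have "x - rp (Suc i) x = (x - rp i x) - rp i (r x - x)" by (simp add: rp_simps funpow_swap1)
    then show ?case using Suc zhom_tors[OF rp_hom d, of i] by (metis zsubgroup_diff zsubgroup_tors)
  qed (simp add: zsubgroup_0[OF zsubgroup_tors])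
  then have "(\<Sum>i<q. x - rp i x) \<in> tors" by (intro zsubgroup_sum zsubgroup_tors)
  moreover have "(\<Sum>i<q. x - rp i x) = zsmul (int q) x"
    using x(1) by (simp add: K_def N_def sum_subtractf zsmul_def)
  ultimately show "x \<in> tors" using zsmul_tors_iff[of "int q" x] q_gt_1 by simp
qed

text \<open>The quotient is killed by q^2: one factor q writes y as \<open>th z\<close> with z in L,
  the other moves z into K as q z - N z.\<close>

lemma th_L_index_nonzero: "qcard (K \<inter> Lm) (th ` (K \<inter> L)) \<noteq> 0"
proof (rule qcard_nonzero[where n = "int q * int q"])
  show "zsmul (int q * int q) y \<in> th ` (K \<inter> L)" if y: "y \<in> K \<inter> Lm" for y
  proof -
    obtain z where z: "zsmul (int q) y = th z" using q_minus_N[of y] y by (auto simp: K_def)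
    have "zsmul (int q) y \<in> Lm" using y zsubgroup_Lm by (simp add: zsubgroup_zsmul)
    then obtain z' where z': "z' \<in> L" "th z' = zsmul (int q) y" using th_in_Lm[of z] z by auto
    let ?z = "zsmul (int q) z' - N z'"
    have "?z \<in> K \<inter> L"
      using z' N_mem(2)[OF z'(1)] zsubgroup_L
      by (simp add: K_def N_simps N_fixed r_N zsubgroup_diff zsubgroup_zsmul)
    moreover have "th ?z = zsmul (int q * int q) y"
      by (simp add: th_simps th_N z' zsmul_zsmul)
    ultimately show ?thesis by (metis imageI)
  qed
qed (use th_mem q_gt_1 in \<open>auto intro!: lattice zsubgroups\<close>)

text \<open>- th^2 = 2 - rho - 1/rho, so the Chebyshev sequence is rho^n + rho^-n. It returns to 2
  at n = q, and it preserves K \<inter> L because rho^-n x = sigma rho^n x for x in L.\<close>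

lemma det_th_th_pos:
  "det (tfmat (\<lambda>x. - th (th x)) (tfbasis (K \<inter> L)) (tfbasis (K \<inter> L))) > 0"
proof (rule det_tfmat_pos[where c = "\<lambda>n x. rp n x + rp (n * (q - 1)) x" and q = q])
  have KL: "is_zsubgroup (K \<inter> L)" by (intro zsubgroups)
  show "zlattice (K \<inter> L)" by (rule lattice[OF KL])
  show T: "zhom (\<lambda>x. - th (th x))" by (simp add: zhom_def th_simps)
  show TA: "- th (th x) \<in> K \<inter> L" if "x \<in> K \<inter> L" for x
    using that th_mem KL by (metis Int_iff zsubgroup_K zsubgroup_L zsubgroup_uminus)
  have two: "zsmul 2 y = y + y" for y :: 'm using zsmul_add_left[of 1 1 y] by simp
  show "rp 0 x + rp (0 * (q - 1)) x = zsmul 2 x" for x by (simp add: two)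
  show "rp 1 x + rp (1 * (q - 1)) x = zsmul 2 x - - th (th x)" for x
  proof -
    have "h1 + h1 = 1 + q" "h0 + h0 = q - 1" using half by auto
    then have "rp h1 (rp h1 x) = rp 1 x" "rp h0 (rp h0 x) = rp (q - 1) x"
      by (simp_all only: rp_rp rp_add_q)
    then show ?thesis by (simp add: two th_def rp_simps rp_inverse)
  qed
  show "rp (Suc (Suc n)) x + rp (Suc (Suc n) * (q - 1)) x =
      rp 1 (rp (Suc n) x + rp (Suc n * (q - 1)) x) + rp (1 * (q - 1)) (rp (Suc n) x + rp (Suc n * (q - 1)) x) -
      (rp n x + rp (n * (q - 1)) x)" for n x
  proof -
    have "1 + Suc n * (q - 1) = n * (q - 1) + q" "1 * (q - 1) + Suc n = n + q"
      "1 * (q - 1) + Suc n * (q - 1) = Suc (Suc n) * (q - 1)" "1 + Suc n = Suc (Suc n)"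
      using q_gt_1 by simp_all
    then have "rp 1 (rp (Suc n * (q - 1)) x) = rp (n * (q - 1)) x" "rp (1 * (q - 1)) (rp (Suc n) x) = rp n x"
      "rp (1 * (q - 1)) (rp (Suc n * (q - 1)) x) = rp (Suc (Suc n) * (q - 1)) x"
      "rp 1 (rp (Suc n) x) = rp (Suc (Suc n)) x"
      by (simp_all only: rp_rp rp_add_q)
    then show ?thesis by (simp only: rp_simps) simp
  qed
  show "rp n x + rp (n * (q - 1)) x \<in> K \<inter> L" if x: "x \<in> K \<inter> L" for n x
  proof -
    have "rp n x + rp (n * (q - 1)) x \<in> K" using x by (simp add: K_def N_simps N_rp)
    moreover have "rp (n * (q - 1)) x = s (rp n x)" using x by (simp add: s_rp L_def)
    ultimately show ?thesis using plus_s_mem(1)[of "rp n x"] by simp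
  qed
  show "q > 0" using q_gt_1 by simp
  show "rp q x + rp (q * (q - 1)) x = zsmul 2 x" for x
    using rp_add_mult_q[of 0 "q - 1" x] by (simp add: r_order two mult.commute)
  have "- th (th x) \<in> tors \<Longrightarrow> x \<in> tors" if "x \<in> K \<inter> L" for x
    using th_tors[of x] th_tors[of "th x"] th_mem that zsubgroup_uminus[OF zsubgroup_tors, of "- th (th x)"]
    by auto
  then show "det (tfmat (\<lambda>x. - th (th x)) (tfbasis (K \<inter> L)) (tfbasis (K \<inter> L))) \<noteq> 0"
    using index_hom[OF lattice[OF KL] tfbasis[OF lattice[OF KL]] lattice[OF KL] tfbasis[OF lattice[OF KL]] T TA]
    by simp
qed

text \<open>By \<open>range_N_Int\<close> and \<open>range_th_Int\<close> these are the orders of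
  the plus and minus parts of Tate H^0(R) = P / N M and H^-1(R) = K / th M.\<close>

abbreviation h0p :: nat where "h0p \<equiv> qcard (P \<inter> L) (N ` L)"
abbreviation h0m :: nat where "h0m \<equiv> qcard (P \<inter> Lm) (N ` Lm)"
abbreviation hp :: nat where "hp \<equiv> qcard (K \<inter> L) (th ` Lm)"
abbreviation hm :: nat where "hm \<equiv> qcard (K \<inter> Lm) (th ` L)"

lemma th_index:
  "qcard (K \<inter> Lm) (th ` (K \<inter> L)) * h0p = hm * q ^ rk (P \<inter> L) * card (P \<inter> K \<inter> L)"
proof -
  have S: "is_zsubgroup (K \<inter> Lm)" "is_zsubgroup (th ` L)" "is_zsubgroup (th ` (K \<inter> L))"
    "is_zsubgroup (ssum (L \<inter> P) (L \<inter> K))"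
    by (intro zsubgroups)+
  have "qcard (K \<inter> Lm) (th ` (K \<inter> L)) = hm * qcard (th ` L) (th ` (K \<inter> L))"
    using th_mem by (intro qcard_mult S) auto
  also have "qcard (th ` L) (th ` (K \<inter> L)) = qcard L (ssum (L \<inter> P) (L \<inter> K))"
  proof (rule qcard_iso[OF zsubgroup_L S(4) _ S(2,3) _ th_hom, symmetric])
    show "th x \<in> th ` (K \<inter> L) \<longleftrightarrow> x \<in> ssum (L \<inter> P) (L \<inter> K)" if x: "x \<in> L" for x
    proof
      assume "th x \<in> th ` (K \<inter> L)"
      then obtain y where y: "y \<in> K" "y \<in> L" "th x = th y" by auto
      then have "th (x - y) = 0" by (simp add: th_simps)
      then have "(x - y) + y \<in> ssum (L \<inter> P) (L \<inter> K)"
        using x y zsubgroup_L by (intro ssumI) (auto simp: P_def th_eq_0_iff zsubgroup_diff)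
      then show "x \<in> ssum (L \<inter> P) (L \<inter> K)" by simp
    next
      assume "x \<in> ssum (L \<inter> P) (L \<inter> K)"
      then show "th x \<in> th ` (K \<inter> L)"
        by (auto elim!: ssumE simp: th_simps P_def th_eq_0_iff[symmetric])
    qed
    show "\<exists>x\<in>L. y - th x \<in> th ` (K \<inter> L)" if "y \<in> th ` L" for y
      using that zsubgroup_0[OF S(3)] by (metis diff_self imageE)
  qed (use ssum_Int_subset[OF zsubgroup_L] in auto)
  finally have "qcard (K \<inter> Lm) (th ` (K \<inter> L)) * h0p =
      hm * (qcard (L \<inter> P) (N ` L) * qcard L (ssum (L \<inter> P) (L \<inter> K)))"
    by (simp add: Int_commute)
  also have "\<dots> = hm * (q ^ rk (L \<inter> P) * card (L \<inter> P \<inter> K))"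
    using norm_index[OF zsubgroup_L] N_mem(2) by auto
  finally show ?thesis by (simp add: Int_ac)
qed

lemma th_index_neg:
  "qcard (K \<inter> L) (th ` (K \<inter> Lm)) * h0m = hp * q ^ rk (P \<inter> Lm) * card (P \<inter> K \<inter> Lm)"
  using dihedral_module.th_index[OF neg] unfolding neg_L neg_Lm .

lemma h_nonzero: "h0p \<noteq> 0" "hm \<noteq> 0"
proof -
  have "card (P \<inter> K \<inter> L) > 0"
    using P_K_tors by (intro card_tors_sub_pos) (auto intro!: zsubgroups)
  have sub: "N ` L \<subseteq> P \<inter> L" "th ` L \<subseteq> K \<inter> Lm" using N_mem th_mem by auto
  show "h0p \<noteq> 0"
  proof (rule qcard_nonzero[where n = "int q"])
    show "zsmul (int q) x \<in> N ` L" if "x \<in> P \<inter> L" for x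
      using that by (auto simp: P_def N_fixed intro!: image_eqI[of _ _ x])
  qed (use sub q_gt_1 in \<open>auto intro!: lattice zsubgroups\<close>)
  have "qcard (K \<inter> Lm) (th ` (K \<inter> L)) = hm * qcard (th ` L) (th ` (K \<inter> L))"
    using sub by (intro qcard_mult zsubgroups) auto
  then show "hm \<noteq> 0" using th_L_index_nonzero by auto
qed

lemma h_nonzero_neg: "h0m \<noteq> 0" "hp \<noteq> 0"
  using dihedral_module.h_nonzero[OF neg] unfolding neg_L neg_Lm .

lemma index_plus_minus_nonzero:
  assumes X: "is_zsubgroup X" "\<And>x. x \<in> X \<Longrightarrow> s x \<in> X"
  shows "qcard X (ssum (X \<inter> L) (X \<inter> Lm)) \<noteq> 0"
proof (rule qcard_nonzero[where n = 2])
  show "zsmul 2 x \<in> ssum (X \<inter> L) (X \<inter> Lm)" if x: "x \<in> X" for x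
  proof -
    have "zsmul 2 x = (x + s x) + (x - s x)" using zsmul_add_left[of 1 1 x] by simp
    then show ?thesis using x X plus_s_mem by (metis Int_iff ssumI zsubgroup_add zsubgroup_diff)
  qed
qed (use X ssum_Int_subset[OF X(1)] in \<open>auto intro!: lattice zsubgroups\<close>)

lemma rk_P: "rk P = rk (P \<inter> L) + rk (P \<inter> Lm)"
proof -
  have sub: "ssum (P \<inter> L) (P \<inter> Lm) \<subseteq> P" by (rule ssum_Int_subset[OF zsubgroup_P])
  have "rk (ssum (P \<inter> L) (P \<inter> Lm)) = rk P"
    using index_plus_minus_nonzero[OF zsubgroup_P s_mem(1)]
    by (intro rk_eq_of_index lattice zsubgroups sub)
  moreover have "rk (ssum (P \<inter> L) (P \<inter> Lm)) = rk (P \<inter> L) + rk (P \<inter> Lm)"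
    using L_Lm_tors by (intro rk_ssum[OF lattice_UNIV] zsubgroups) auto
  ultimately show ?thesis by simp
qed

lemma rk_L: "rk L = rk (P \<inter> L) + rk (K \<inter> L)"
proof -
  have sub: "ssum (L \<inter> P) (L \<inter> K) \<subseteq> L" by (rule ssum_Int_subset[OF zsubgroup_L])
  have "rk (ssum (L \<inter> P) (L \<inter> K)) = rk L"
    using index_P_K_nonzero[OF zsubgroup_L] N_mem(2)
    by (intro rk_eq_of_index lattice zsubgroups sub) auto
  moreover have "rk (ssum (L \<inter> P) (L \<inter> K)) = rk (L \<inter> P) + rk (L \<inter> K)"
    using P_K_tors by (intro rk_ssum[OF lattice_UNIV] zsubgroups) auto
  ultimately show ?thesis by (simp add: Int_commute)
qed

end

section \<open>Regulators of the eigenspaces and the identity relating them\<close>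

locale dihedral_pairing = dihedral_module q r s
  for q :: nat and r s :: "'m::ab_group_add \<Rightarrow> 'm" +
  fixes pair :: "'m \<Rightarrow> 'm \<Rightarrow> 'l::field_char_0"
  assumes admissible: "admissible_pairing r s pair"
begin

lemma pair_biadditive: "biadditive pair"
  using admissible by (simp add: admissible_pairing_def biadditive_def zhom_def)

lemma pair_left: "zhom (\<lambda>x. pair x y)" and pair_right: "zhom (pair x)"
  using pair_biadditive by (simp_all add: biadditive_def)

lemmas pair_simps = zhom_add[OF pair_left] zhom_0[OF pair_left] zhom_uminus[OF pair_left]
  zhom_diff[OF pair_left] zhom_sum[OF pair_left]
  zhom_add[OF pair_right] zhom_0[OF pair_right] zhom_uminus[OF pair_right]
  zhom_diff[OF pair_right] zhom_sum[OF pair_right]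

lemma pair_s: "pair (s x) (s y) = pair x y" and pair_r: "pair (r x) (r y) = pair x y"
  using admissible by (simp_all add: admissible_pairing_def)

lemma pair_rp: "pair (rp k x) (rp k y) = pair x y"
  by (induction k) (simp_all add: pair_r)

text \<open>Rotations are isometries, so each has its inverse as adjoint, and taking adjoints swaps
  the two terms of \<open>th\<close>.\<close>

lemma pair_th: "pair (th x) y = pair x (- th y)"
proof -
  have "pair (rp h1 x) y = pair x (rp h0 y)" "pair (rp h0 x) y = pair x (rp h1 y)"
    using pair_rp[of h1 x "rp h0 y"] pair_rp[of h0 x "rp h1 y"] by (simp_all add: rp_inverse)
  then show ?thesis by (simp add: th_def pair_simps)
qed

lemma orth_P_K:
  assumes "x \<in> P" "y \<in> K"
  shows "pair x y = 0 \<and> pair y x = 0"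
proof -
  have "pair x (rp i y) = pair x y" "pair (rp i y) x = pair y x" for i
    using pair_rp[of i x y] pair_rp[of i y x] assms(1) by (simp_all add: P_def rp_fixed)
  then have "pair x (N y) = of_nat q * pair x y" "pair (N y) x = of_nat q * pair y x"
    by (simp_all add: N_def pair_simps)
  then show ?thesis using assms(2) q_gt_1 by (simp add: K_def pair_simps)
qed

lemma orth_L_Lm:
  assumes "x \<in> L" "y \<in> Lm"
  shows "pair x y = 0 \<and> pair y x = 0"
proof -
  have "pair x y = - pair x y" "pair y x = - pair y x"
    using pair_s[of x y] pair_s[of y x] assms by (simp_all add: L_def Lm_def pair_simps)
  then show ?thesis by (simp add: eq_neg_iff_add_eq_0)
qed

text \<open>The index of P + K is not itself a cohomology order; \<open>norm_index\<close> trades it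
  for [X \<inter> P : N X], and the factor |X \<inter> P \<inter> K| cancels.\<close>

lemma regD_P_K:
  assumes X: "is_zsubgroup X" "N ` X \<subseteq> X"
  shows "regD pair X * of_nat q ^ (2 * rk (X \<inter> P)) =
    regD pair (X \<inter> P) * regD pair (X \<inter> K) * of_nat (qcard (X \<inter> P) (N ` X)) ^ 2"
proof -
  let ?S = "ssum (X \<inter> P) (X \<inter> K)" and ?c = "card (X \<inter> P \<inter> K)"
  have S: "is_zsubgroup ?S" "?S \<subseteq> X" "is_zsubgroup (X \<inter> P)" "is_zsubgroup (X \<inter> K)"
    using X ssum_Int_subset[OF X(1)] by (auto intro!: zsubgroups)
  have t: "X \<inter> P \<inter> (X \<inter> K) \<subseteq> tors" using P_K_tors by auto
  have e: "X \<inter> P \<inter> (X \<inter> K) = X \<inter> P \<inter> K" by auto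
  have c: "?c > 0" using X P_K_tors by (intro card_tors_sub_pos) (auto intro!: zsubgroups)
  have 1: "regD pair X * of_nat (qcard X ?S) ^ 2 =
      regD pair (X \<inter> P) * regD pair (X \<inter> K) * of_nat ?c ^ 2"
    using regD_index[OF pair_biadditive lattice[OF X(1)] S(1,2) index_P_K_nonzero[OF X]]
      regD_ssum[OF lattice_UNIV S(3) _ S(4) _ t pair_biadditive] orth_P_K by (simp add: e)
  have e2: "(of_nat (qcard (X \<inter> P) (N ` X)) * of_nat (qcard X ?S) :: 'l) = of_nat q ^ rk (X \<inter> P) * of_nat ?c"
    using norm_index[OF X] by (metis of_nat_mult of_nat_power)
  have 2: "(of_nat (qcard (X \<inter> P) (N ` X)) :: 'l) ^ 2 * of_nat (qcard X ?S) ^ 2 =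
      of_nat q ^ (2 * rk (X \<inter> P)) * of_nat ?c ^ 2"
    using arg_cong[OF e2, of "\<lambda>x. x ^ 2"] by (simp only: power_mult_distrib power_even_eq)
  have "(regD pair X * of_nat q ^ (2 * rk (X \<inter> P))) * of_nat ?c ^ 2 =
      regD pair X * of_nat (qcard X ?S) ^ 2 * of_nat (qcard (X \<inter> P) (N ` X)) ^ 2"
    using 2 by (simp add: mult_ac)
  also have "\<dots> = (regD pair (X \<inter> P) * regD pair (X \<inter> K) * of_nat (qcard (X \<inter> P) (N ` X)) ^ 2) * of_nat ?c ^ 2"
    unfolding 1 by (simp add: mult_ac)
  finally show ?thesis using c by simp
qed

lemma regD_K: "regD pair K * 4 ^ rk (K \<inter> L) = regD pair (K \<inter> L) * regD pair (K \<inter> Lm)"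
proof -
  let ?S = "ssum (K \<inter> L) (K \<inter> Lm)" and ?c = "card (K \<inter> L \<inter> Lm)"
  have S: "is_zsubgroup ?S" "?S \<subseteq> K" "is_zsubgroup (K \<inter> L)" "is_zsubgroup (K \<inter> Lm)"
    using ssum_Int_subset[OF zsubgroup_K] by (auto intro!: zsubgroups)
  have t: "K \<inter> L \<inter> (K \<inter> Lm) \<subseteq> tors" using L_Lm_tors by auto
  have e: "K \<inter> L \<inter> (K \<inter> Lm) = K \<inter> L \<inter> Lm" by auto
  have c: "?c > 0" using L_Lm_tors by (intro card_tors_sub_pos) (auto intro!: zsubgroups)
  have 1: "regD pair K * of_nat (qcard K ?S) ^ 2 =
      regD pair (K \<inter> L) * regD pair (K \<inter> Lm) * of_nat ?c ^ 2"
    using regD_index[OF pair_biadditive lattice[OF zsubgroup_K] S(1,2)] K_plus_minus_index c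
      regD_ssum[OF lattice_UNIV S(3) _ S(4) _ t pair_biadditive] orth_L_Lm by (simp add: e)
  have "(of_nat (qcard K ?S) :: 'l) ^ 2 = 4 ^ rk (K \<inter> L) * of_nat ?c ^ 2"
    unfolding K_plus_minus_index
    by (simp add: power_mult_distrib power_mult[symmetric] mult.commute[of _ 2]) (simp add: power_mult)
  then have "regD pair K * 4 ^ rk (K \<inter> L) * of_nat ?c ^ 2 =
      regD pair (K \<inter> L) * regD pair (K \<inter> Lm) * of_nat ?c ^ 2"
    using 1 by (simp add: mult.assoc)
  then show ?thesis using c by simp
qed

text \<open>\<open>regD_adjoint\<close> is applied to \<open>th\<close> from K \<inter> L to K
  \<inter> Lm, with adjoint - \<open>th\<close>. The two indices are then rewritten by
  \<open>th_index\<close> and \<open>th_index_neg\<close>, and the orders of the kernels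
  cancel.\<close>

lemma regD_K_plus_minus:
  "regD pair (K \<inter> Lm) * of_nat hm * of_nat q ^ rk (P \<inter> L) * of_nat h0m =
    regD pair (K \<inter> L) * of_nat hp * of_nat q ^ rk (P \<inter> Lm) * of_nat h0p"
proof -
  let ?cp = "card (P \<inter> K \<inter> L)" and ?cm = "card (P \<inter> K \<inter> Lm)"
  let ?a = "qcard (K \<inter> Lm) (th ` (K \<inter> L))" and ?b = "qcard (K \<inter> L) (th ` (K \<inter> Lm))"
  have c: "?cp > 0" "?cm > 0"
    using P_K_tors by (auto intro!: card_tors_sub_pos zsubgroups)
  have gh: "zhom (\<lambda>x. - th x)" by (simp add: zhom_def th_simps)
  have im: "(\<lambda>x. - th x) ` (K \<inter> Lm) = th ` (K \<inter> Lm)"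
  proof -
    have "(\<lambda>x. - th x) ` (K \<inter> Lm) = th ` uminus ` (K \<inter> Lm)" by (simp add: image_image th_simps)
    also have "uminus ` (K \<inter> Lm) = K \<inter> Lm"
      using zsubgroup_uminus[OF zsubgroup_Int[OF zsubgroup_K zsubgroup_Lm]]
      by (auto intro!: image_eqI[of _ uminus "- _"])
    finally show ?thesis .
  qed
  have "regD pair (K \<inter> Lm) * of_nat ?a * of_nat (card {x \<in> K \<inter> Lm. - th x = 0}) =
      regD pair (K \<inter> L) * of_nat (qcard (K \<inter> L) ((\<lambda>x. - th x) ` (K \<inter> Lm))) *
        of_nat (card {x \<in> K \<inter> L. th x = 0})"
  proof (rule regD_adjoint[OF pair_biadditive _ _ th_hom _ _ gh _ _ pair_th th_L_index_nonzero det_th_th_pos])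
    show "x \<in> tors" if "x \<in> K \<inter> Lm" "- th x \<in> tors" for x
      using th_tors[of x] that zsubgroup_uminus[OF zsubgroup_tors, of "- th x"] by auto
    show "- th x \<in> K \<inter> L" if "x \<in> K \<inter> Lm" for x
      using that th_mem by (auto intro!: zsubgroup_uminus zsubgroups)
  qed (use th_mem th_tors in \<open>auto intro!: lattice zsubgroups\<close>)
  moreover have "{x \<in> K \<inter> Lm. - th x = 0} = P \<inter> K \<inter> Lm" "{x \<in> K \<inter> L. th x = 0} = P \<inter> K \<inter> L"
    by (auto simp: P_def th_eq_0_iff)
  ultimately have 1: "regD pair (K \<inter> Lm) * of_nat ?a * of_nat ?cm = regD pair (K \<inter> L) * of_nat ?b * of_nat ?cp"
    by (simp only: im)
  have 2: "(of_nat ?a * of_nat h0p :: 'l) = of_nat hm * of_nat q ^ rk (P \<inter> L) * of_nat ?cp"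
    using th_index by (metis of_nat_mult of_nat_power)
  have 3: "(of_nat ?b * of_nat h0m :: 'l) = of_nat hp * of_nat q ^ rk (P \<inter> Lm) * of_nat ?cm"
    using th_index_neg by (metis of_nat_mult of_nat_power)
  have "(regD pair (K \<inter> Lm) * of_nat hm * of_nat q ^ rk (P \<inter> L) * of_nat h0m) * (of_nat ?cp * of_nat ?cm) =
      regD pair (K \<inter> Lm) * (of_nat hm * of_nat q ^ rk (P \<inter> L) * of_nat ?cp) * of_nat ?cm * of_nat h0m"
    by (simp add: mult_ac)
  also have "\<dots> = (regD pair (K \<inter> Lm) * of_nat ?a * of_nat ?cm) * of_nat h0p * of_nat h0m"
    unfolding 2[symmetric] by (simp add: mult_ac)
  also have "\<dots> = regD pair (K \<inter> L) * (of_nat ?b * of_nat h0m) * of_nat h0p * of_nat ?cp"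
    unfolding 1 by (simp add: mult_ac)
  also have "\<dots> = (regD pair (K \<inter> L) * of_nat hp * of_nat q ^ rk (P \<inter> Lm) * of_nat h0p) * (of_nat ?cp * of_nat ?cm)"
    unfolding 3 by (simp add: mult_ac)
  finally show ?thesis using c by simp
qed

lemma qcard_P: "qcard P (range N) = h0p * h0m"
proof -
  have "qcard P (range N) = qcard (P \<inter> L) (range N \<inter> L) * qcard (P \<inter> Lm) (range N \<inter> Lm)"
  proof (rule qcard_split)
    show "s x \<in> range N" if "x \<in> range N" for x using that by (auto simp: s_N)
    show "zsmul (int q) x \<in> range N" if "x \<in> P" for x
      using that by (auto simp: P_def N_fixed[symmetric])
  qed (use N_mem s_mem in \<open>auto intro!: zsubgroups\<close>)
  then show ?thesis by (simp add: range_N_Int)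
qed

lemma qcard_K: "qcard K (range th) = hp * hm"
proof -
  have "qcard K (range th) = qcard (K \<inter> L) (range th \<inter> L) * qcard (K \<inter> Lm) (range th \<inter> Lm)"
  proof (rule qcard_split)
    show "s x \<in> range th" if "x \<in> range th" for x
      using that by (auto simp: s_th th_simps(3)[symmetric])
    show "zsmul (int q) x \<in> range th" if "x \<in> K" for x
      using q_minus_N[of x] that by (auto simp: K_def)
  qed (use th_mem s_mem in \<open>auto intro!: zsubgroups\<close>)
  then show ?thesis by (simp add: range_th_Int)
qed

text \<open>P + K and L + Lm are orthogonal sums of finite index in M, so a vanishing regulator of a
  summand would force one for M.\<close>

lemma regD_nonzero: "regD pair P \<noteq> 0" "regD pair L \<noteq> 0"
proof -
  have "gram pair 1 bs = gramP pair bs bs" for bs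
    by (rule eq_matI) (simp_all add: gram_def gramP_def)
  then have U: "regD pair UNIV \<noteq> 0"
    using admissible tfbasis[OF lattice_UNIV] card_tors_pos[OF lattice_UNIV]
    by (simp add: regD_def admissible_pairing_def)
  show "regD pair P \<noteq> 0"
    using regD_P_K[of UNIV] U q_gt_1 by (auto simp: zsubgroup_UNIV)
  have "regD pair (ssum L Lm) = regD pair UNIV * of_nat (qcard UNIV (ssum L Lm)) ^ 2"
    using index_plus_minus_nonzero[of UNIV]
    by (intro regD_index pair_biadditive lattice_UNIV zsubgroups) (simp_all add: zsubgroup_UNIV)
  moreover have "regD pair (ssum L Lm) = regD pair L * regD pair Lm * of_nat (card (L \<inter> Lm)) ^ 2"
    using orth_L_Lm by (intro regD_ssum[OF lattice_UNIV] zsubgroups L_Lm_tors pair_biadditive) auto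
  ultimately show "regD pair L \<noteq> 0"
    using U index_plus_minus_nonzero[of UNIV] by (auto simp: zsubgroup_UNIV)
qed

text \<open>D(M) and D(L) are expanded by \<open>regD_P_K\<close>. Then \<open>regD_K\<close>
  replaces D(K) by D(K^+) D(K^-), the comparison replaces D(K^-) by D(K^+), and the resulting square
  is absorbed into D(L)^2. Denominators are cleared.\<close>

lemma regulator_identity:
  "regD pair UNIV * regD pair (P \<inter> L) ^ 2 * of_nat q ^ rk P * 2 ^ (2 * rk L) * (of_nat hm * of_nat h0p) =
    regD pair P * regD pair L ^ 2 * of_nat (2 * q) ^ (2 * rk (P \<inter> L)) * (of_nat hp * of_nat h0m)"
proof -
  define n m k where "n = rk (P \<inter> L)" and "m = rk (P \<inter> Lm)" and "k = rk (K \<inter> L)"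
  note nmk = n_def[symmetric] m_def[symmetric] k_def[symmetric]
  define M E Kp Km p l kk where "M = regD pair UNIV" and "E = regD pair (P \<inter> L)"
    and "Kp = regD pair (K \<inter> L)" and "Km = regD pair (K \<inter> Lm)" and "p = regD pair P"
    and "l = regD pair L" and "kk = regD pair K"
  note D = M_def[symmetric] E_def[symmetric] Kp_def[symmetric] Km_def[symmetric] p_def[symmetric]
    l_def[symmetric] kk_def[symmetric]
  define Q a b c d :: 'l where "Q = of_nat q" and "a = of_nat h0p" and "b = of_nat h0m"
    and "c = of_nat hp" and "d = of_nat hm"
  note Qs = Q_def[symmetric] a_def[symmetric] b_def[symmetric] c_def[symmetric] d_def[symmetric]
  have Q: "Q \<noteq> 0" using q_gt_1 by (simp add: Q_def)
  have 1: "M * Q ^ (2 * (n + m)) = p * kk * (a * b) ^ 2"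
    using regD_P_K[of UNIV] by (simp add: zsubgroup_UNIV qcard_P rk_P nmk D Qs)
  have 2: "l * Q ^ (2 * n) = E * Kp * a ^ 2"
    using regD_P_K[of L] N_mem(2)
    by (simp add: zsubgroup_L image_subset_iff Int_commute[of L] nmk D Qs)
  have 3: "kk * 4 ^ k = Kp * Km" using regD_K by (simp add: nmk D)
  have 4: "Km * d * Q ^ n * b = Kp * c * Q ^ m * a"
    using regD_K_plus_minus by (simp add: nmk D Qs)
  have four: "(2::'l) ^ (2 * j) = 4 ^ j" for j by (simp add: power_mult)
  have M: "M = p * kk * (a * b) ^ 2 / (Q ^ (n + m) * Q ^ (n + m))"
    using 1 Q unfolding mult_2 power_add[of Q "n + m" "n + m"] by (simp add: eq_divide_eq)
  have l2: "l ^ 2 = E ^ 2 * Kp ^ 2 * (a ^ 2) ^ 2 / (Q ^ (2 * n) * Q ^ (2 * n))"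
  proof -
    have "l = E * Kp * a ^ 2 / Q ^ (2 * n)" using 2 Q by (simp add: field_simps)
    then show ?thesis by (simp add: power_divide power_mult_distrib power2_eq_square)
  qed
  have "M * E ^ 2 * Q ^ (n + m) * 4 ^ (n + k) * (d * a) =
      p * E ^ 2 * 4 ^ n * (kk * 4 ^ k) * a ^ 3 * b ^ 2 * d / Q ^ (n + m)"
    unfolding M using Q by (simp add: field_simps power_add power2_eq_square power3_eq_cube)
  also have "\<dots> = p * E ^ 2 * 4 ^ n * Kp * (Km * d * Q ^ n * b) * a ^ 3 * b / (Q ^ (n + m) * Q ^ n)"
    unfolding 3 using Q by (simp add: field_simps power2_eq_square)
  also have "\<dots> = p * E ^ 2 * 4 ^ n * Kp ^ 2 * (a ^ 2) ^ 2 * b * c / (Q ^ n * Q ^ n)"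
    unfolding 4 using Q by (simp add: field_simps power_add power2_eq_square power3_eq_cube)
  also have "\<dots> = p * l ^ 2 * (4 ^ n * Q ^ (2 * n)) * (c * b)"
    unfolding l2 using Q by (simp add: field_simps mult_2 mult_2_right power_add)
  finally show ?thesis
    by (simp add: nmk D Qs rk_P rk_L four power_mult_distrib power_add)
qed

end

section \<open>Tate cohomology\<close>

text \<open>\<phi> will be evaluation at generators of the group. Cocycles become the subgroup Y and
  coboundaries Y', the latter tested on differences of cocycles because \<open>tate_h1\<close> is
  defined through that relation.\<close>

lemma tate_h1_eq:
  fixes \<phi> :: "(nat \<times> nat \<Rightarrow> 'm::ab_group_add) \<Rightarrow> 'b::ab_group_add"
  assumes Y: "is_zsubgroup Y" "is_zsubgroup Y'" "Y' \<subseteq> Y"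
    and im: "\<phi> ` cocycles1 q r s H = Y"
    and ker: "\<And>f f'. f \<in> cocycles1 q r s H \<Longrightarrow> f' \<in> cocycles1 q r s H \<Longrightarrow>
      (\<lambda>g. f' g - f g) \<in> coboundaries1 r s H \<longleftrightarrow> \<phi> f' - \<phi> f \<in> Y'"
  shows "tate_h1 q r s H = qcard Y Y'"
proof -
  let ?C = "cocycles1 q r s H"
  let ?F = "\<lambda>f. {f'\<in>?C. (\<lambda>g. f' g - f g) \<in> coboundaries1 r s H}"
  let ?cl = "\<lambda>y. {z\<in>Y. z - y \<in> Y'}"
  have F: "?F f = {f'\<in>?C. \<phi> f' - \<phi> f \<in> Y'}" if "f \<in> ?C" for f using ker[OF that] by blast
  have "card (?F ` ?C) = card ((\<lambda>f. ?cl (\<phi> f)) ` ?C)"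
  proof (rule card_image_eq_kernel)
    fix f g assume fg: "f \<in> ?C" "g \<in> ?C"
    then have YY: "\<phi> f \<in> Y" "\<phi> g \<in> Y" using im by auto
    have 1: "?cl (\<phi> f) = ?cl (\<phi> g) \<longleftrightarrow> \<phi> f - \<phi> g \<in> Y'"
      using Y YY by (intro coset_eq_iff)
    have 2: "?F f = ?F g \<longleftrightarrow> \<phi> f - \<phi> g \<in> Y'"
    proof
      assume "?F f = ?F g"
      moreover have "f \<in> ?F f" using F[OF fg(1)] fg zsubgroup_0[OF Y(2)] by simp
      ultimately show "\<phi> f - \<phi> g \<in> Y'" using F[OF fg(2)] by blast
    next
      assume d: "\<phi> f - \<phi> g \<in> Y'"
      have "\<phi> h - \<phi> f \<in> Y' \<longleftrightarrow> \<phi> h - \<phi> g \<in> Y'" for h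
        using zsubgroup_add_cancel(1)[OF Y(2) d, of "\<phi> h - \<phi> f"] by simp
      then show "?F f = ?F g" unfolding F[OF fg(1)] F[OF fg(2)] by simp
    qed
    show "?F f = ?F g \<longleftrightarrow> ?cl (\<phi> f) = ?cl (\<phi> g)" using 1 2 by blast
  qed
  also have "(\<lambda>f. ?cl (\<phi> f)) ` ?C = ?cl ` Y" unfolding im[symmetric] image_image ..
  finally show ?thesis by (simp add: tate_h1_def qcard_def)
qed

lemma zspan_eqI:
  assumes "S \<subseteq> A" "is_zsubgroup A" "\<And>B. S \<subseteq> B \<Longrightarrow> is_zsubgroup B \<Longrightarrow> A \<subseteq> B"
  shows "zspan S = A"
  unfolding zspan_def using assms by blast

section \<open>Tate cohomology in degrees 0 and -1\<close>

context dihedral_module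
begin

lemma act_simps: "act r s (k, 0) x = rp k x" "act r s (k, Suc 0) x = rp k (s x)"
  by (simp_all add: act_def)

lemma fixpts_eq: "fixpts r s Tgrp = UNIV" "fixpts r s (Rgrp q) = P" "fixpts r s Sgrp = L"
  "fixpts r s (Dgrp q) = P \<inter> L"
proof -
  show "fixpts r s Tgrp = UNIV" "fixpts r s Sgrp = L"
    by (auto simp: fixpts_def Tgrp_def Sgrp_def L_def act_simps)
  have r: "(1, 0) \<in> Rgrp q" "(1, 0) \<in> Dgrp q" "(0, Suc 0) \<in> Dgrp q"
    using q_gt_1 by (auto simp: Rgrp_def Dgrp_def)
  show "fixpts r s (Rgrp q) = P"
  proof (intro equalityI subsetI)
    fix x assume "x \<in> fixpts r s (Rgrp q)"
    then show "x \<in> P" using r by (force simp: fixpts_def P_def act_simps)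
  qed (auto simp: fixpts_def P_def Rgrp_def act_simps rp_fixed)
  show "fixpts r s (Dgrp q) = P \<inter> L"
  proof (intro equalityI subsetI)
    fix x assume "x \<in> fixpts r s (Dgrp q)"
    then have "act r s (1, 0) x = x" "act r s (0, Suc 0) x = x" using r by (auto simp: fixpts_def)
    then show "x \<in> P \<inter> L" by (simp add: P_def L_def act_simps)
  qed (auto simp: fixpts_def P_def L_def Dgrp_def act_simps rp_fixed less_2_cases_iff)
qed

lemma normH_eq: "normH r s Tgrp x = x" "normH r s (Rgrp q) x = N x" "normH r s Sgrp x = x + s x"
  "normH r s (Dgrp q) x = N (x + s x)"
proof -
  show "normH r s Tgrp x = x" "normH r s Sgrp x = x + s x"
    by (simp_all add: normH_def Tgrp_def Sgrp_def act_simps)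
  have "normH r s ({0..<q} \<times> E) x = (\<Sum>k<q. \<Sum>e\<in>E. act r s (k, e) x)" for E
    by (simp add: normH_def sum.cartesian_product atLeast0LessThan)
  moreover have "{0..<2} = {0, Suc 0}" by auto
  ultimately show "normH r s (Rgrp q) x = N x" "normH r s (Dgrp q) x = N (x + s x)"
    by (simp_all add: Rgrp_def Dgrp_def act_simps N_def rp_simps)
qed

abbreviation sp :: "'m set" where "sp \<equiv> range (\<lambda>x. x + s x)"
abbreviation sm :: "'m set" where "sm \<equiv> range (\<lambda>x. s x - x)"

lemma zsubgroup_sp: "is_zsubgroup sp" and zsubgroup_sm: "is_zsubgroup sm"
  by (auto intro!: zsubgroup_image zsubgroup_UNIV simp: zhom_def s_simps)

lemma sm_eq: "range (\<lambda>x. x - s x) = sm"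
proof -
  have "x - s x = s (- x) - (- x)" "s x - x = - x - s (- x)" for x by (simp_all add: s_simps)
  then show ?thesis by (metis (no_types, lifting) equalityI image_subsetI rangeI)
qed

lemma diff_s_mem_sm: "x - s x \<in> sm"
  unfolding sm_eq[symmetric] by (rule rangeI)

lemma sp_L: "sp \<subseteq> L" and sm_Lm: "sm \<subseteq> Lm"
  using plus_s_mem by (auto simp: sm_eq[symmetric])

lemma tate_h0_eq: "tate_h0 r s Tgrp = 1" "tate_h0 r s (Rgrp q) = qcard P (range N)"
  "tate_h0 r s Sgrp = qcard L sp"
  unfolding tate_h0_def fixpts_eq normH_eq[abs_def]
  by (simp_all add: qcard_self zsubgroup_UNIV)

lemma tate_h0_D: "tate_h0 r s (Dgrp q) = h0p * qcard L sp"
proof -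
  have D: "range (\<lambda>x. N (x + s x)) = N ` sp" by (simp add: image_image)
  have Z: "is_zsubgroup (N ` L)" "is_zsubgroup (N ` sp)"
    using zsubgroup_sp by (auto intro!: zsubgroups)
  have "qcard L sp = qcard (N ` L) (N ` sp)"
  proof (rule qcard_iso[OF zsubgroup_L zsubgroup_sp sp_L Z image_mono[OF sp_L] N_hom])
    show "N x \<in> N ` sp \<longleftrightarrow> x \<in> sp" if x: "x \<in> L" for x
    proof
      assume "N x \<in> N ` sp"
      then obtain y where "N x = N y + s (N y)" by (auto simp: N_simps s_N)
      then have "x = (N y - (\<Sum>i=1..h0. rp i x)) + s (N y - (\<Sum>i=1..h0. rp i x))"
        using N_of_fixed[OF x] by (simp add: s_simps(4) algebra_simps)
      then show "x \<in> sp" by blast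
    qed auto
    show "\<exists>x\<in>L. y - N x \<in> N ` sp" if "y \<in> N ` L" for y
    proof -
      obtain x where "x \<in> L" "y = N x" using \<open>y \<in> N ` L\<close> by blast
      then show ?thesis using zsubgroup_0[OF Z(2)] by (intro bexI[of _ x]) simp_all
    qed
  qed simp
  then show ?thesis
    unfolding tate_h0_def fixpts_eq normH_eq D
    using N_mem sp_L by (auto intro!: qcard_mult zsubgroups Z)
qed

text \<open>rho^k - 1 is a multiple of rho - 1, and rho^k sigma - 1 = (rho^k - 1) sigma + (sigma -
  1).\<close>

lemma zspan_act: "zspan {act r s g x - x | g x. g \<in> Tgrp} = {0}"
  "zspan {act r s g x - x | g x. g \<in> Rgrp q} = range th"
  "zspan {act r s g x - x | g x. g \<in> Sgrp} = sm"
  "zspan {act r s g x - x | g x. g \<in> Dgrp q} = ssum (range th) sm"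
proof -
  have R: "is_zsubgroup (range th)" by (intro zsubgroups)
  have rp: "rp k x - x \<in> range th" for k x
  proof (induction k)
    case (Suc k)
    have "rp (Suc k) x - x = (rp k x - x) + th (rp h1 (rp k x))"
      unfolding r_diff_eq(1)[symmetric] by simp
    then show ?case using Suc R by (metis rangeI zsubgroup_add)
  qed (simp add: zsubgroup_0[OF R])
  show "zspan {act r s g x - x | g x. g \<in> Tgrp} = {0}"
    by (rule zspan_eqI) (auto simp: Tgrp_def act_simps zsubgroup_trivial zsubgroup_0)
  show "zspan {act r s g x - x | g x. g \<in> Sgrp} = sm"
  proof (rule zspan_eqI)
    show "{act r s g x - x | g x. g \<in> Sgrp} \<subseteq> sm"
      using zsubgroup_0[OF zsubgroup_sm] by (auto simp: Sgrp_def act_simps)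
    show "sm \<subseteq> B" if "{act r s g x - x | g x. g \<in> Sgrp} \<subseteq> B" for B
    proof
      fix y assume "y \<in> sm"
      then obtain x where "y = act r s (0, Suc 0) x - x" by (auto simp: act_simps)
      then show "y \<in> B" using that by (auto simp: Sgrp_def)
    qed
  qed (rule zsubgroup_sm)
  have Rsub: "range th \<subseteq> B" if "{act r s g x - x | g x. g \<in> Rgrp q} \<subseteq> B" for B
  proof
    fix y assume "y \<in> range th"
    then obtain x where "y = act r s (1, 0) x - x"
      unfolding range_th[symmetric] by (auto simp: act_simps)
    then show "y \<in> B" using that q_gt_1 by (auto simp: Rgrp_def)
  qed
  show "zspan {act r s g x - x | g x. g \<in> Rgrp q} = range th"
    using rp Rsub R by (intro zspan_eqI) (auto simp: Rgrp_def act_simps)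
  show "zspan {act r s g x - x | g x. g \<in> Dgrp q} = ssum (range th) sm"
  proof (rule zspan_eqI)
    show "{act r s g x - x | g x. g \<in> Dgrp q} \<subseteq> ssum (range th) sm"
    proof clarify
      fix k e x assume "(k, e) \<in> Dgrp q"
      then have "e = 0 \<or> e = Suc 0" by (auto simp: Dgrp_def)
      then show "act r s (k, e) x - x \<in> ssum (range th) sm"
      proof
        assume "e = 0"
        then have "act r s (k, e) x - x = (rp k x - x) + 0" by (simp add: act_simps)
        then show ?thesis using rp zsubgroup_0[OF zsubgroup_sm] by (metis ssumI)
      next
        assume "e = Suc 0"
        then have "act r s (k, e) x - x = (rp k (s x) - s x) + (s x - x)" by (simp add: act_simps)
        also have "\<dots> \<in> ssum (range th) sm" using rp by (intro ssumI) auto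
        finally show ?thesis .
      qed
    qed
    show "is_zsubgroup (ssum (range th) sm)" by (intro zsubgroups zsubgroup_sm)
    show "ssum (range th) sm \<subseteq> B"
      if B: "{act r s g x - x | g x. g \<in> Dgrp q} \<subseteq> B" "is_zsubgroup B" for B
    proof (rule ssum_subset[OF B(2)])
      have "Rgrp q \<subseteq> Dgrp q" by (auto simp: Rgrp_def Dgrp_def)
      then have "{act r s g x - x | g x. g \<in> Rgrp q} \<subseteq> {act r s g x - x | g x. g \<in> Dgrp q}"
        by blast
      then show "range th \<subseteq> B" using Rsub B(1) by blast
      show "sm \<subseteq> B"
      proof
        fix y assume "y \<in> sm"
        then obtain x where "y = act r s (0, Suc 0) x - x" by (auto simp: act_simps)
        moreover have "(0, Suc 0) \<in> Dgrp q" using q_gt_1 by (simp add: Dgrp_def)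
        ultimately show "y \<in> B" using B(1) by blast
      qed
    qed
  qed
qed

lemma tate_hm1_eq: "tate_hm1 r s Tgrp = 1" "tate_hm1 r s (Rgrp q) = qcard K (range th)"
  "tate_hm1 r s Sgrp = qcard Lm sm"
proof -
  have "{x. x + s x = 0} = Lm" by (auto simp: Lm_def eq_neg_iff_add_eq_0 add.commute)
  then show "tate_hm1 r s Tgrp = 1" "tate_hm1 r s (Rgrp q) = qcard K (range th)"
    "tate_hm1 r s Sgrp = qcard Lm sm"
    unfolding tate_hm1_def zspan_act normH_eq K_def
    by (simp_all add: qcard_self zsubgroup_trivial)
qed

text \<open>The index of \<open>ssum (range th) sm\<close> in Lm + K, the kernel of the norm,
  factors through \<open>sm\<close> + K. The upper step is H^-1(Sigma), since
  \<open>K_minus_eq\<close> puts K \<inter> Lm inside \<open>sm\<close>; the lower one is the plus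
  part of K / th M.\<close>

lemma tate_hm1_D: "tate_hm1 r s (Dgrp q) = qcard Lm sm * hp"
proof -
  let ?I = "ssum (range th) sm" and ?J = "ssum sm K"
  have Z: "is_zsubgroup ?I" "is_zsubgroup ?J" "is_zsubgroup (ssum Lm K)" "is_zsubgroup (K \<inter> L)"
    "is_zsubgroup (th ` Lm)"
    by (intro zsubgroups zsubgroup_sm)+
  have I: "{x. N (x + s x) = 0} = ssum Lm K"
  proof (intro equalityI subsetI)
    fix x assume "x \<in> {x. N (x + s x) = 0}"
    then have "x + s x \<in> K" by (simp add: K_def)
    then obtain k where k: "k \<in> K" "x + s x = k + s k" using K_plus_eq plus_s_mem(1) by blast
    then have "(x - k) + k \<in> ssum Lm K"
      by (intro ssumI) (auto simp: Lm_def s_simps algebra_simps)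
    then show "x \<in> ssum Lm K" by simp
  next
    fix x assume "x \<in> ssum Lm K"
    then obtain a b where "x = a + b" "s a = - a" "N b = 0" by (auto elim: ssumE simp: Lm_def K_def)
    moreover from this have "N (s b) = 0" by (simp add: s_N[symmetric] s_simps)
    ultimately show "x \<in> {x. N (x + s x) = 0}" by (simp add: N_simps s_simps)
  qed
  have sub: "?I \<subseteq> ?J" "?J \<subseteq> ssum Lm K" "th ` Lm \<subseteq> K \<inter> L"
  proof -
    show "?I \<subseteq> ?J"
      using th_mem(3) ssum_superset[OF zsubgroup_K, of sm] ssum_superset(2)[OF zsubgroup_sm, of K]
      by (intro ssum_subset Z) auto
    show "?J \<subseteq> ssum Lm K" using sm_Lm by (auto elim!: ssumE intro!: ssumI)
    show "th ` Lm \<subseteq> K \<inter> L" using th_mem by auto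
  qed
  have 1: "qcard Lm sm = qcard (ssum Lm K) ?J"
  proof (rule qcard_iso[OF zsubgroup_Lm zsubgroup_sm sm_Lm Z(3,2) sub(2) zhom_id])
    show "x \<in> ssum Lm K" if "x \<in> Lm" for x
      using that by (rule subsetD[OF ssum_superset(1)[OF zsubgroup_K]])
    show "x \<in> ?J \<longleftrightarrow> x \<in> sm" if x: "x \<in> Lm" for x
    proof
      assume "x \<in> ?J"
      then obtain y k where yk: "y \<in> sm" "k \<in> K" "x = y + k" by (elim ssumE)
      then have "k = x - y" by simp
      then have "k \<in> Lm" using x yk(1) sm_Lm zsubgroup_Lm by (auto intro: zsubgroup_diff)
      then obtain z where "k = z - s z" using K_minus_eq yk(2) by blast
      then have "k \<in> sm" by (simp only: diff_s_mem_sm)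
      then show "x \<in> sm" using yk zsubgroup_sm by (simp add: zsubgroup_add)
    next
      assume "x \<in> sm"
      then show "x \<in> ?J" by (rule subsetD[OF ssum_superset(1)[OF zsubgroup_K]])
    qed
    show "\<exists>x\<in>Lm. y - x \<in> ?J" if "y \<in> ssum Lm K" for y
    proof -
      obtain a k where "a \<in> Lm" "k \<in> K" "y = a + k" using \<open>y \<in> ssum Lm K\<close> by (auto elim: ssumE)
      moreover from this have "y - a \<in> ?J"
        using subsetD[OF ssum_superset(2)[OF zsubgroup_sm, of K], of k] by simp
      ultimately show ?thesis by (intro bexI[of _ a])
    qed
  qed
  have 2: "hp = qcard ?J ?I"
  proof (rule qcard_iso[OF Z(4,5) sub(3) Z(2,1) sub(1) zhom_id])
    show "x \<in> ?J" if "x \<in> K \<inter> L" for x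
      using that subsetD[OF ssum_superset(2)[OF zsubgroup_sm, of K], of x] by simp
    show "x \<in> ?I \<longleftrightarrow> x \<in> th ` Lm" if x: "x \<in> K \<inter> L" for x
    proof
      assume "x \<in> ?I"
      then obtain y z where yz: "x = th y + (s z - z)" by (auto elim!: ssumE)
      have "x + x = x + s x" using x by (simp add: L_def)
      also have "\<dots> = th (y - s y)" by (simp add: yz s_simps s_th th_simps)
      finally have xx: "x + x = th (y - s y)" .
      obtain u where u: "zsmul (int q) x = th u" using q_minus_N[of x] x by (auto simp: K_def)
      \<comment> \<open>Both q x and 2 x lie in the image of \<open>th\<close>, hence so does x = q
        x - \<open>h0\<close> (2 x).\<close>
      have "x = zsmul (int q) x - zsmul (int h0) (x + x)"
        unfolding half_int zsmul_add_left zsmul_add_right by simp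
      then have e: "th (u - zsmul (int h0) (y - s y)) = x" by (simp only: u xx th_simps)
      then have "th (u - zsmul (int h0) (y - s y)) \<in> L" using x by simp
      then obtain v where "v \<in> Lm" "th v = x" unfolding e[symmetric] by (rule th_in_L)
      then show "x \<in> th ` Lm" by (intro image_eqI[of x th v]) simp_all
    next
      assume "x \<in> th ` Lm"
      then have "x \<in> range th" by blast
      then show "x \<in> ?I" by (rule subsetD[OF ssum_superset(1)[OF zsubgroup_sm]])
    qed
    show "\<exists>x\<in>K \<inter> L. y - x \<in> ?I" if "y \<in> ?J" for y
    proof -
      obtain a k where ak: "a \<in> sm" "k \<in> K" "y = a + k" using \<open>y \<in> ?J\<close> by (elim ssumE)
      obtain u where u: "zsmul (int q) k = th u" using q_minus_N[of k] ak by (auto simp: K_def)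
      \<comment> \<open>Modulo \<open>?I\<close>, q k vanishes and sigma k equals k, while - 2
        \<open>h0\<close> = 1 - q; so k is congruent to this element, which lies in L.\<close>
      let ?x = "- zsmul (int h0) (k + s k)"
      have "?x \<in> K \<inter> L"
        using ak(2) s_mem(2) plus_s_mem(1)
        by (simp add: zsubgroup_intros[OF zsubgroup_K] zsubgroup_intros[OF zsubgroup_L])
      moreover have "k - ?x = th u - zsmul (int h0) (k - s k)"
        unfolding u[symmetric] half_int zsmul_add_left zsmul_add_right zmod.scale_right_diff_distrib by simp
      then have "y - ?x = th u + (a - zsmul (int h0) (k - s k))" using ak(3) by (simp add: algebra_simps)
      moreover have "a - zsmul (int h0) (k - s k) \<in> sm"
        using ak(1) by (intro zsubgroup_diff zsubgroup_zsmul zsubgroup_sm diff_s_mem_sm)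
      ultimately have "y - ?x \<in> ?I" "?x \<in> K \<inter> L" by (simp_all only: ssumI rangeI)
      then show ?thesis by (intro bexI[of _ ?x])
    qed
  qed
  show ?thesis
    unfolding tate_hm1_def zspan_act normH_eq I 1 2 by (rule qcard_mult[OF Z(3,2,1) sub(1,2)])
qed

end

section \<open>First cohomology by explicit cocycles\<close>

context dihedral_module
begin

text \<open>The operator 1 + rho + ... + rho^(k-1): a cocycle with value x at rho takes the value
  \<open>sg k x\<close> at rho^k.\<close>

definition sg :: "nat \<Rightarrow> 'm \<Rightarrow> 'm" where "sg k x = (\<Sum>i<k. rp i x)"

lemma sg_0: "sg 0 x = 0" and sg_Suc: "sg (Suc k) x = sg k x + rp k x" and sg_q: "sg q x = N x"
  by (simp_all add: sg_def N_def)

lemma sg_add: "sg (a + b) x = sg a x + rp a (sg b x)"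
  by (induction b) (simp_all add: sg_0 sg_Suc rp_simps rp_rp add.assoc)

text \<open>N x = 0 is what makes the candidate cocycle well defined on exponents modulo q.\<close>

lemma sg_mod: "N x = 0 \<Longrightarrow> sg (k mod q) x = sg k x"
proof -
  assume x: "N x = 0"
  have "sg (m * q) x = 0" for m
    by (induction m) (simp_all add: sg_0 sg_add sg_q x rp_simps(2))
  then have "sg (k mod q + k div q * q) x = sg (k mod q) x" unfolding sg_add by (simp add: rp_simps(2))
  then show ?thesis by (simp only: mod_div_mult_eq)
qed

lemma sg_diff: "sg k (x - y) = sg k x - sg k y"
  by (simp add: sg_def rp_simps sum_subtractf)

lemma sg_telescope: "sg k (r m - m) = rp k m - m"
  by (induction k) (simp_all add: sg_0 sg_Suc rp_simps funpow_swap1)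

lemma cocycle_rule:
  "f \<in> cocycles1 q r s H \<Longrightarrow> g \<in> H \<Longrightarrow> h \<in> H \<Longrightarrow> f (dmul q g h) = f g + act r s g (f h)"
  by (simp add: cocycles1_def)

lemma cocycle_outside: "f \<in> cocycles1 q r s H \<Longrightarrow> g \<notin> H \<Longrightarrow> f g = 0"
  unfolding cocycles1_def by blast

lemma cocycle_0:
  assumes "f \<in> cocycles1 q r s H" "(0, 0) \<in> H" shows "f (0, 0) = 0"
  using cocycle_rule[OF assms(1) assms(2) assms(2)] q_gt_1 by (simp add: dmul_def act_simps)

lemma cocycle_rotation:
  assumes f: "f \<in> cocycles1 q r s H" and H: "Rgrp q \<subseteq> H"
  shows "k < q \<Longrightarrow> f (k, 0) = sg k (f (1, 0))" "N (f (1, 0)) = 0"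
proof -
  have m: "(k, 0) \<in> H" if "k < q" for k using that H by (auto simp: Rgrp_def)
  have z: "f (0, 0) = 0" using cocycle_0[OF f] m[of 0] q_gt_1 by simp
  have step: "f (Suc k mod q, 0) = f (k, 0) + rp k (f (1, 0))" if "k < q" for k
    using cocycle_rule[OF f m[OF that] m[OF q_gt_1]] by (simp add: dmul_def act_simps)
  show *: "f (k, 0) = sg k (f (1, 0))" if "k < q" for k
    using that
  proof (induction k)
    case (Suc k)
    then show ?case using step[of k] by (simp add: sg_Suc)
  qed (simp add: sg_0 z)
  have "sg q (f (1, 0)) = 0"
    using step[of "q - 1"] *[of "q - 1"] q_gt_1 z sg_Suc[of "q - 1" "f (1, 0)"] by simp
  then show "N (f (1, 0)) = 0" by (simp add: sg_q)
qed

lemma tate_h1_T: "tate_h1 q r s Tgrp = 1"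
proof -
  have "tate_h1 q r s Tgrp = qcard {0 :: 'm} {0}"
  proof (rule tate_h1_eq[where \<phi>="\<lambda>_. 0"])
    have z: "f = (\<lambda>_. 0)" if "f \<in> cocycles1 q r s Tgrp" for f
    proof
      show "f g = 0" for g
        using cocycle_0[OF that] cocycle_outside[OF that, of g] by (cases "g = (0, 0)") (simp_all add: Tgrp_def)
    qed
    have "(\<lambda>_. 0) \<in> cocycles1 q r s Tgrp" by (simp add: cocycles1_def Tgrp_def act_simps)
    then show "(\<lambda>_. 0) ` cocycles1 q r s Tgrp = {0 :: 'm}" by auto
    fix f f' assume "f \<in> cocycles1 q r s Tgrp" "f' \<in> cocycles1 q r s Tgrp"
    then have "f = (\<lambda>_. 0)" "f' = (\<lambda>_. 0)" using z by blast+
    then show "(\<lambda>g. f' g - f g) \<in> coboundaries1 r s Tgrp \<longleftrightarrow> (0 :: 'm) - 0 \<in> {0}"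
      by (auto simp: coboundaries1_def Tgrp_def act_simps fun_eq_iff)
  qed (simp_all add: zsubgroup_trivial)
  then show ?thesis by (simp add: qcard_self zsubgroup_trivial)
qed

text \<open>A cocycle on a cyclic group is determined by its value at the generator, which can be
  any element killed by N; coboundaries give (rho - 1) M = th M.\<close>

lemma tate_h1_R: "tate_h1 q r s (Rgrp q) = qcard K (range th)"
proof (rule tate_h1_eq[where \<phi>="\<lambda>f. f (1, 0)"])
  let ?C = "cocycles1 q r s (Rgrp q)"
  have m: "(1, 0) \<in> Rgrp q" using q_gt_1 by (simp add: Rgrp_def)
  show "(\<lambda>f. f (1, 0)) ` ?C = K"
  proof (intro equalityI subsetI)
    fix x assume x: "x \<in> K"
    define f where "f g = (if g \<in> Rgrp q then sg (fst g) x else 0)" for g :: "nat \<times> nat"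
    have "f \<in> ?C"
      using x by (auto simp: cocycles1_def f_def Rgrp_def dmul_def act_simps K_def sg_mod sg_add)
    moreover have "f (1, 0) = x" using m sg_Suc[of 0 x] by (simp add: f_def sg_0)
    ultimately show "x \<in> (\<lambda>f. f (1, 0)) ` ?C" by blast
  qed (use cocycle_rotation(2) in \<open>auto simp: K_def\<close>)
  show "(\<lambda>g. f' g - f g) \<in> coboundaries1 r s (Rgrp q) \<longleftrightarrow> f' (1, 0) - f (1, 0) \<in> range th"
    if f: "f \<in> ?C" "f' \<in> ?C" for f f'
  proof
    assume "(\<lambda>g. f' g - f g) \<in> coboundaries1 r s (Rgrp q)"
    then obtain x where "(\<lambda>g. f' g - f g) = (\<lambda>g. if g \<in> Rgrp q then act r s g x - x else 0)"
      by (auto simp: coboundaries1_def)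
    from fun_cong[OF this, of "(1, 0)"] show "f' (1, 0) - f (1, 0) \<in> range th"
      using m by (simp add: act_simps range_th[symmetric])
  next
    assume "f' (1, 0) - f (1, 0) \<in> range th"
    then obtain x where x: "f' (1, 0) - f (1, 0) = r x - x" unfolding range_th[symmetric] by blast
    have "f' g - f g = (if g \<in> Rgrp q then act r s g x - x else 0)" for g
    proof (cases "g \<in> Rgrp q")
      case True
      then obtain k where k: "g = (k, 0)" "k < q" by (auto simp: Rgrp_def)
      then have "f' g - f g = sg k (f' (1, 0) - f (1, 0))"
        by (simp only: sg_diff cocycle_rotation(1)[OF f(1) order_refl] cocycle_rotation(1)[OF f(2) order_refl])
      then show ?thesis using True k(1) by (simp only: x sg_telescope act_simps if_True)
    qed (simp add: cocycle_outside[OF f(1)] cocycle_outside[OF f(2)])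
    then show "(\<lambda>g. f' g - f g) \<in> coboundaries1 r s (Rgrp q)" by (auto simp: coboundaries1_def)
  qed
qed (use th_mem in \<open>auto intro!: zsubgroups\<close>)

lemma tate_h1_S: "tate_h1 q r s Sgrp = qcard Lm sm"
proof (rule tate_h1_eq[where \<phi>="\<lambda>f. f (0, 1)"])
  let ?C = "cocycles1 q r s Sgrp"
  have m: "(0, 0) \<in> Sgrp" "(0, 1) \<in> Sgrp" by (simp_all add: Sgrp_def)
  show "(\<lambda>f. f (0, 1)) ` ?C = Lm"
  proof (intro equalityI subsetI)
    fix x assume x: "x \<in> Lm"
    define f where "f g = (if g = (0, 1) then x else 0)" for g :: "nat \<times> nat"
    have "f \<in> ?C"
      using x q_gt_1 by (auto simp: cocycles1_def f_def Sgrp_def dmul_def act_simps Lm_def s_simps)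
    moreover have "f (0, 1) = x" by (simp add: f_def)
    ultimately show "x \<in> (\<lambda>f. f (0, 1)) ` ?C" by blast
  next
    fix y assume "y \<in> (\<lambda>f. f (0, 1)) ` ?C"
    then obtain f where f: "f \<in> ?C" "y = f (0, 1)" by auto
    show "y \<in> Lm"
      using cocycle_rule[OF f(1) m(2,2)] cocycle_0[OF f(1) m(1)] q_gt_1 f(2)
      by (simp add: dmul_def act_simps Lm_def eq_neg_iff_add_eq_0 add.commute)
  qed
  show "(\<lambda>g. f' g - f g) \<in> coboundaries1 r s Sgrp \<longleftrightarrow> f' (0, 1) - f (0, 1) \<in> sm"
    if f: "f \<in> ?C" "f' \<in> ?C" for f f'
  proof
    assume "(\<lambda>g. f' g - f g) \<in> coboundaries1 r s Sgrp"
    then obtain x where "(\<lambda>g. f' g - f g) = (\<lambda>g. if g \<in> Sgrp then act r s g x - x else 0)"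
      by (auto simp: coboundaries1_def)
    from fun_cong[OF this, of "(0, 1)"] show "f' (0, 1) - f (0, 1) \<in> sm"
      using m by (simp add: act_simps)
  next
    assume "f' (0, 1) - f (0, 1) \<in> sm"
    then obtain x where x: "f' (0, 1) - f (0, 1) = s x - x" by blast
    have "f' g - f g = (if g \<in> Sgrp then act r s g x - x else 0)" for g
    proof (cases "g \<in> Sgrp")
      case True
      then have "g = (0, 0) \<or> g = (0, 1)" by (simp add: Sgrp_def)
      then show ?thesis
        using True x cocycle_0[OF f(1) m(1)] cocycle_0[OF f(2) m(1)] by (auto simp: act_simps)
    qed (simp add: cocycle_outside[OF f(1)] cocycle_outside[OF f(2)])
    then show "(\<lambda>g. f' g - f g) \<in> coboundaries1 r s Sgrp" by (auto simp: coboundaries1_def)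
  qed
qed (use zsubgroup_Lm zsubgroup_sm sm_Lm in auto)

text \<open>A cocycle on \<open>D\<close> is the pair of its values at \<open>\<rho>\<close> and \<open>\<sigma>\<close>, subject to one condition for each
  defining relation of \<open>D\<close>.\<close>
definition ZD1 :: "('m \<times> 'm) set" where
  "ZD1 = {(a, b). N a = 0 \<and> s b = - b \<and> a + r (s a) = b - r b}"

definition BD1 :: "('m \<times> 'm) set" where
  "BD1 = range (\<lambda>m. (r m - m, s m - m))"

lemma zsubgroup_ZD1: "is_zsubgroup ZD1"
proof -
  have "ZD1 = {z. N (fst z) = 0} \<inter> {z. s (snd z) + snd z = 0} \<inter>
      {z. fst z + r (s (fst z)) - snd z + r (snd z) = 0}"
    by (auto simp: ZD1_def eq_neg_iff_add_eq_0 algebra_simps)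
  also have "is_zsubgroup \<dots>"
    by (intro zsubgroup_Int zsubgroup_kernel)
      (simp_all add: zhom_def N_simps s_simps zhom_add[OF r_hom])
  finally show ?thesis .
qed

lemma zsubgroup_BD1: "is_zsubgroup BD1"
  unfolding BD1_def
  by (auto intro!: zsubgroup_image zsubgroup_UNIV simp: zhom_def s_simps zhom_add[OF r_hom])

text \<open>With omega = \<open>rp h1\<close>, omega sigma omega^-1 = omega^2 sigma = rho sigma:
  twisting by omega carries the reflection rho sigma to sigma.\<close>

lemma r_s_rp_h1: "r (s (rp h1 x)) = rp h1 (s x)"
proof -
  have "h1 \<le> q" "q - h1 = h0" using half by auto
  then have "r (s (rp h1 x)) = rp (Suc h0) (s x)" by (simp add: s_rp_le)
  then show ?thesis using half(2) by simp
qed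

lemma BD1_subset: "BD1 \<subseteq> ZD1"
proof -
  have "r (s (r x)) = s x" for x
    using s_r_s[of "s x"] rp_rp[of 1 "q - 1" "s x"] q_gt_1 by (simp add: r_order)
  then show ?thesis
    by (auto simp: BD1_def ZD1_def N_simps N_r s_simps zhom_diff[OF r_hom] algebra_simps)
qed

text \<open>\<open>snd\<close> is restriction to Sigma and is onto \<open>Lm\<close>. A cocycle
  whose restriction is trivial can be normalised to b = 0; then a + rho sigma a = 0, so omega^-1 a
  lies in \<open>Lm\<close>. This is where the minus part of K / th M enters, in place of the plus
  part in degree -1.\<close>

lemma qcard_ZD1: "qcard ZD1 BD1 = qcard Lm sm * hm"
proof -
  have snd: "zhom (snd :: 'm \<times> 'm \<Rightarrow> 'm)" by (simp add: zhom_def)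
  define W where "W = ZD1 \<inter> {z. snd z \<in> sm}"
  have W: "is_zsubgroup W" "W \<subseteq> ZD1" "BD1 \<subseteq> W"
    unfolding W_def using BD1_subset
    by (auto intro!: zsubgroup_Int zsubgroup_ZD1 zsubgroup_vimage[OF snd zsubgroup_sm])
      (auto simp: BD1_def)
  have 1: "qcard ZD1 W = qcard Lm sm"
  proof (rule qcard_iso[OF zsubgroup_ZD1 W(1,2) zsubgroup_Lm zsubgroup_sm sm_Lm snd])
    show "\<exists>x\<in>ZD1. y - snd x \<in> sm" if y: "y \<in> Lm" for y
    proof -
      \<comment> \<open>After the twist by omega, the condition a + rho sigma a = y - rho y asks for
        an element of K with trace - th y, which \<open>K_plus_eq\<close> provides.\<close>
      have "- th y \<in> K" "- th y \<in> L"
        using th_mem y by (auto intro!: zsubgroup_uminus zsubgroups)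
      then obtain a where a: "a \<in> K" "- th y = a + s a" by (rule K_plus_eq)
      have "rp h1 a + r (s (rp h1 a)) = rp h1 (a + s a)" by (simp add: r_s_rp_h1 rp_simps)
      also have "\<dots> = y - r y" unfolding a(2)[symmetric] by (simp add: rp_simps r_diff_eq(2)[symmetric])
      finally have "(rp h1 a, y) \<in> ZD1" using a(1) y by (simp add: ZD1_def Lm_def K_def N_rp)
      then show ?thesis using zsubgroup_0[OF zsubgroup_sm] by (intro bexI[of _ "(rp h1 a, y)"]) auto
    qed
  qed (auto simp: W_def ZD1_def Lm_def)
  have fh: "zhom (\<lambda>k. (rp h1 k, 0 :: 'm))" by (simp add: zhom_def rp_simps)
  have Z: "is_zsubgroup (K \<inter> Lm)" "is_zsubgroup (th ` L)" "th ` L \<subseteq> K \<inter> Lm"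
    using th_mem by (auto intro!: zsubgroups)
  have 2: "hm = qcard W BD1"
  proof (rule qcard_iso[OF Z W(1) zsubgroup_BD1 W(3) fh])
    show "(rp h1 k, 0) \<in> W" if "k \<in> K \<inter> Lm" for k
      using that zsubgroup_0[OF zsubgroup_sm]
      by (simp add: W_def ZD1_def K_def Lm_def N_rp r_s_rp_h1 rp_simps s_simps zhom_0[OF r_hom])
    show "(rp h1 k, 0) \<in> BD1 \<longleftrightarrow> k \<in> th ` L" if "k \<in> K \<inter> Lm" for k
    proof
      assume "(rp h1 k, 0) \<in> BD1"
      then obtain m where m: "rp h1 k = rp h1 (th m)" "s m = m"
        by (auto simp: BD1_def r_diff_eq(2))
      then have "k = th m" by (metis rp_inverse(2))
      then show "k \<in> th ` L" using m(2) by (auto simp: L_def)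
    next
      assume "k \<in> th ` L"
      then obtain m where "k = th m" "s m = m" by (auto simp: L_def)
      then have "(rp h1 k, 0) = (r m - m, s m - m)" by (simp add: r_diff_eq(2))
      then show "(rp h1 k, 0) \<in> BD1" unfolding BD1_def by blast
    qed
    show "\<exists>k\<in>K \<inter> Lm. w - (rp h1 k, 0) \<in> BD1" if w: "w \<in> W" for w
    proof -
      obtain a b m where abm: "w = (a, b)" "(a, b) \<in> ZD1" "b = s m - m"
        using w by (cases w) (auto simp: W_def)
      \<comment> \<open>Subtracting the coboundary of m makes the value at sigma zero;
        \<open>rp h0\<close> then undoes the twist.\<close>
      define c where "c = a - (r m - m)"
      have "(r m - m, b) \<in> BD1" unfolding BD1_def abm(3) by blast
      then have "(a, b) - (r m - m, b) \<in> ZD1"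
        using abm(2) BD1_subset zsubgroup_ZD1 by (blast intro: zsubgroup_diff)
      then have c: "N c = 0" "c + r (s c) = 0"
        by (simp_all add: c_def ZD1_def zhom_0[OF r_hom])
      have "rp h1 (rp h0 c) = c" by (rule rp_inverse)
      then have "rp h1 (rp h0 c + s (rp h0 c)) = 0"
        using c(2) r_s_rp_h1[of "rp h0 c"] by (simp add: rp_simps(1))
      then have "rp h0 c + s (rp h0 c) = 0"
        by (metis rp_inverse(2) rp_simps(2))
      then have "rp h0 c \<in> K \<inter> Lm"
        using c(1) by (simp add: K_def Lm_def N_rp eq_neg_iff_add_eq_0 add.commute)
      moreover have "w - (rp h1 (rp h0 c), 0) \<in> BD1"
        using \<open>(r m - m, b) \<in> BD1\<close> unfolding rp_inverse by (simp add: abm(1) c_def)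
      ultimately show ?thesis by blast
    qed
  qed
  show ?thesis unfolding 1[symmetric] 2 by (rule qcard_mult[OF zsubgroup_ZD1 W(1) zsubgroup_BD1 W(3,2)])
qed

text \<open>The two sides are the values forced on a cocycle at sigma rho^l = rho^(q-l) sigma,
  computed from the two expressions.\<close>

lemma ZD1_reflect:
  assumes "(a, b) \<in> ZD1" "l \<le> q"
  shows "sg (q - l) a + rp (q - l) b = b + s (sg l a)"
  using assms(2)
proof (induction l)
  case 0
  then show ?case using assms(1) by (simp add: sg_q ZD1_def r_order sg_0 s_simps)
next
  case (Suc l)
  define m where "m = q - Suc l"
  have m: "q - l = Suc m" using Suc.prems by (simp add: m_def)
  have IH: "sg m a + rp m a + rp (Suc m) b = b + s (sg l a)"
    using Suc by (simp add: m sg_Suc)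
  have "s (sg (Suc l) a) = s (sg l a) + rp (Suc m) (s a)"
    using Suc.prems m by (simp add: sg_Suc s_simps s_rp_le)
  moreover have "rp m (a + r (s a)) = rp m (b - r b)" using assms(1) by (simp add: ZD1_def)
  then have "rp m a + rp (Suc m) (s a) = rp m b - rp (Suc m) b"
    by (simp add: rp_simps funpow_swap1)
  ultimately have "b + s (sg (Suc l) a) = sg m a + rp m b"
    using IH by (metis (no_types, opaque_lifting) add.assoc add.commute diff_add_cancel)
  then show ?case by (simp add: m_def)
qed

text \<open>The formula is f(rho^k) + rho^k f(sigma^e). Products with a rotation on the left need
  the periodicity of \<open>sg\<close>; those with a reflection on the left need
  \<open>ZD1_reflect\<close>.\<close>

lemma cocycle_of_ZD1:
  assumes ab: "(a, b) \<in> ZD1"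
  defines "f \<equiv> \<lambda>g. if g \<in> Dgrp q then sg (fst g) a + rp (fst g) (if snd g = 0 then 0 else b) else 0"
  shows "f \<in> cocycles1 q r s (Dgrp q)"
proof -
  have Na: "N a = 0" and sb: "s b = - b" using ab by (auto simp: ZD1_def)
  define \<beta> where "\<beta> e = (if e = (0::nat) then 0 else b)" for e
  have F: "f (k, e) = sg k a + rp k (\<beta> e)" if "(k, e) \<in> Dgrp q" for k e
    using that by (simp add: f_def \<beta>_def)
  have "f (dmul q (k, e) (l, d)) = f (k, e) + act r s (k, e) (f (l, d))"
    if g: "(k, e) \<in> Dgrp q" and h: "(l, d) \<in> Dgrp q" for k e l d
  proof -
    have l: "l < q" and d: "d = 0 \<or> d = 1" and e: "e = 0 \<or> e = 1" using g h by (auto simp: Dgrp_def)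
    show ?thesis
    proof (cases "e = 0")
      case True
      have "dmul q (k, e) (l, d) = ((k + l) mod q, d)" using True d by (auto simp: dmul_def)
      moreover have "((k + l) mod q, d) \<in> Dgrp q" using h q_gt_1 by (auto simp: Dgrp_def)
      ultimately show ?thesis
        unfolding True by (simp add: F[OF g[unfolded True]] F[OF h] F sg_mod Na rp_mod sg_add rp_simps rp_rp act_simps \<beta>_def)
    next
      case False
      then have e1: "e = Suc 0" using e by simp
      let ?d = "(1 + d) mod 2"
      have "dmul q (k, e) (l, d) = ((k + (q - l)) mod q, ?d)" by (simp add: e1 dmul_def)
      moreover have "((k + (q - l)) mod q, ?d) \<in> Dgrp q" using q_gt_1 by (simp add: Dgrp_def)
      ultimately have L: "f (dmul q (k, e) (l, d)) = sg k a + rp k (sg (q - l) a + rp (q - l) (\<beta> ?d))"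
        by (simp only: F sg_mod[OF Na] rp_mod sg_add) (simp add: rp_simps rp_rp)
      have key: "sg (q - l) a + rp (q - l) b = b + s (sg l a)" using ZD1_reflect[OF ab, of l] l by simp
      have "sg (q - l) a + rp (q - l) (\<beta> ?d) = b + s (sg l a + rp l (\<beta> d))"
        using d
      proof
        assume "d = 0"
        then show ?thesis using key by (simp add: \<beta>_def s_simps rp_simps)
      next
        assume "d = 1"
        moreover have "s (rp l b) = - rp (q - l) b" using l by (simp add: s_rp_le sb rp_simps)
        ultimately show ?thesis using key by (simp add: \<beta>_def s_simps(1) rp_simps(2) algebra_simps)
      qed
      then show ?thesis
        unfolding L F[OF g] F[OF h] unfolding e1 by (simp add: \<beta>_def act_simps rp_simps add.assoc)
    qed
  qed
  then show ?thesis by (auto simp: cocycles1_def f_def[symmetric]) (simp add: f_def)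
qed

lemma tate_h1_D: "tate_h1 q r s (Dgrp q) = qcard Lm sm * hm"
proof -
  let ?C = "cocycles1 q r s (Dgrp q)"
  have RD: "Rgrp q \<subseteq> Dgrp q" by (auto simp: Rgrp_def Dgrp_def)
  have m: "(1, 0) \<in> Dgrp q" "(0, 1) \<in> Dgrp q" "(0, 0) \<in> Dgrp q" "(q - 1, 0) \<in> Dgrp q"
    using q_gt_1 by (simp_all add: Dgrp_def)
  have refl: "f (k, 1) = sg k (f (1, 0)) + rp k (f (0, 1))" if "f \<in> ?C" "k < q" for f k
  proof -
    have "(k, 0) \<in> Dgrp q" using that(2) by (simp add: Dgrp_def)
    from cocycle_rule[OF that(1) this m(2)] show ?thesis
      using that cocycle_rotation(1)[OF that(1) RD that(2)] by (simp add: dmul_def act_simps)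
  qed
  have "tate_h1 q r s (Dgrp q) = qcard ZD1 BD1"
  proof (rule tate_h1_eq[OF zsubgroup_ZD1 zsubgroup_BD1 BD1_subset, where \<phi>="\<lambda>f. (f (1, 0), f (0, 1))"])
    show "(\<lambda>f. (f (1, 0), f (0, 1))) ` ?C = ZD1"
    proof (intro equalityI subsetI)
      fix z assume "z \<in> ZD1"
      then obtain a b where ab: "z = (a, b)" "(a, b) \<in> ZD1" by (cases z) auto
      let ?f = "\<lambda>g. if g \<in> Dgrp q then sg (fst g) a + rp (fst g) (if snd g = 0 then 0 else b) else 0"
      have "(?f (1, 0), ?f (0, 1)) = z"
        using m sg_Suc[of 0 a] by (simp add: ab sg_0 zhom_0[OF r_hom])
      then show "z \<in> (\<lambda>f. (f (1, 0), f (0, 1))) ` ?C"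
        by (intro image_eqI[where x="?f"] cocycle_of_ZD1[OF ab(2)]) simp
    next
      fix z assume "z \<in> (\<lambda>f. (f (1, 0), f (0, 1))) ` ?C"
      then obtain f where f: "f \<in> ?C" "z = (f (1, 0), f (0, 1))" by auto
      let ?a = "f (1, 0)" and ?b = "f (0, 1)"
      have Na: "N ?a = 0" by (rule cocycle_rotation(2)[OF f(1) RD])
      have sb: "s ?b = - ?b"
        using cocycle_rule[OF f(1) m(2,2)] cocycle_0[OF f(1) m(3)] q_gt_1
        by (simp add: dmul_def act_simps eq_neg_iff_add_eq_0 add.commute)
      \<comment> \<open>The value at sigma rho = rho^(q-1) sigma is computed in two ways; applying
        rho to the result gives the last condition of \<open>ZD1\<close>.\<close>
      have "f (q - 1, 1) = ?b + s ?a"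
        using cocycle_rule[OF f(1) m(2,1)] q_gt_1 by (simp add: dmul_def act_simps)
      then have e: "sg (q - 1) ?a + rp (q - 1) ?b = ?b + s ?a" using refl[OF f(1), of "q - 1"] q_gt_1 by simp
      have "sg q ?a = ?a + r (sg (q - 1) ?a)"
        using sg_add[of 1 "q - 1" ?a] q_gt_1 sg_Suc[of 0 ?a] by (simp add: sg_0)
      then have "r (sg (q - 1) ?a) = - ?a" using Na by (simp add: sg_q eq_neg_iff_add_eq_0 add.commute)
      moreover have "r (rp (q - 1) ?b) = ?b"
        using rp_rp[of 1 "q - 1" ?b] q_gt_1 by (simp add: r_order)
      ultimately have "- ?a + ?b = r ?b + r (s ?a)"
        using arg_cong[OF e, of r] by (simp add: zhom_add[OF r_hom])
      then have "?a + r (s ?a) = ?b - r ?b" by (simp add: algebra_simps)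
      then show "z \<in> ZD1" using Na sb f(2) by (simp add: ZD1_def)
    qed
    show "(\<lambda>g. f' g - f g) \<in> coboundaries1 r s (Dgrp q) \<longleftrightarrow>
        (f' (1, 0), f' (0, 1)) - (f (1, 0), f (0, 1)) \<in> BD1"
      if f: "f \<in> ?C" "f' \<in> ?C" for f f'
    proof
      assume "(\<lambda>g. f' g - f g) \<in> coboundaries1 r s (Dgrp q)"
      then obtain x where "(\<lambda>g. f' g - f g) = (\<lambda>g. if g \<in> Dgrp q then act r s g x - x else 0)"
        by (auto simp: coboundaries1_def)
      from fun_cong[OF this, of "(1, 0)"] fun_cong[OF this, of "(0, 1)"]
      show "(f' (1, 0), f' (0, 1)) - (f (1, 0), f (0, 1)) \<in> BD1"
        using m by (auto simp: act_simps BD1_def)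
    next
      assume "(f' (1, 0), f' (0, 1)) - (f (1, 0), f (0, 1)) \<in> BD1"
      then obtain x where x: "f' (1, 0) - f (1, 0) = r x - x" "f' (0, 1) - f (0, 1) = s x - x"
        by (auto simp: BD1_def)
      have "f' g - f g = (if g \<in> Dgrp q then act r s g x - x else 0)" for g
      proof (cases "g \<in> Dgrp q")
        case True
        then obtain k where k: "g = (k, 0) \<or> g = (k, 1)" "k < q"
          by (cases g) (auto simp: Dgrp_def less_2_cases_iff)
        have 0: "f' (k, 0) - f (k, 0) = rp k x - x"
          by (simp only: cocycle_rotation(1)[OF f(1) RD k(2)] cocycle_rotation(1)[OF f(2) RD k(2)]
              sg_diff[symmetric] x sg_telescope)
        have "f' (k, 1) - f (k, 1) =
            sg k (f' (1, 0) - f (1, 0)) + rp k (f' (0, 1) - f (0, 1))"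
          using refl[OF f(1) k(2)] refl[OF f(2) k(2)] by (simp add: sg_diff rp_simps(4))
        also have "\<dots> = rp k (s x) - x" unfolding x sg_telescope by (simp add: rp_simps)
        finally show ?thesis using 0 k(1) True by (auto simp: act_simps)
      qed (simp add: cocycle_outside[OF f(1)] cocycle_outside[OF f(2)])
      then show "(\<lambda>g. f' g - f g) \<in> coboundaries1 r s (Dgrp q)" by (auto simp: coboundaries1_def)
    qed
  qed
  then show ?thesis by (simp add: qcard_ZD1)
qed

lemma qcard_sp_sm_nonzero: "qcard L sp \<noteq> 0" "qcard Lm sm \<noteq> 0"
proof -
  have two: "zsmul 2 y = y + y" for y :: 'm using zsmul_add_left[of 1 1 y] by simp
  show "qcard L sp \<noteq> 0"
  proof (rule qcard_nonzero[where n=2, OF lattice[OF zsubgroup_L] zsubgroup_sp sp_L])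
    show "zsmul 2 x \<in> sp" if "x \<in> L" for x
      using that by (auto simp: two L_def intro!: image_eqI[of _ _ x])
  qed simp
  show "qcard Lm sm \<noteq> 0"
  proof (rule qcard_nonzero[where n=2, OF lattice[OF zsubgroup_Lm] zsubgroup_sm sm_Lm])
    show "zsmul 2 x \<in> sm" if "x \<in> Lm" for x
      using that unfolding sm_eq[symmetric] by (auto simp: two Lm_def intro!: image_eqI[of _ _ x])
  qed simp
qed

end

text \<open>u^2 v^2 / (u w v^2) = u / w. Here v is the 2-part shared by D and Sigma, u the
  eigenspace of the cohomology of R that D sees, and w the other one.\<close>

lemma theta_prod_eq:
  fixes u v w z :: "'l::field"
  assumes "F Tgrp = 1" "F (Dgrp q) = u * v" "F (Rgrp q) = u * w" "F Sgrp = v" "u \<noteq> 0" "v \<noteq> 0" "w \<noteq> 0"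
  shows "theta_prod q F = u / w"
  using assms by (simp add: theta_prod_def power_int_minus power2_eq_square field_simps)

section \<open>Evaluation of the regulator constant and of the Theta products\<close>

context dihedral_pairing
begin

text \<open>Scaling the pairing by 1/|H| divides the determinant by |H| to the rank of the fixed
  points.\<close>

lemma regulator_factor:
  "(of_nat (card (tors \<inter> fixpts r s H)) :: 'l) powi (-2) * regdet r s pair H =
    regD pair (fixpts r s H) / of_nat (card H) ^ rk (fixpts r s H)"
proof -
  let ?bs = "tfbasis (fixpts r s H)"
  have "gram pair c ?bs = c \<cdot>\<^sub>m gramP pair ?bs ?bs" for c
    by (rule eq_matI) (simp_all add: gram_def gramP_def)
  then have "det (gram pair c ?bs) = c ^ rk (fixpts r s H) * det (gramP pair ?bs ?bs)" for c
    by (simp add: gramP_def rk_def)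
  then show ?thesis
    by (simp add: regdet_def regD_def tfbasis_def[symmetric] power_int_minus field_simps)
qed

text \<open>The powers of q, 2 and 2q in \<open>regulator_identity\<close> are exactly the factors
  |H|^rank contributed by R, Sigma and D.\<close>

lemma reg_const_eq: "reg_const q r s pair = of_nat (hp * h0m) / of_nat (hm * h0p)"
proof -
  define M E p l where "M = regD pair UNIV" and "E = regD pair (P \<inter> L)" and "p = regD pair P" and "l = regD pair L"
  note D = M_def[symmetric] E_def[symmetric] p_def[symmetric] l_def[symmetric]
  have c: "card Tgrp = 1" "card (Dgrp q) = 2 * q" "card (Rgrp q) = q" "card Sgrp = 2"
    by (simp_all add: Tgrp_def Dgrp_def Rgrp_def Sgrp_def)
  have nz: "p \<noteq> 0" "l \<noteq> 0" "(of_nat q :: 'l) \<noteq> 0" "(of_nat (2 * q) :: 'l) \<noteq> 0"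
    "(of_nat (hm * h0p) :: 'l) \<noteq> 0"
    using regD_nonzero q_gt_1 h_nonzero by (simp_all add: p_def l_def)
  have "reg_const q r s pair = M * (E / of_nat (2 * q) ^ rk (P \<inter> L)) ^ 2 *
      inverse (p / of_nat q ^ rk P) * inverse ((l / 2 ^ rk L) ^ 2)"
    unfolding reg_const_def theta_prod_def regulator_factor fixpts_eq c D
    by (simp add: power_int_minus)
  also have "\<dots> = (M * E ^ 2 * of_nat q ^ rk P * 2 ^ (2 * rk L)) /
      (p * l ^ 2 * of_nat (2 * q) ^ (2 * rk (P \<inter> L)))"
    using nz by (simp add: power_divide power_mult_distrib power_even_eq divide_simps del: of_nat_mult)
  also have "\<dots> = of_nat (hp * h0m) / of_nat (hm * h0p)"
    using regulator_identity nz unfolding D by (simp add: frac_eq_eq mult_ac)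
  finally show ?thesis .
qed

lemma theta_h0: "theta_prod q (\<lambda>H. of_nat (tate_h0 r s H)) = (of_nat h0p / of_nat h0m :: 'l)"
  by (rule theta_prod_eq[where v = "of_nat (qcard L sp)"])
    (use h_nonzero h_nonzero_neg qcard_sp_sm_nonzero in \<open>simp_all add: tate_h0_eq tate_h0_D qcard_P\<close>)

lemma theta_hm1: "theta_prod q (\<lambda>H. of_nat (tate_hm1 r s H)) = (of_nat hp / of_nat hm :: 'l)"
  by (rule theta_prod_eq[where v = "of_nat (qcard Lm sm)"])
    (use h_nonzero h_nonzero_neg qcard_sp_sm_nonzero in \<open>simp_all add: tate_hm1_eq tate_hm1_D qcard_K\<close>)

lemma theta_h1: "theta_prod q (\<lambda>H. of_nat (tate_h1 q r s H)) = (of_nat hm / of_nat hp :: 'l)"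
  by (rule theta_prod_eq[where v = "of_nat (qcard Lm sm)"])
    (use h_nonzero h_nonzero_neg qcard_sp_sm_nonzero in
      \<open>simp_all add: tate_h1_T tate_h1_R tate_h1_S tate_h1_D qcard_K\<close>)

end

text \<open>D is finite, so the translates of finitely many generators over Z[D] are finitely many
  generators over Z, and all lie in one lattice.\<close>

lemma zlattice_UNIV:
  fixes r s :: "'m::ab_group_add \<Rightarrow> 'm"
  assumes "fg_ZD_module q r s"
  shows "zlattice (UNIV :: 'm set)"
proof -
  obtain S where S: "finite S" "zspan {act r s g y | g y. g \<in> Dgrp q \<and> y \<in> S} = UNIV"
    using assms by (auto simp: fg_ZD_module_def)
  define G where "G = {act r s g y | g y. g \<in> Dgrp q \<and> y \<in> S}"
  have "G = (\<lambda>(g, y). act r s g y) ` (Dgrp q \<times> S)" by (auto simp: G_def)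
  then have "finite G" using S(1) by (simp add: Dgrp_def)
  then obtain A where A: "zlattice A" "G \<subseteq> A"
    using zlattice_finite_superset by meson
  then have "zspan G \<subseteq> A"
    using zlattice_imp_zsubgroup[OF A(1)] by (auto simp: zspan_def)
  moreover have "zspan G = UNIV" using S(2) by (simp add: G_def)
  ultimately show ?thesis using A(1) by (simp add: top.extremum_unique)
qed

theorem mainTheorem9:
  fixes q :: nat and r s :: "'m::ab_group_add \<Rightarrow> 'm"
    and pair :: "'m \<Rightarrow> 'm \<Rightarrow> 'l::field_char_0"
  assumes "odd q" and "q > 1"
    and "is_ZD_module q r s" and "fg_ZD_module q r s"
    and "admissible_pairing r s pair"
  shows "reg_const q r s pair
           = inverse (theta_prod q (\<lambda>H. of_nat (tate_h0 r s H)) * theta_prod q (\<lambda>H. of_nat (tate_h1 q r s H)))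
       \<and> reg_const q r s pair
           = theta_prod q (\<lambda>H. of_nat (tate_hm1 r s H)) / theta_prod q (\<lambda>H. of_nat (tate_h0 r s H))"
proof -
  interpret dihedral_pairing q r s pair
    by unfold_locales (use assms zlattice_UNIV in auto)
  show ?thesis
    unfolding reg_const_eq theta_h0 theta_h1 theta_hm1 by (simp add: field_simps)
qed

end
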